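(* Let $\alpha,\beta,\gamma\in\mathbb{C}^\ast$ and $y_1,y_2\in\mathbb{C}\setminus(-\infty,1]$, with $\Re\alpha>-\frac12$, $\Re(\beta+\gamma)>-1$, $\Re\gamma>1$. Put $$A:=A(y_1,y_2,y_3):=\frac{y_1^2+y_2^2+y_3^2-1}{2\,y_1y_2y_3}.$$ Then $$Q_{\gamma}^{(\alpha,\beta)}(2y_1^2-1)\,Q_{\gamma}^{(\alpha,\beta)}(2y_2^2-1)=\frac{e^{-i\pi(\beta+\frac12)}2^{\alpha+\beta}\sqrt{\pi}\,\Gamma(\beta+\frac12)\Gamma(\alpha+\gamma+1)(y_1y_2)^{\alpha-\beta-1}}{\Gamma(\gamma+1)\Gamma(\alpha+\beta)(y_1^2-1)^\alpha(y_2^2-1)^\alpha}\int_{y_1y_2+\sqrt{(y_1^2-1)(y_2^2-1)}}^\infty Q_\gamma^{(\alpha,\beta)}(2y_3^2-1)\,y_3^{\alpha+\beta}(A^2-1)^{\frac12(\alpha-\beta-1)}D_{\alpha-\beta-1}^{\beta+\frac12}\!\left(\frac{A}{\sqrt{A^2-1}}\right)dy_3$$ $$=\frac{e^{-i\pi\beta}2^{\alpha}\Gamma(\alpha+\gamma+1)(y_1y_2)^{\alpha-\beta-1}}{\Gamma(\gamma+1)\Gamma(\alpha+\beta)(y_1^2-1)^\alpha(y_2^2-1)^\alpha}\int_{y_1y_2+\sqrt{(y_1^2-1)(y_2^2-1)}}^\infty Q_\gamma^{(\alpha,\beta)}(2y_3^2-1)\,y_3^{\alpha+\beta}(A^2-1)^{\frac12(\alpha-1)}Q_{\alpha-1}^{\beta}\!\left(\frac{A}{\sqrt{A^2-1}}\right)dy_3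 .$$
   Context: $\mathbb{C}^\ast=\mathbb{C}\setminus\{0\}$. The regularized Gauss hypergeometric function is $\mathbf{F}(a,b;c;z)=\sum_{n\ge0}\frac{(a)_n(b)_n}{\Gamma(c+n)}\frac{z^n}{n!}$, continued analytically in $z$ to $\mathbb{C}\setminus[1,\infty)$. For $z\in\mathbb{C}\setminus(-\infty,1]$: Jacobi function of the second kind: $Q_\gamma^{(\alpha,\beta)}(z)=\frac{2^{\alpha+\beta+\gamma}\Gamma(\alpha+\gamma+1)\Gamma(\beta+\gamma+1)}{(z-1)^{\alpha+\gamma+1}(z+1)^\beta}\mathbf{F}\big(\gamma+1,\alpha+\gamma+1;\alpha+\beta+2\gamma+2;\frac{2}{1-z}\big)$. Gegenbauer function of the second kind: $D_\lambda^\alpha(z)=\frac{e^{i\pi\alpha}\Gamma(\lambda+2\alpha)}{\Gamma(\alpha)(2z)^{\lambda+2\alpha}}\mathbf{F}\big(\frac{\lambda}{2}+\alpha,\frac{\lambda}{2}+\alpha+\frac12;\lambda+\alpha+1;\frac1{z^2}\big)$ for $|z|>1$, and elsewhere by analytic continuation. Associated Legendre function of the second kind: $Q_\nu^\mu(z)=\frac{\sqrt\pi\,e^{i\pi\mu}\Gamma(\nu+\mu+1)(z^2-1)^{\mu/2}}{2^{\nu+1}z^{\nu+\mu+1}}\mathbf{F}\big(\frac{\nu+\mu+1}{2},\frac{\nu+\mu+2}{2};\nu+\frac32;\frac1{z^2}\big)$ for $|z|>1$, and elsewhere by analytic continuation. Convention: the basic range is $y_1,y_2>1$ real (integration along the real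 axis, all powers and roots of positive numbers positive); for other complex values, multivalued expressions and the integral are understood by analytic continuation from that range. Parameters are assumed such that all Gamma factors and functions appearing are defined. *)

theory Defs
  imports "HOL-Analysis.Analysis"
begin

definition regF_series :: "complex \<Rightarrow> complex \<Rightarrow> complex \<Rightarrow> complex \<Rightarrow> complex" where
  "regF_series a b c z =
     (\<Sum>n. pochhammer a n * pochhammer b n * rGamma (c + of_nat n) * (z ^ n / fact n))"

text \<open>
  The regularized Gauss function. \<open>rGamma\<close> is the entire function \<open>1/\<Gamma>\<close>, so every \<open>c\<close> is allowed.
  Outside the unit disc, \<open>SOME\<close> picks a holomorphic continuation of the series to the plane cut along
  \<open>[1,\<infinity>)\<close>. Any two of them agree on the cut plane. Values on the cut carry no information.
\<close>

definition regF :: "complex \<Rightarrow> complex \<Rightarrow> complex \<Rightarrow> complex \<Rightarrow> complex" where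
  "regF a b c z =
     (if norm z < 1 then regF_series a b c z
      else (SOME f. f holomorphic_on - (complex_of_real ` {1..}) \<and>
                    (\<forall>w. norm w < 1 \<longrightarrow> f w = regF_series a b c w)) z)"

definition cut_plane :: "complex set" where
  "cut_plane = - (complex_of_real ` {..1})"

text \<open>
  The following functions are meant for arguments in \<open>cut_plane\<close>, where all the powers below are
  holomorphic with the principal branch of \<open>powr\<close>.
\<close>

definition jacobi_Q :: "complex \<Rightarrow> complex \<Rightarrow> complex \<Rightarrow> complex \<Rightarrow> complex" where
  "jacobi_Q \<gamma> \<alpha> \<beta> z =
     2 powr (\<alpha> + \<beta> + \<gamma>) * Gamma (\<alpha> + \<gamma> + 1) * Gamma (\<beta> + \<gamma> + 1)
       / ((z - 1) powr (\<alpha> + \<gamma> + 1) * (z + 1) powr \<beta>)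
       * regF (\<gamma> + 1) (\<alpha> + \<gamma> + 1) (\<alpha> + \<beta> + 2 * \<gamma> + 2) (2 / (1 - z))"

text \<open>
  If \<open>z \<in> cut_plane\<close> then \<open>1/z\<^sup>2\<close> avoids \<open>[1,\<infinity>)\<close>. Hence the two formulas below, which are the usual ones
  for \<open>\<bar>z\<bar> > 1\<close>, give the analytic continuation to all of \<open>cut_plane\<close> as they stand. The factor
  \<open>(z\<^sup>2 - 1)\<^bsup>\<mu>/2\<^esup>\<close> is the branch that is holomorphic on \<open>cut_plane\<close> and principal for real \<open>z > 1\<close>, namely
  \<open>(z - 1)\<^bsup>\<mu>/2\<^esup> (z + 1)\<^bsup>\<mu>/2\<^esup>\<close>; the principal power of \<open>z\<^sup>2 - 1\<close> would jump across the imaginary axis.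
\<close>

definition gegenbauer_D :: "complex \<Rightarrow> complex \<Rightarrow> complex \<Rightarrow> complex" where
  "gegenbauer_D l \<alpha> z =
     exp (\<i> * of_real pi * \<alpha>) * Gamma (l + 2 * \<alpha>)
       / (Gamma \<alpha> * (2 * z) powr (l + 2 * \<alpha>))
       * regF (l / 2 + \<alpha>) (l / 2 + \<alpha> + 1 / 2) (l + \<alpha> + 1) (1 / z\<^sup>2)"

definition legendre_Q :: "complex \<Rightarrow> complex \<Rightarrow> complex \<Rightarrow> complex" where
  "legendre_Q \<nu> \<mu> z =
     of_real (sqrt pi) * exp (\<i> * of_real pi * \<mu>) * Gamma (\<nu> + \<mu> + 1)
       * ((z - 1) powr (\<mu> / 2) * (z + 1) powr (\<mu> / 2))
       / (2 powr (\<nu> + 1) * z powr (\<nu> + \<mu> + 1))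
       * regF ((\<nu> + \<mu> + 1) / 2) ((\<nu> + \<mu> + 2) / 2) (\<nu> + 3 / 2) (1 / z\<^sup>2)"

definition A_arg :: "real \<Rightarrow> real \<Rightarrow> real \<Rightarrow> real" where
  "A_arg y1 y2 y3 = (y1\<^sup>2 + y2\<^sup>2 + y3\<^sup>2 - 1) / (2 * y1 * y2 * y3)"

definition lower_limit :: "real \<Rightarrow> real \<Rightarrow> real" where
  "lower_limit y1 y2 = y1 * y2 + sqrt ((y1\<^sup>2 - 1) * (y2\<^sup>2 - 1))"

text \<open>For \<open>y1, y2 > 1\<close> and \<open>y3 > lower_limit y1 y2\<close> one has \<open>A_arg y1 y2 y3 > 1\<close>.\<close>

definition integrand_D ::
  "complex \<Rightarrow> complex \<Rightarrow> complex \<Rightarrow> real \<Rightarrow> real \<Rightarrow> real \<Rightarrow> complex" where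
  "integrand_D \<alpha> \<beta> \<gamma> y1 y2 y3 =
     (let A = A_arg y1 y2 y3 in
       jacobi_Q \<gamma> \<alpha> \<beta> (of_real (2 * y3\<^sup>2 - 1)) * of_real y3 powr (\<alpha> + \<beta>)
         * of_real (A\<^sup>2 - 1) powr ((\<alpha> - \<beta> - 1) / 2)
         * gegenbauer_D (\<alpha> - \<beta> - 1) (\<beta> + 1 / 2) (of_real (A / sqrt (A\<^sup>2 - 1))))"

definition integrand_Q ::
  "complex \<Rightarrow> complex \<Rightarrow> complex \<Rightarrow> real \<Rightarrow> real \<Rightarrow> real \<Rightarrow> complex" where
  "integrand_Q \<alpha> \<beta> \<gamma> y1 y2 y3 =
     (let A = A_arg y1 y2 y3 in
       jacobi_Q \<gamma> \<alpha> \<beta> (of_real (2 * y3\<^sup>2 - 1)) * of_real y3 powr (\<alpha> + \<beta>)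
         * of_real (A\<^sup>2 - 1) powr ((\<alpha> - 1) / 2)
         * legendre_Q (\<alpha> - 1) \<beta> (of_real (A / sqrt (A\<^sup>2 - 1))))"

definition integral_D :: "complex \<Rightarrow> complex \<Rightarrow> complex \<Rightarrow> real \<Rightarrow> real \<Rightarrow> complex" where
  "integral_D \<alpha> \<beta> \<gamma> y1 y2 = (LINT y3:{lower_limit y1 y2<..}|lborel. integrand_D \<alpha> \<beta> \<gamma> y1 y2 y3)"

definition integral_Q :: "complex \<Rightarrow> complex \<Rightarrow> complex \<Rightarrow> real \<Rightarrow> real \<Rightarrow> complex" where
  "integral_Q \<alpha> \<beta> \<gamma> y1 y2 = (LINT y3:{lower_limit y1 y2<..}|lborel. integrand_Q \<alpha> \<beta> \<gamma> y1 y2 y3)"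

definition power_factor :: "complex \<Rightarrow> complex \<Rightarrow> real \<Rightarrow> real \<Rightarrow> complex" where
  "power_factor \<alpha> \<beta> y1 y2 =
     of_real (y1 * y2) powr (\<alpha> - \<beta> - 1)
       / (of_real (y1\<^sup>2 - 1) powr \<alpha> * of_real (y2\<^sup>2 - 1) powr \<alpha>)"

text \<open>
  Holomorphy in two variables: complex differentiability, i.e. existence of a complex linear Frechet
  derivative, at every point of an open set.
\<close>

definition holomorphic2_on :: "(complex \<times> complex \<Rightarrow> complex) \<Rightarrow> (complex \<times> complex) set \<Rightarrow> bool" where
  "holomorphic2_on f S \<longleftrightarrow>
     (\<forall>p\<in>S. \<exists>a b. (f has_derivative (\<lambda>(h, k). a * h + b * k)) (at p))"

text \<open>
  Analytic continuation from the real range \<open>(1,\<infinity>)\<close> in each variable. Since \<open>cut_plane\<close> is open and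
  connected, \<open>g\<close> is uniquely determined by \<open>f\<close> on \<open>cut_plane\<close> (resp. on \<open>cut_plane \<times> cut_plane\<close>).
\<close>

definition continues1 :: "(real \<Rightarrow> complex) \<Rightarrow> (complex \<Rightarrow> complex) \<Rightarrow> bool" where
  "continues1 f g \<longleftrightarrow> g holomorphic_on cut_plane \<and> (\<forall>y>1. g (of_real y) = f y)"

definition continues2 :: "(real \<Rightarrow> real \<Rightarrow> complex) \<Rightarrow> (complex \<times> complex \<Rightarrow> complex) \<Rightarrow> bool" where
  "continues2 f g \<longleftrightarrow>
     holomorphic2_on g (cut_plane \<times> cut_plane) \<and>
     (\<forall>y1>1. \<forall>y2>1. g (of_real y1, of_real y2) = f y1 y2)"

end

(*
  Both kernels reduce to one function kern(A), and Q_gamma(2 y^2 - 1) has two Euler integrals, jac_int1 and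
  jac_int2. For Re alpha > 0 also kern is an Euler-type integral over (-1,1). Writing the y3-integral with
  jac_int2 and this representation of kern, and substituting X = y3^2, the triple integral has a power
  of a function linear in X as innermost integrand, so the X-integration is a Beta integral. What
  remains is a double integral over x > 1, 0 < t < 1, and the rational substitution
    x = (u2 / (1 - t1) + t2) / (t2 + u2),   1 - t = (1 - t1) (1 - t2) x      (u_i = y_i^2 - 1)
  turns its integrand exactly into the product of the integrands of jac_int1 for y1 and jac_int2 for y2.
  The range Re alpha > -1/2 follows by analytic continuation in alpha; the continuation in (y1, y2)
  is immediate since the integrals are quotients of product functions.
*)
theory Submission
  imports Defs "HOL-Complex_Analysis.Complex_Analysis"
begin

subsection \<open>Integration tools\<close>

text \<open>The pivot is \<open>Z_poly\<close>, quadratic in x and linear in X = y3^2. Completing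
  the square in x brings out A and hence \<open>kern\<close>; solving for X makes the same power one
  factor of a Beta integrand. \<open>jac_int2\<close> supplies the other factor: its base u + t
  carries the exponent -a - c - 1, which pairs with the exponent a - 1 of the kernel to give
  \<open>Beta a (c + 1)\<close>.

  The obstacle is the strip -1/2 < Re a \<le> 0. There the Euler-type integral of
  \<open>kern\<close> diverges, and \<open>jac_int2\<close> may diverge too, since it needs Re (a +
  b + c) > -1. So for the continuation in a the y3-integrand is written differently, with
  \<open>jac_int1\<close> and a kernel integral that has been integrated by parts. The resulting
  joint integrand is W^a times a factor free of a, up to a factor that is bounded locally in a. Its
  integrability at two real exponents therefore gives both absolute convergence and holomorphy in a.

  Changes of variables in the plane are done one coordinate at a time, so that only one-dimensional
  substitution and Fubini occur.\<close>

lemma set_integral_substitution: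
  fixes f :: "real \<Rightarrow> 'a :: euclidean_space" and g g' :: "real \<Rightarrow> real"
  assumes S: "S \<in> sets borel" and T: "T \<in> sets borel"
    and der: "\<And>x. x \<in> S \<Longrightarrow> (g has_field_derivative g' x) (at x within S)"
    and bij: "bij_betw g S T"
    and f: "set_borel_measurable borel T f"
    and h: "set_borel_measurable borel S (\<lambda>x. \<bar>g' x\<bar> *\<^sub>R f (g x))"
  shows "set_integrable lborel T f \<longleftrightarrow> set_integrable lborel S (\<lambda>x. \<bar>g' x\<bar> *\<^sub>R f (g x))"
    and "(LINT x:T|lborel. f x) = (LINT x:S|lborel. \<bar>g' x\<bar> *\<^sub>R f (g x))"
proof -
  have inj: "inj_on g S" and im: "g ` S = T"
    using bij by (auto simp: bij_betw_def)
  have S': "S \<in> sets lebesgue" using S by simp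
  have lb: "set_integrable lebesgue A k \<longleftrightarrow> set_integrable lborel A k"
    if "set_borel_measurable borel A k" for A and k :: "real \<Rightarrow> 'a"
    using that unfolding set_integrable_def set_borel_measurable_def
    by (subst integrable_completion) auto
  have li: "(LINT x:A|lebesgue. k x) = (LINT x:A|lborel. k x)"
    if "set_borel_measurable borel A k" for A and k :: "real \<Rightarrow> 'a"
    using that unfolding set_lebesgue_integral_def set_borel_measurable_def
    by (subst integral_completion) auto
  note cv = has_absolute_integral_change_of_variables_real[OF S' der inj, where f = f, unfolded im]
  have iff: "set_integrable lebesgue T f \<longleftrightarrow> set_integrable lebesgue S (\<lambda>x. \<bar>g' x\<bar> *\<^sub>R f (g x))"
    using cv by blast
  show iff': "set_integrable lborel T f \<longleftrightarrow> set_integrable lborel S (\<lambda>x. \<bar>g' x\<bar> *\<^sub>R f (g x))"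
    using iff lb[OF f] lb[OF h] by simp
  show "(LINT x:T|lborel. f x) = (LINT x:S|lborel. \<bar>g' x\<bar> *\<^sub>R f (g x))"
  proof (cases "set_integrable lebesgue T f")
    case True
    then have "integral T f = integral S (\<lambda>x. \<bar>g' x\<bar> *\<^sub>R f (g x))"
      using cv by blast
    then show ?thesis
      using True iff li[OF f] li[OF h] by (simp add: set_lebesgue_integral_eq_integral(2))
  next
    \<comment> \<open>Neither side is integrable then, and both integrals take the default value
      0.\<close>
    case False
    then show ?thesis
      using iff lb[OF f] lb[OF h]
      unfolding set_lebesgue_integral_def set_integrable_def
      by (simp add: not_integrable_integral_eq)
  qed
qed

text \<open>A local bound on f alone suffices: Cauchy's inequality turns it into a bound on the
  derivative in z, the mean value inequality turns that into a bound on difference quotients, and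
  dominated convergence applies along sequences.\<close>

lemma holomorphic_on_lebesgue_integral:
  fixes f :: "complex \<Rightarrow> 'a \<Rightarrow> complex"
  assumes U: "open U"
    and hol: "\<And>x. x \<in> space M \<Longrightarrow> (\<lambda>z. f z x) holomorphic_on U"
    and meas: "\<And>z. z \<in> U \<Longrightarrow> f z \<in> borel_measurable M"
    and dom: "\<And>z0. z0 \<in> U \<Longrightarrow> \<exists>e>0. \<exists>g. integrable M g \<and>
                (\<forall>z\<in>ball z0 e \<inter> U. \<forall>x\<in>space M. norm (f z x) \<le> g x)"
  shows "(\<lambda>z. \<integral>x. f z x \<partial>M) holomorphic_on U"
  unfolding holomorphic_on_open[OF U]
proof
  fix z0 assume z0: "z0 \<in> U"
  obtain e g where e: "e > 0" and g: "integrable M g"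
    and bd: "\<And>z x. z \<in> ball z0 e \<inter> U \<Longrightarrow> x \<in> space M \<Longrightarrow> norm (f z x) \<le> g x"
    using dom[OF z0] by blast
  obtain d where d: "d > 0" "ball z0 d \<subseteq> U"
    using U z0 open_contains_ball by blast
  \<comment> \<open>The closed disc of radius r stays in U and in the region where g dominates.
    Halving once more leaves room for a Cauchy disc of radius s around every point of
    \<open>cball z0 s\<close>.\<close>
  define r where "r = min e d / 2"
  have r: "r > 0" "cball z0 r \<subseteq> ball z0 e \<inter> U"
    using e d by (auto simp: r_def subset_iff)
  define s where "s = r / 2"
  have s: "s > 0" using r by (simp add: s_def)
  have integ: "integrable M (f z)" if "z \<in> cball z0 r" for z
  proof (rule Bochner_Integration.integrable_bound[OF g])
    have z: "z \<in> ball z0 e \<inter> U" using that r by blast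
    then show "f z \<in> borel_measurable M" using meas by blast
    show "AE x in M. norm (f z x) \<le> norm (g x)"
      using bd[OF z] by (auto intro!: AE_I2 order_trans[OF _ abs_ge_self])
  qed
  have der: "norm (deriv (\<lambda>z. f z x) z) \<le> g x / s" if "z \<in> cball z0 s" "x \<in> space M" for z x
  proof -
    have sub: "cball z s \<subseteq> cball z0 r"
      using that(1) by (simp add: s_def cball_subset_cball_iff dist_commute)
    have "(\<lambda>z. f z x) holomorphic_on cball z s"
      using hol[OF that(2)] by (rule holomorphic_on_subset) (use sub r in auto)
    then have h: "(\<lambda>z. f z x) holomorphic_on ball z s" "continuous_on (cball z s) (\<lambda>z. f z x)"
      using holomorphic_on_subset ball_subset_cball holomorphic_on_imp_continuous_on by blast+
    have "norm ((deriv ^^ 1) (\<lambda>z. f z x) z) \<le> fact 1 * g x / s ^ 1"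
      by (rule Cauchy_inequality[OF h s], rule bd)
         (use sub r that in \<open>auto simp: subset_iff dist_norm\<close>)
    then show ?thesis by simp
  qed
  define f' where "f' x = deriv (\<lambda>z. f z x) z0" for x
  have dq: "((\<lambda>z. (f z x - f z0 x) / (z - z0)) \<longlongrightarrow> f' x) (at z0)" if "x \<in> space M" for x
    using holomorphic_derivI[OF hol[OF that] U z0] unfolding f'_def has_field_derivative_iff .
  have lip: "norm ((f z x - f z0 x) / (z - z0)) \<le> g x / s" if "z \<in> cball z0 s" "x \<in> space M" for z x
  proof -
    have gx: "g x \<ge> 0"
      using bd[of z0 x] e z0 that(2) norm_ge_zero order_trans by (metis IntI centre_in_ball)
    have "norm (f z x - f z0 x) \<le> g x / s * norm (z - z0)"
    proof (rule field_differentiable_bound[of "cball z0 s" "\<lambda>z. f z x" "deriv (\<lambda>z. f z x)"])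
      fix w assume w: "w \<in> cball z0 s"
      then have "w \<in> U" using r s_def s by force
      then show "((\<lambda>z. f z x) has_field_derivative deriv (\<lambda>z. f z x) w) (at w within cball z0 s)"
        using holomorphic_derivI[OF hol[OF that(2)] U] has_field_derivative_at_within by blast
      show "norm (deriv (\<lambda>z. f z x) w) \<le> g x / s" by (rule der[OF w that(2)])
    qed (use that s in auto)
    then show ?thesis using gx s
      by (cases "z = z0") (auto simp: norm_divide divide_simps)
  qed
  have "((\<lambda>z. ((\<integral>x. f z x \<partial>M) - (\<integral>x. f z0 x \<partial>M)) / (z - z0)) \<longlongrightarrow> (\<integral>x. f' x \<partial>M)) (at z0)"
    unfolding tendsto_at_iff_sequentially comp_def
  proof safe
    fix X :: "nat \<Rightarrow> complex"
    assume X: "\<forall>i. X i \<in> UNIV - {z0}" "X \<longlonglongrightarrow> z0"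
    obtain N where N: "\<And>n. n \<ge> N \<Longrightarrow> dist (X n) z0 < s"
      using X(2) s metric_LIMSEQ_D by blast
    \<comment> \<open>Only the tail of the sequence lies in \<open>cball z0 s\<close>, where the
      quotient bound holds; \<open>LIMSEQ_offset\<close> restores the full sequence.\<close>
    define Y where "Y n = X (n + N)" for n
    have Y: "Y n \<in> cball z0 s" "Y n \<noteq> z0" for n
      using N[of "n + N"] X(1) by (auto simp: Y_def dist_commute less_imp_le)
    have Yr: "Y n \<in> cball z0 r" for n using Y(1)[of n] s by (auto simp: s_def)
    have YU: "Y n \<in> U" for n using Yr r by blast
    have Yt: "filterlim Y (at z0) sequentially"
      unfolding filterlim_at Y_def using Y X(2) by (auto simp: LIMSEQ_ignore_initial_segment Y_def)
    have eq: "((\<integral>x. f (Y n) x \<partial>M) - (\<integral>x. f z0 x \<partial>M)) / (Y n - z0)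
              = (\<integral>x. (f (Y n) x - f z0 x) / (Y n - z0) \<partial>M)" for n
      using integ[OF Yr[of n]] integ[of z0] r by simp
    have meas': "f' \<in> borel_measurable M"
      by (rule borel_measurable_LIMSEQ_metric[where f = "\<lambda>n x. (f (Y n) x - f z0 x) / (Y n - z0)"])
         (use meas[OF YU] meas[OF z0] filterlim_compose[OF dq Yt] in auto)
    have "(\<lambda>n. \<integral>x. (f (Y n) x - f z0 x) / (Y n - z0) \<partial>M) \<longlonglongrightarrow> (\<integral>x. f' x \<partial>M)"
    proof (rule integral_dominated_convergence[where w = "\<lambda>x. g x / s"])
      show "AE x in M. (\<lambda>n. (f (Y n) x - f z0 x) / (Y n - z0)) \<longlonglongrightarrow> f' x"
        using filterlim_compose[OF dq Yt] by (auto intro!: AE_I2)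
      show "AE x in M. norm ((f (Y n) x - f z0 x) / (Y n - z0)) \<le> g x / s" for n
        using lip[OF Y(1)] by (auto intro!: AE_I2)
    qed (use meas' meas[OF YU] meas[OF z0] g in auto)
    then have "(\<lambda>n. ((\<integral>x. f (X (n + N)) x \<partial>M) - (\<integral>x. f z0 x \<partial>M)) / (X (n + N) - z0)) \<longlonglongrightarrow> (\<integral>x. f' x \<partial>M)"
      by (simp only: eq flip: Y_def)
    then show "(\<lambda>n. ((\<integral>x. f (X n) x \<partial>M) - (\<integral>x. f z0 x \<partial>M)) / (X n - z0)) \<longlonglongrightarrow> (\<integral>x. f' x \<partial>M)"
      by (rule LIMSEQ_offset[where k = N])
  qed
  then show "\<exists>f'. ((\<lambda>z. \<integral>x. f z x \<partial>M) has_field_derivative f') (at z0)"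
    unfolding has_field_derivative_iff by blast
qed

subsection \<open>Complex powers of positive reals\<close>

text \<open>Holomorphic in the exponent for every base and never zero, unlike \<open>powr\<close> at
  base 0. Identities between products of such powers reduce to linear identities between exponents
  of logarithms, which is how the large monomial comparisons below are settled.\<close>

definition rpow :: "real \<Rightarrow> complex \<Rightarrow> complex" where
  "rpow x a = exp (a * of_real (ln x))"

lemma powr_eq_rpow: "x > 0 \<Longrightarrow> of_real x powr a = rpow x a"
  by (simp add: rpow_def powr_def Ln_of_real)

lemma rpow_mult: "x > 0 \<Longrightarrow> y > 0 \<Longrightarrow> rpow (x * y) a = rpow x a * rpow y a"
  by (simp add: rpow_def ln_mult distrib_left exp_add)

lemma rpow_divide: "x > 0 \<Longrightarrow> y > 0 \<Longrightarrow> rpow (x / y) a = rpow x a / rpow y a"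
  by (simp add: rpow_def ln_div right_diff_distrib exp_diff)

lemma rpow_add: "rpow x (a + b) = rpow x a * rpow x b"
  by (simp add: rpow_def distrib_right exp_add)

lemma rpow_diff: "rpow x (a - b) = rpow x a / rpow x b"
  by (simp add: rpow_def left_diff_distrib exp_diff)

lemma rpow_minus: "rpow x (- a) = 1 / rpow x a"
  by (simp add: rpow_def exp_minus inverse_eq_divide)

lemma rpow_0 [simp]: "rpow x 0 = 1"
  by (simp add: rpow_def)

lemma rpow_1_left [simp]: "rpow 1 a = 1"
  by (simp add: rpow_def)

lemma rpow_1: "x > 0 \<Longrightarrow> rpow x 1 = of_real x"
  by (simp add: rpow_def exp_of_real)

lemma rpow_nonzero [simp]: "rpow x a \<noteq> 0"
  by (simp add: rpow_def)

lemma rpow_power: "x > 0 \<Longrightarrow> rpow (x ^ n) a = rpow x (of_nat n * a)"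
  by (simp add: rpow_def ln_realpow mult_ac)

lemma norm_rpow: "x > 0 \<Longrightarrow> norm (rpow x a) = x powr Re a"
  by (simp add: rpow_def powr_def)

lemma rpow_of_real: "x > 0 \<Longrightarrow> rpow x (of_real a) = of_real (x powr a)"
  by (simp add: rpow_def powr_def exp_of_real flip: of_real_mult)

lemma measurable_rpow [measurable]:
  "f \<in> borel_measurable M \<Longrightarrow> (\<lambda>x. rpow (f x) a) \<in> borel_measurable M"
  unfolding rpow_def by measurable

lemma holomorphic_on_rpow [holomorphic_intros]:
  "f holomorphic_on S \<Longrightarrow> (\<lambda>z. rpow x (f z)) holomorphic_on S"
  unfolding rpow_def by (intro holomorphic_intros)

text \<open>Adding the powers at both ends of the exponent interval covers x < 1 and x \<ge> 1 at
  once. Integrability at two real exponents thus dominates a whole vertical strip of complex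
  ones.\<close>

lemma norm_rpow_le:
  assumes "x > 0" "\<bar>Re a - r\<bar> \<le> e"
  shows "norm (rpow x a) \<le> x powr (r - e) + x powr (r + e)"
proof (cases "x \<ge> 1")
  case True
  then have "x powr Re a \<le> x powr (r + e)" using assms by (intro powr_mono) auto
  then show ?thesis using assms by (simp add: norm_rpow add_increasing)
next
  case False
  then have "x powr Re a \<le> x powr (r - e)" using assms by (intro powr_mono') auto
  then show ?thesis using assms by (simp add: norm_rpow add_increasing2)
qed

subsection \<open>Beta integrals\<close>

lemma analytic_eq_from_real:
  assumes "f holomorphic_on S" "g holomorphic_on S" "open S" "connected S" "(a::real) < b"
    and "of_real ` {a<..<b} \<subseteq> S"
    and "\<And>x. x \<in> {a<..<b} \<Longrightarrow> f (of_real x) = g (of_real x)"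
    and "z \<in> S"
  shows "f z = g z"
proof -
  define m where "m = (a + b) / 2"
  have m: "m \<in> {a<..<b}" using assms(5) by (simp add: m_def field_simps)
  have "m islimpt {a<..<b}"
    using m interior_limit_point[of m "{a<..<b}"] by (simp add: interior_open)
  then have lim: "(of_real m :: complex) islimpt (of_real ` {a<..<b})"
    by (rule islimpt_isCont_image) (auto simp: eventually_at_filter)
  have "f z - g z = 0"
    by (rule analytic_continuation[of "\<lambda>z. f z - g z" S "of_real ` {a<..<b}" "of_real m"])
       (use assms m lim in \<open>auto intro!: holomorphic_intros\<close>)
  then show ?thesis by simp
qed

lemma Beta_holomorphic_left:
  "Re b > 0 \<Longrightarrow> (\<lambda>a. Beta a b) holomorphic_on {z. Re z > 0}"
  unfolding Beta_altdef
  by (intro holomorphic_intros) (auto elim!: nonpos_Ints_cases)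

lemma Beta_integral_integrable:
  assumes "Re a > 0" "Re b > 0"
  shows "set_integrable lborel {0<..<1} (\<lambda>t. rpow t (a - 1) * rpow (1 - t) (b - 1))"
proof -
  have "set_integrable lborel {0<..<1} (\<lambda>t. t powr (Re a - 1) * (1 - t) powr (Re b - 1))"
    by (rule set_integrable_subset[OF integrable_Beta[OF assms]]) auto
  then show ?thesis
    unfolding set_integrable_def
    by (rule Bochner_Integration.integrable_bound)
       (auto intro!: AE_I2 simp: indicator_def norm_mult norm_rpow)
qed

lemma Beta_integral_holomorphic:
  assumes "Re b > 0"
  shows "(\<lambda>a. LINT t:{0<..<1}|lborel. rpow t (a - 1) * rpow (1 - t) (b - 1)) holomorphic_on {z. Re z > 0}"
  unfolding set_lebesgue_integral_def
proof (rule holomorphic_on_lebesgue_integral)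
  fix z0 :: complex assume z0: "z0 \<in> {z. Re z > 0}"
  define e where "e = Re z0 / 2"
  have e: "e > 0" "Re z0 - e > 0" using z0 by (auto simp: e_def)
  define g where "g t = indicator {0<..<1} t *\<^sub>R ((t powr (Re z0 - e - 1) + t powr (Re z0 + e - 1))
    * (1 - t) powr (Re b - 1))" for t :: real
  have Beta: "set_integrable lborel {0<..<1} (\<lambda>t. t powr (c - 1) * (1 - t) powr (Re b - 1))" if "c > 0" for c
    by (rule set_integrable_subset[OF integrable_Beta[OF that assms]]) auto
  have "set_integrable lborel {0<..<1} (\<lambda>t. t powr (Re z0 - e - 1) * (1 - t) powr (Re b - 1)
      + t powr (Re z0 + e - 1) * (1 - t) powr (Re b - 1))"
    by (intro set_integral_add Beta) (use e in auto)
  then have "integrable lborel g"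
    unfolding set_integrable_def g_def by (simp only: distrib_right)
  moreover have "norm (indicator {0<..<1} x *\<^sub>R (rpow x (z - 1) * rpow (1 - x) (b - 1))) \<le> g x"
    if "z \<in> ball z0 e \<inter> {z. Re z > 0}" for z and x :: real
  proof -
    have "\<bar>Re (z0 - z)\<bar> < e" using that abs_Re_le_cmod[of "z0 - z"] by (auto simp: dist_norm)
    then have "norm (rpow x (z - 1)) \<le> x powr (Re z0 - e - 1) + x powr (Re z0 + e - 1)" if "x > 0"
      using norm_rpow_le[OF that, of "z - 1" "Re z0 - 1" e] by (simp add: algebra_simps)
    then show ?thesis
      unfolding g_def indicator_def norm_mult norm_scaleR
      by (auto simp: norm_rpow intro!: mult_right_mono)
  qed
  ultimately show "\<exists>e>0. \<exists>g. integrable lborel g \<and> (\<forall>z\<in>ball z0 e \<inter> {z. 0 < Re z}. \<forall>x\<in>space lborel.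
      norm (indicator {0<..<1} x *\<^sub>R (rpow x (z - 1) * rpow (1 - x) (b - 1))) \<le> g x)"
    using e by blast
qed (auto intro!: holomorphic_intros open_halfspace_Re_gt)

lemma Beta_integral_sym:
  "(LINT t:{0<..<1}|lborel. rpow t (a - 1) * rpow (1 - t) (b - 1)) =
   (LINT t:{0<..<1}|lborel. rpow t (b - 1) * rpow (1 - t) (a - 1))"
  by (subst set_integral_substitution(2)[of "{0<..<1}" _ "\<lambda>t. 1 - t" "\<lambda>_. - 1"])
     (auto intro!: derivative_eq_intros bij_betw_byWitness[where f' = "\<lambda>t. 1 - t"]
           simp: set_borel_measurable_def mult.commute)

text \<open>Continuation one parameter at a time: from two real parameters to a complex first one,
  then the symmetry t -> 1 - t exchanges the roles, and the other parameter is continued in the same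
  way.\<close>

lemma Beta_integral_complex:
  assumes "Re a > 0" "Re b > 0"
  shows "(LINT t:{0<..<1}|lborel. rpow t (a - 1) * rpow (1 - t) (b - 1)) = Beta a b"
proof -
  let ?I = "\<lambda>a b. LINT t:{0<..<1}|lborel. rpow t (a - 1) * rpow (1 - t) (b - 1)"
  have halfplane: "open {z. Re z > 0}" "connected {z. Re z > 0}"
    by (auto simp: open_halfspace_Re_gt convex_halfspace_Re_gt convex_connected)
  have rr: "?I (of_real x) (of_real y) = Beta (of_real x) (of_real y)" if "x > 0" "y > 0" for x y
  proof -
    have "?I (of_real x) (of_real y)
        = (LINT t:{0<..<1}|lborel. of_real (t powr (x - 1) * (1 - t) powr (y - 1)))"
    proof (intro set_lebesgue_integral_cong allI impI)
      fix t :: real assume "t \<in> {0<..<1}"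
      then show "rpow t (of_real x - 1) * rpow (1 - t) (of_real y - 1) = of_real (t powr (x - 1) * (1 - t) powr (y - 1))"
        using rpow_of_real[of t "x - 1"] rpow_of_real[of "1 - t" "y - 1"] by simp
    qed auto
    also have "\<dots> = of_real (LINT t:{0<..<1}|lborel. t powr (x - 1) * (1 - t) powr (y - 1))"
      unfolding set_lebesgue_integral_def by (simp flip: integral_complex_of_real add: scaleR_conv_of_real)
    also have "(LINT t:{0<..<1}|lborel. t powr (x - 1) * (1 - t) powr (y - 1)) = Beta x y"
    proof -
      have "set_integrable lborel {0<..<1} (\<lambda>t. t powr (x - 1) * (1 - t) powr (y - 1))"
        by (rule set_integrable_subset[OF integrable_Beta[OF that]]) auto
      then have "(LINT t:{0<..<1}|lborel. t powr (x - 1) * (1 - t) powr (y - 1))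
          = integral {0<..<1} (\<lambda>t. t powr (x - 1) * (1 - t) powr (y - 1))"
        by (rule set_borel_integral_eq_integral(2))
      also have "\<dots> = Beta x y"
        using has_integral_Beta_real[OF that] by (simp only: has_integral_Icc_iff_Ioo integral_unique)
      finally show ?thesis .
    qed
    finally show ?thesis by (simp add: Beta_complex_of_real)
  qed
  have cr: "?I x (of_real y) = Beta x (of_real y)" if "Re x > 0" "y > 0" for x y
    by (rule analytic_eq_from_real[where f = "\<lambda>x. ?I x (of_real y)" and S = "{z. Re z > 0}" and a = 0 and b = 1])
       (use that rr halfplane in \<open>auto intro!: Beta_holomorphic_left Beta_integral_holomorphic\<close>)
  have rc: "?I (of_real y) a = Beta (of_real y) a" if "y > 0" for y
    using cr[OF assms(1) that] by (simp add: Beta_integral_sym[of "of_real y" a] Beta_commute)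
  have "?I b a = Beta b a"
    by (rule analytic_eq_from_real[where f = "\<lambda>x. ?I x a" and S = "{z. Re z > 0}" and a = 0 and b = 1])
       (use assms rc halfplane in \<open>auto intro!: Beta_holomorphic_left Beta_integral_holomorphic\<close>)
  then show ?thesis by (simp add: Beta_integral_sym[of a] Beta_commute)
qed

text \<open>With s = x0 + r the substitution x = x0 + s t / (1 - t) gives x + r = s / (1 - t), so
  both bases become monomials in s, t and 1 - t.\<close>

lemma Beta_integral_Ioi:
  assumes "Re a > 0" "Re b > 0" "x0 + r > (0 :: real)"
  shows "set_integrable lborel {x0<..} (\<lambda>x. rpow (x - x0) (a - 1) * rpow (x + r) (- a - b))" (is ?A)
    and "(LINT x:{x0<..}|lborel. rpow (x - x0) (a - 1) * rpow (x + r) (- a - b)) = rpow (x0 + r) (- b) * Beta a b" (is ?B)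
proof -
  let ?f = "\<lambda>x. rpow (x - x0) (a - 1) * rpow (x + r) (- a - b)"
  define s where "s = x0 + r"
  have s: "s > 0" using assms by (simp add: s_def)
  define g where "g t = x0 + s * t / (1 - t)" for t
  define g' where "g' t = s / (1 - t)\<^sup>2" for t
  have der: "(g has_field_derivative g' t) (at t within {0<..<1})" if "t \<in> {0<..<1}" for t
  proof -
    have "((\<lambda>t. x0 + s * t / (1 - t)) has_field_derivative (s * (1 - t) - s * t * (- 1)) / ((1 - t) * (1 - t)))
      (at t within {0<..<1})"
      by (rule derivative_eq_intros refl | use that in simp)+
    also have "(s * (1 - t) - s * t * (- 1)) / ((1 - t) * (1 - t)) = g' t"
      by (simp add: g'_def power2_eq_square algebra_simps)
    finally show ?thesis by (simp add: g_def[abs_def])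
  qed
  have bij: "bij_betw g {0<..<1} {x0<..}"
  proof (rule bij_betw_byWitness[where f' = "\<lambda>x. (x - x0) / (x - x0 + s)"])
    show "\<forall>t\<in>{0<..<1}. (g t - x0) / (g t - x0 + s) = t"
    proof
      fix t :: real assume t: "t \<in> {0<..<1}"
      have "g t - x0 + s = s / (1 - t)" using t by (simp add: g_def field_simps)
      then show "(g t - x0) / (g t - x0 + s) = t" using t s by (simp add: g_def)
    qed
    show "\<forall>x\<in>{x0<..}. g ((x - x0) / (x - x0 + s)) = x"
    proof
      fix x assume x: "x \<in> {x0<..}"
      have "1 - (x - x0) / (x - x0 + s) = s / (x - x0 + s)" using x s by (simp add: field_simps)
      then show "g ((x - x0) / (x - x0 + s)) = x" using x s by (simp add: g_def)
    qed
  qed (use s in \<open>auto simp: g_def\<close>)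
  have eq: "\<bar>g' t\<bar> *\<^sub>R ?f (g t) = rpow s (- b) * (rpow t (a - 1) * rpow (1 - t) (b - 1))"
    if "t \<in> {0<..<1}" for t
  proof -
    have 1: "g t - x0 = s * t / (1 - t)" "g t + r = s / (1 - t)"
      using that by (auto simp: g_def s_def field_simps)
    have 2: "\<bar>g' t\<bar> *\<^sub>R z = rpow s 1 * rpow (1 - t) (-2) * z" for z
      using that s rpow_power[of "1 - t" 2 "-1"]
      by (simp add: g'_def rpow_1 rpow_minus scaleR_conv_of_real power2_eq_square rpow_mult)
    have "rpow s 1 * rpow (1 - t) (-2) * (rpow (s * t / (1 - t)) (a - 1) * rpow (s / (1 - t)) (- a - b))
       = rpow s (- b) * (rpow t (a - 1) * rpow (1 - t) (b - 1))"
      using that s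
      by (simp add: rpow_def ln_mult ln_div flip: exp_add exp_diff) (simp add: algebra_simps)
    then show ?thesis unfolding 1 2 .
  qed
  note sub = set_integral_substitution[where f = ?f, OF _ _ der bij]
  have m: "set_borel_measurable borel {0<..<1} (\<lambda>x. \<bar>g' x\<bar> *\<^sub>R ?f (g x))"
    unfolding set_borel_measurable_def g_def g'_def by measurable
  have m': "set_borel_measurable borel {x0<..} ?f"
    unfolding set_borel_measurable_def by measurable
  have "set_integrable lborel {0<..<1} (\<lambda>t. \<bar>g' t\<bar> *\<^sub>R ?f (g t))
     \<longleftrightarrow> set_integrable lborel {0<..<1} (\<lambda>t. rpow s (- b) * (rpow t (a - 1) * rpow (1 - t) (b - 1)))"
    using eq by (intro set_integrable_cong) auto
  also have "\<dots>" using Beta_integral_integrable[OF assms(1,2)] by (rule set_integrable_mult_right)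
  finally show ?A using sub(1) m m' by simp
  have "(LINT t:{0<..<1}|lborel. \<bar>g' t\<bar> *\<^sub>R ?f (g t)) =
    (LINT t:{0<..<1}|lborel. rpow s (- b) * (rpow t (a - 1) * rpow (1 - t) (b - 1)))"
    using eq by (intro set_lebesgue_integral_cong) auto
  then show ?B using sub(2) m m' Beta_integral_complex[OF assms(1,2)] by (simp add: s_def)
qed

text \<open>The substitution acts on the second coordinate with the first as a parameter. On each
  fibre it preserves the integral of the function and that of its norm, so Fubini carries
  integrability from the transformed side S back to T.\<close>

lemma fibre_substitution:
  fixes F :: "real \<times> real \<Rightarrow> complex" and g g' :: "real \<Rightarrow> real \<Rightarrow> real"
  assumes S: "S \<in> sets borel" and T: "T \<in> sets borel"
    and der: "\<And>y x. (y, x) \<in> S \<Longrightarrow> (g y has_field_derivative g' y x) (at x within {x. (y, x) \<in> S})"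
    and bij: "\<And>y. bij_betw (g y) {x. (y, x) \<in> S} {x. (y, x) \<in> T}"
    and F: "set_borel_measurable borel T F"
    and H: "set_borel_measurable borel S (\<lambda>(y, x). \<bar>g' y x\<bar> *\<^sub>R F (y, g y x))"
    and int: "set_integrable lborel S (\<lambda>(y, x). \<bar>g' y x\<bar> *\<^sub>R F (y, g y x))"
  shows "set_integrable lborel T F"
    and "(LINT p:T|lborel. F p) = (LINT (y, x):S|lborel. \<bar>g' y x\<bar> *\<^sub>R F (y, g y x))"
proof -
  let ?H = "\<lambda>(y, x). \<bar>g' y x\<bar> *\<^sub>R F (y, g y x)"
  define FT where "FT p = indicator T p *\<^sub>R F p" for p
  define HS where "HS p = indicator S p *\<^sub>R ?H p" for p
  have FT: "FT \<in> borel_measurable (lborel \<Otimes>\<^sub>M lborel)"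
    using F unfolding set_borel_measurable_def FT_def lborel_prod by simp
  have HS: "HS \<in> borel_measurable (lborel \<Otimes>\<^sub>M lborel)"
    using H unfolding set_borel_measurable_def HS_def lborel_prod by simp
  have HSi: "integrable (lborel \<Otimes>\<^sub>M lborel) HS"
    using int unfolding set_integrable_def HS_def lborel_prod .
  have S': "{x. (y, x) \<in> S} \<in> sets borel" and T': "{x. (y, x) \<in> T} \<in> sets borel" for y
    using sets_Pair1[of S borel borel y] sets_Pair1[of T borel borel y] S T
    by (simp_all add: borel_prod vimage_def)
  have f1: "indicator {x. (y, x) \<in> T} x *\<^sub>R F (y, x) = FT (y, x)"
    and f2: "indicator {x. (y, x) \<in> S} x *\<^sub>R (\<bar>g' y x\<bar> *\<^sub>R F (y, g y x)) = HS (y, x)"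
    and f3: "indicator {x. (y, x) \<in> T} x *\<^sub>R norm (F (y, x)) = norm (FT (y, x))"
    and f4: "indicator {x. (y, x) \<in> S} x *\<^sub>R (\<bar>g' y x\<bar> *\<^sub>R norm (F (y, g y x))) = norm (HS (y, x))" for y x
    by (auto simp: FT_def HS_def indicator_def)
  have FTy: "(\<lambda>x. FT (y, x)) \<in> borel_measurable borel" and HSy: "(\<lambda>x. HS (y, x)) \<in> borel_measurable borel" for y
    using measurable_Pair2[OF FT, of y] measurable_Pair2[OF HS, of y] by simp_all
  have der': "(g y has_field_derivative g' y x) (at x within {x. (y, x) \<in> S})" if "x \<in> {x. (y, x) \<in> S}" for y x
    using der that by simp
  have m1: "set_borel_measurable borel {x. (y, x) \<in> T} (\<lambda>x. F (y, x))"
    and m2: "set_borel_measurable borel {x. (y, x) \<in> S} (\<lambda>x. \<bar>g' y x\<bar> *\<^sub>R F (y, g y x))"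
    and m3: "set_borel_measurable borel {x. (y, x) \<in> T} (\<lambda>x. norm (F (y, x)))"
    and m4: "set_borel_measurable borel {x. (y, x) \<in> S} (\<lambda>x. \<bar>g' y x\<bar> *\<^sub>R norm (F (y, g y x)))" for y
    unfolding set_borel_measurable_def f1 f2 f3 f4
    using FTy[of y] HSy[of y] by simp_all
  have a: "integrable lborel (\<lambda>x. FT (y, x)) \<longleftrightarrow> integrable lborel (\<lambda>x. HS (y, x))" for y
    using set_integral_substitution(1)[OF S' T' der' bij m1 m2, of y]
    unfolding set_integrable_def f1 f2 .
  have b: "(\<integral>x. FT (y, x) \<partial>lborel) = (\<integral>x. HS (y, x) \<partial>lborel)" for y
    using set_integral_substitution(2)[OF S' T' der' bij m1 m2, of y]
    unfolding set_lebesgue_integral_def f1 f2 .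
  have c: "(\<integral>x. norm (FT (y, x)) \<partial>lborel) = (\<integral>x. norm (HS (y, x)) \<partial>lborel)" for y
    using set_integral_substitution(2)[OF S' T' der' bij m3 m4, of y]
    unfolding set_lebesgue_integral_def f3 f4 .
  have FTi: "integrable (lborel \<Otimes>\<^sub>M lborel) FT"
  proof (rule lborel_pair.Fubini_integrable[OF FT])
    show "integrable lborel (\<lambda>x. \<integral>y. norm (FT (x, y)) \<partial>lborel)"
      unfolding c using lborel_pair.integrable_fst'[OF integrable_norm[OF HSi]] .
    show "AE x in lborel. integrable lborel (\<lambda>y. FT (x, y))"
      unfolding a using lborel_pair.AE_integrable_fst'[OF HSi] .
  qed
  then show "set_integrable lborel T F"
    unfolding set_integrable_def FT_def lborel_prod .
  have "integral\<^sup>L (lborel \<Otimes>\<^sub>M lborel) FT = integral\<^sup>L (lborel \<Otimes>\<^sub>M lborel) HS"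
    using lborel_pair.integral_fst'[OF FTi] lborel_pair.integral_fst'[OF HSi] b by simp
  then show "(LINT p:T|lborel. F p) = (LINT (y, x):S|lborel. \<bar>g' y x\<bar> *\<^sub>R F (y, g y x))"
    unfolding set_lebesgue_integral_def FT_def HS_def lborel_prod by (simp add: case_prod_unfold)
qed

subsection \<open>The rational substitution in the plane\<close>

lemma set_integrable_pair_mult:
  fixes f g :: "real \<Rightarrow> complex"
  assumes "set_integrable lborel S f" "set_integrable lborel T g"
  shows "set_integrable lborel (S \<times> T) (\<lambda>(x, y). f x * g y)"
    and "(LINT (x, y):S \<times> T|lborel. f x * g y) = (LINT x:S|lborel. f x) * (LINT y:T|lborel. g y)"
proof -
  define f' where "f' x = indicator S x *\<^sub>R f x" for x
  define g' where "g' y = indicator T y *\<^sub>R g y" for y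
  have int: "integrable lborel f'" "integrable lborel g'"
    using assms by (auto simp: f'_def[abs_def] g'_def[abs_def] set_integrable_def)
  have [measurable]: "f' \<in> borel_measurable borel" "g' \<in> borel_measurable borel"
    using int by (auto dest: borel_measurable_integrable)
  have eq: "indicator (S \<times> T) p *\<^sub>R (case p of (x, y) \<Rightarrow> f x * g y) = f' (fst p) * g' (snd p)" for p
    by (cases p) (auto simp: f'_def g'_def indicator_def)
  have *: "integrable (lborel \<Otimes>\<^sub>M lborel) (\<lambda>p. f' (fst p) * g' (snd p))"
    by (rule lborel_pair.Fubini_integrable) (use int in \<open>auto simp: norm_mult\<close>)
  then show "set_integrable lborel (S \<times> T) (\<lambda>(x, y). f x * g y)"
    unfolding set_integrable_def eq lborel_prod .
  show "(LINT (x, y):S \<times> T|lborel. f x * g y) = (LINT x:S|lborel. f x) * (LINT y:T|lborel. g y)"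
    unfolding set_lebesgue_integral_def eq lborel_prod[symmetric]
    unfolding f'_def[symmetric] g'_def[symmetric]
    using lborel_pair.integral_fst'[OF *] int by simp
qed

lemma set_integrable_pair_swap:
  fixes F :: "real \<times> real \<Rightarrow> complex"
  assumes "set_integrable lborel (S \<times> T) (\<lambda>(x, y). F (x, y))"
  shows "set_integrable lborel (T \<times> S) (\<lambda>(y, x). F (x, y))"
    and "(LINT (y, x):T \<times> S|lborel. F (x, y)) = (LINT (x, y):S \<times> T|lborel. F (x, y))"
proof -
  define G where "G p = indicator (S \<times> T) p *\<^sub>R F p" for p
  have eq: "indicator (T \<times> S) p *\<^sub>R (case p of (y, x) \<Rightarrow> F (x, y)) = (case p of (x, y) \<Rightarrow> G (y, x))" for p
    by (cases p) (auto simp: G_def indicator_def)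
  have G: "integrable (lborel \<Otimes>\<^sub>M lborel) G"
    using assms by (simp add: G_def[abs_def] set_integrable_def lborel_prod case_prod_unfold)
  show "set_integrable lborel (T \<times> S) (\<lambda>(y, x). F (x, y))"
    unfolding set_integrable_def eq lborel_prod[symmetric]
    using lborel_pair.integrable_product_swap[OF G] by simp
  show "(LINT (y, x):T \<times> S|lborel. F (x, y)) = (LINT (x, y):S \<times> T|lborel. F (x, y))"
    unfolding set_lebesgue_integral_def eq lborel_prod[symmetric]
    using lborel_pair.integral_product_swap[of G] borel_measurable_integrable[OF G]
    by (simp add: G_def[abs_def] case_prod_unfold)
qed

context
  fixes u1 u2 :: real and a b c :: complex
  assumes u: "u1 > 0" "u2 > 0"
begin

text \<open>This is (x - 1) * (X0 - 1 + t), where X0 is the zero of \<open>Z_poly u1 u2 X x\<close>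
  as a function of X: the quantity that the Beta integral in X leaves behind, with its denominator
  cleared.\<close>

definition D_poly :: "real \<Rightarrow> real \<Rightarrow> real" where
  "D_poly x t = x * ((1 + u1) * (1 + u2) * x - 1 - u1 - u2) - (1 - t) * (x - 1)"

text \<open>The triple integrand after integration over X, without the factor
  \<open>Beta a (c + 1)\<close>.\<close>

definition plane_integrand :: "real \<Rightarrow> real \<Rightarrow> complex" where
  "plane_integrand x t = rpow x (- a - b) * rpow (x - 1) (a + c) * rpow t c * rpow (1 - t) (a + b + c)
     * rpow (D_poly x t) (- c - 1)"

text \<open>Eliminating t1 from the two equations of the substitution leaves t as a Moebius function
  of t2 at fixed x. The planar map thus splits into t2 -> t at fixed x (\<open>sub_t\<close>) and t1
  -> x at fixed t2 (\<open>sub_x\<close>).\<close>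

definition sub_t :: "real \<Rightarrow> real \<Rightarrow> real" where
  "sub_t x t2 = t2 * (x * (1 + u2) - 1) / (t2 * (x - 1) + x * u2)"

definition sub_t' :: "real \<Rightarrow> real \<Rightarrow> real" where
  "sub_t' x t2 = (x * (1 + u2) - 1) * (x * u2) / (t2 * (x - 1) + x * u2)\<^sup>2"

definition sub_x :: "real \<Rightarrow> real \<Rightarrow> real" where
  "sub_x t2 t1 = (u2 / (1 - t1) + t2) / (t2 + u2)"

definition sub_x' :: "real \<Rightarrow> real \<Rightarrow> real" where
  "sub_x' t2 t1 = u2 / ((1 - t1)\<^sup>2 * (t2 + u2))"

lemma sub_t_deriv:
  assumes "x > 1" "t2 \<in> {0<..<1}"
  shows "(sub_t x has_field_derivative sub_t' x t2) (at t2 within A)"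
proof -
  have nz: "t2 * (x - 1) + x * u2 > 0" using assms u by (intro add_pos_pos) auto
  have "((\<lambda>t2. t2 * (x * (1 + u2) - 1) / (t2 * (x - 1) + x * u2)) has_field_derivative
     ((x * (1 + u2) - 1) * (t2 * (x - 1) + x * u2) - t2 * (x * (1 + u2) - 1) * (x - 1))
       / ((t2 * (x - 1) + x * u2) * (t2 * (x - 1) + x * u2))) (at t2 within A)"
    by (rule derivative_eq_intros refl | use nz in simp)+
  also have "(x * (1 + u2) - 1) * (t2 * (x - 1) + x * u2) - t2 * (x * (1 + u2) - 1) * (x - 1)
    = (x * (1 + u2) - 1) * (x * u2)"
    by (simp add: algebra_simps)
  finally show ?thesis by (simp add: sub_t_def[abs_def] sub_t'_def power2_eq_square)
qed

text \<open>A Moebius map that fixes 0 and 1 and has positive denominator in between; the witness is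
  its inverse.\<close>

lemma sub_t_bij:
  assumes "x > 1"
  shows "bij_betw (sub_t x) {0<..<1} {0<..<1}"
proof (rule bij_betw_byWitness[where f' = "\<lambda>t. t * x * u2 / ((x * (1 + u2) - 1) - t * (x - 1))"])
  define k where "k = x * (1 + u2) - 1"
  have k: "k > x - 1" "k > 0" "k = x * u2 + (x - 1)" "x * u2 > 0"
  proof -
    show xu: "x * u2 > 0" using assms u by simp
    show 3: "k = x * u2 + (x - 1)" by (simp add: k_def algebra_simps)
    show "k > x - 1" "k > 0" using xu assms by (simp_all add: 3)
  qed
  have pos: "t * (x - 1) + x * u2 > 0" if "t \<in> {0<..<1}" for t
    using that assms u by (intro add_pos_pos) auto
  have pos': "k - t * (x - 1) > 0" if "t \<in> {0<..<1}" for t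
  proof -
    have "t * (x - 1) < 1 * (x - 1)" using that assms by (intro mult_strict_right_mono) auto
    then show ?thesis using k by simp
  qed
  show "\<forall>t\<in>{0<..<1}. sub_t x t * x * u2 / (x * (1 + u2) - 1 - sub_t x t * (x - 1)) = t"
  proof
    fix t :: real assume t: "t \<in> {0<..<1}"
    define w where "w = t * (x - 1) + x * u2"
    have w: "w > 0" using pos[OF t] by (simp add: w_def)
    have 1: "sub_t x t = t * k / w" by (simp add: sub_t_def k_def w_def)
    have "k - t * k / w * (x - 1) = k * (x * u2) / w"
      using w by (simp add: field_simps) (simp add: w_def algebra_simps)
    then show "sub_t x t * x * u2 / (x * (1 + u2) - 1 - sub_t x t * (x - 1)) = t"
      using w k(2,4) assms u unfolding 1 k_def[symmetric] by simp
  qed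
  show "\<forall>t\<in>{0<..<1}. sub_t x (t * x * u2 / (x * (1 + u2) - 1 - t * (x - 1))) = t"
  proof
    fix t :: real assume t: "t \<in> {0<..<1}"
    define w where "w = k - t * (x - 1)"
    have w: "w > 0" using pos'[OF t] by (simp add: w_def)
    have "t * x * u2 / w * (x - 1) + x * u2 = x * u2 * k / w"
      using w by (simp add: field_simps) (simp add: w_def algebra_simps)
    then show "sub_t x (t * x * u2 / (x * (1 + u2) - 1 - t * (x - 1))) = t"
      using w k(2,4) assms u unfolding sub_t_def k_def[symmetric] w_def[symmetric] by simp
  qed
  show "sub_t x ` {0<..<1} \<subseteq> {0<..<1}"
  proof safe
    fix t :: real assume t: "t \<in> {0<..<1}"
    have "t * k < t * (x - 1) + x * u2"
      using t k(4) mult_strict_right_mono[of t 1 "x * u2"] by (simp add: k(3) distrib_left)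
    then show "sub_t x t \<in> {0<..<1}"
      using pos[OF t] k t by (auto simp: sub_t_def simp flip: k_def intro!: divide_pos_pos)
  qed
  show "(\<lambda>t. t * x * u2 / (x * (1 + u2) - 1 - t * (x - 1))) ` {0<..<1} \<subseteq> {0<..<1}"
  proof (safe, unfold k_def[symmetric])
    fix t :: real assume t: "t \<in> {0<..<1}"
    have "t * x * u2 + t * (x - 1) < k"
      using t k mult_strict_right_mono[of t 1 k] by (simp add: k(3) distrib_left mult_ac)
    then show "t * x * u2 / (k - t * (x - 1)) \<in> {0<..<1}"
      using pos'[OF t] assms u t by (auto intro!: divide_pos_pos mult_pos_pos)
  qed
qed

lemma sub_x_deriv:
  assumes "t2 \<in> {0<..<1}" "t1 \<in> {0<..<1}"
  shows "(sub_x t2 has_field_derivative sub_x' t2 t1) (at t1 within A)"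
proof -
  have "((\<lambda>t1. (u2 / (1 - t1) + t2) / (t2 + u2)) has_field_derivative
     (- (u2 * (- 1)) / ((1 - t1) * (1 - t1))) / (t2 + u2)) (at t1 within A)"
    by (rule derivative_eq_intros refl | use assms u in simp)+
  then show ?thesis by (simp add: sub_x_def[abs_def] sub_x'_def power2_eq_square)
qed

lemma sub_x_bij:
  assumes "t2 \<in> {0<..<1}"
  shows "bij_betw (sub_x t2) {0<..<1} {1<..}"
proof (rule bij_betw_byWitness[where f' = "\<lambda>x. 1 - u2 / (x * (t2 + u2) - t2)"])
  define d where "d = t2 + u2"
  have d: "d > 0" "t2 = d - u2" using assms u by (auto simp: d_def)
  have pos: "x * d - t2 > u2" if "x > 1" for x
    using mult_strict_right_mono[OF that d(1)] d(2) by simp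
  show "\<forall>t1\<in>{0<..<1}. 1 - u2 / (sub_x t2 t1 * (t2 + u2) - t2) = t1"
    using d u by (auto simp: sub_x_def simp flip: d_def)
  show "\<forall>x\<in>{1<..}. sub_x t2 (1 - u2 / (x * (t2 + u2) - t2)) = x"
    using d u pos by (auto simp: sub_x_def simp flip: d_def)
  show "sub_x t2 ` {0<..<1} \<subseteq> {1<..}"
    using d u by (auto simp: sub_x_def less_divide_eq simp flip: d_def)
  show "(\<lambda>x. 1 - u2 / (x * (t2 + u2) - t2)) ` {1<..} \<subseteq> {0<..<1}"
    using pos u less_trans[OF u(2) pos] by (auto simp flip: d_def)
qed

text \<open>In the new variables x, x - 1, t, 1 - t, \<open>D_poly\<close> and both Jacobians are
  monomials in u2, u1 + t1, t1, t2, 1 - t1, 1 - t2, u2 + t2 and the auxiliary p and q. The claim is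
  then a comparison of exponents.\<close>

lemma plane_integrand_transformed:
  assumes t: "t1 \<in> {0<..<1}" "t2 \<in> {0<..<1}"
  defines "x \<equiv> sub_x t2 t1"
  shows "\<bar>sub_x' t2 t1\<bar> *\<^sub>R (\<bar>sub_t' x t2\<bar> *\<^sub>R plane_integrand x (sub_t x t2)) =
    rpow u2 a * ((rpow t2 c * rpow (1 - t2) (a + b + c) * rpow (u2 + t2) (- a - c - 1))
      * (rpow t1 (a + c) * rpow (1 - t1) (b + c) * rpow (u1 + t1) (- c - 1)))"
proof -
  define d where "d = u2 + t2"
  \<comment> \<open>p and q mix t1 and t2 and would prevent the variables from separating; their
    exponents, Jacobians included, add up to zero.\<close>
  define p where "p = u2 + t2 * (1 - t1)"
  define q where "q = d + t1 * (1 - t2)"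
  define r where "r = 1 - t1"
  have r: "r > 0" "t1 = 1 - r" using t by (auto simp: r_def)
  have pos: "d > 0" "p > 0" "q > 0" "t1 > 0" "t2 > 0" "1 - t2 > 0" "u1 + t1 > 0"
    using t u by (auto simp: d_def p_def q_def intro!: add_pos_nonneg)
  have x: "x = p / (r * d)"
  proof -
    have "x = (u2 / r + t2) / d" by (simp add: x_def sub_x_def r_def d_def add.commute)
    also have "u2 / r + t2 = p / r" using r(1) by (simp add: p_def field_simps flip: r_def)
    finally show ?thesis by simp
  qed
  have x1: "x - 1 = u2 * t1 / (r * d)"
    using pos(1) r(1) by (simp add: x field_simps) (simp add: p_def d_def r_def algebra_simps)
  have k: "x * (1 + u2) - 1 = u2 * q / (r * d)"
    using pos(1) r(1) by (simp add: x field_simps) (simp add: p_def d_def r_def q_def algebra_simps)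
  have w: "t2 * (x - 1) + x * u2 = u2 / r"
  proof -
    have "t2 * (x - 1) + x * u2 = x * d - t2" by (simp add: d_def algebra_simps)
    also have "\<dots> = u2 / r" using pos(1) r(1) by (simp add: x p_def field_simps flip: r_def)
    finally show ?thesis .
  qed
  have st: "sub_t x t2 = t2 * q / d"
    unfolding sub_t_def k w using pos r u by (simp add: field_simps)
  have st1: "1 - sub_t x t2 = (1 - t2) * p / d"
    using pos(1) unfolding st by (simp add: field_simps) (simp add: p_def d_def q_def algebra_simps)
  have st': "sub_t' x t2 = q * p / (d * d)"
    unfolding sub_t'_def k w unfolding x power2_eq_square using pos r(1) u by simp
  have D: "D_poly x (sub_t x t2) = (u1 + t1) * p * u2 * q / (r * r * d * d)"
  proof -
    \<comment> \<open>The second equation of the substitution. With it \<open>D_poly\<close> becomes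
      x * (u1 + t1) * (x * (1 + u2) - 1), which is where the base u1 + t1 of \<open>jac_int1\<close>
      comes from.\<close>
    have e: "1 - sub_t x t2 = (1 - t2) * r * x"
    proof -
      have "(1 - t2) * r * x = (1 - t2) * p / d" unfolding x using r(1) by simp
      then show ?thesis using st1 by simp
    qed
    have "D_poly x (sub_t x t2) = x * (u1 * (x * (1 + u2) - 1) + ((x * (1 + u2) - 1) - u2 - (1 - t2) * r * (x - 1)))"
      unfolding D_poly_def e by (simp add: algebra_simps)
    also have "(x * (1 + u2) - 1) - u2 - (1 - t2) * r * (x - 1) = t1 * (x * (1 + u2) - 1)"
    proof -
      have "(x * (1 + u2) - 1) - u2 = (1 + u2) * (x - 1)" by (simp add: algebra_simps)
      moreover have "((1 + u2) - (1 - t2) * r) * (x - 1) = t1 * (x * (1 + u2) - 1)"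
        unfolding x1 k by (simp add: q_def d_def r_def algebra_simps)
      ultimately show ?thesis by (simp add: algebra_simps)
    qed
    finally have "D_poly x (sub_t x t2) = x * ((u1 + t1) * (x * (1 + u2) - 1))"
      by (simp add: algebra_simps)
    then show ?thesis unfolding k by (simp add: x mult_ac)
  qed
  have sx': "sub_x' t2 t1 = u2 / (r * r * d)"
    by (simp add: sub_x'_def power2_eq_square r_def d_def add.commute)
  have 1: "\<bar>sub_x' t2 t1\<bar> *\<^sub>R (\<bar>sub_t' x t2\<bar> *\<^sub>R z) = rpow (u2 * q * p / (r * r * d * d * d)) 1 * z" for z
    using pos r(1) u by (simp add: sx' st' rpow_1 scaleR_conv_of_real mult_ac)
  show ?thesis
    unfolding 1 plane_integrand_def D st1 x1
    unfolding st
    unfolding x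
    using pos r(1) u
    by (simp add: rpow_def ln_mult ln_div flip: exp_add exp_diff d_def r_def) (simp add: algebra_simps)
qed

text \<open>Integrability is known for the product in (t2, t1) and is transported outwards: H on
  (t2, t1), then G on (t2, x), then the coordinates are swapped, then F on (x, t).\<close>

lemma plane_integral:
  assumes int1: "set_integrable lborel {0<..<1} (\<lambda>t. rpow t (a + c) * rpow (1 - t) (b + c) * rpow (u1 + t) (- c - 1))"
    and int2: "set_integrable lborel {0<..<1} (\<lambda>t. rpow t c * rpow (1 - t) (a + b + c) * rpow (u2 + t) (- a - c - 1))"
  shows "set_integrable lborel ({1<..} \<times> {0<..<1}) (\<lambda>(x, t). plane_integrand x t)"
    and "(LINT (x, t):{1<..} \<times> {0<..<1}|lborel. plane_integrand x t) = rpow u2 a *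
      ((LINT t:{0<..<1}|lborel. rpow t (a + c) * rpow (1 - t) (b + c) * rpow (u1 + t) (- c - 1)) *
       (LINT t:{0<..<1}|lborel. rpow t c * rpow (1 - t) (a + b + c) * rpow (u2 + t) (- a - c - 1)))"
proof -
  define f1 where "f1 t = rpow t (a + c) * rpow (1 - t) (b + c) * rpow (u1 + t) (- c - 1)" for t
  define f2 where "f2 t = rpow t c * rpow (1 - t) (a + b + c) * rpow (u2 + t) (- a - c - 1)" for t
  define F where "F = (\<lambda>(x, t). plane_integrand x t)"
  define G where "G = (\<lambda>(t2, x). \<bar>sub_t' x t2\<bar> *\<^sub>R F (x, sub_t x t2))"
  define H where "H = (\<lambda>(t2, t1). \<bar>sub_x' t2 t1\<bar> *\<^sub>R G (t2, sub_x t2 t1))"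
  let ?I = "{0::real<..<1}" let ?J = "{1::real<..}"
  note [simp] = borel_open open_Times
  have [measurable]: "F \<in> borel_measurable borel" "G \<in> borel_measurable borel" "H \<in> borel_measurable borel"
    unfolding F_def G_def H_def plane_integrand_def D_poly_def sub_t'_def sub_t_def sub_x'_def sub_x_def case_prod_unfold
    by (measurable; simp add: borel_prod[symmetric])+
  have H: "H p = rpow u2 a * (case p of (t2, t1) \<Rightarrow> f2 t2 * f1 t1)" if "p \<in> ?I \<times> ?I" for p
    using that plane_integrand_transformed by (auto simp: H_def G_def F_def f1_def f2_def)
  note pm = set_integrable_pair_mult[OF int2 int1, folded f1_def f2_def]
  have Hi: "set_integrable lborel (?I \<times> ?I) H"
    using set_integrable_mult_right[OF pm(1), of "rpow u2 a"] H
    by (subst set_integrable_cong[OF refl refl H]) auto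
  have HI: "(LINT p:?I \<times> ?I|lborel. H p) = rpow u2 a * ((LINT t:?I|lborel. f2 t) * (LINT t:?I|lborel. f1 t))"
    using H pm(2) by (subst set_lebesgue_integral_cong[where g = "\<lambda>p. rpow u2 a * (case p of (t2, t1) \<Rightarrow> f2 t2 * f1 t1)"]) auto
  have fib: "{x. (y, x) \<in> A \<times> B} = (if y \<in> A then B else {})" for y :: real and A B :: "real set"
    by auto
  have Gi: "set_integrable lborel (?I \<times> ?J) G" and GI: "(LINT p:?I \<times> ?J|lborel. G p) = (LINT p:?I \<times> ?I|lborel. H p)"
  proof -
    have H': "(\<lambda>(y, x). \<bar>sub_x' y x\<bar> *\<^sub>R G (y, sub_x y x)) = H" by (simp add: H_def)
    have bij: "bij_betw (sub_x y) {x. (y, x) \<in> ?I \<times> ?I} {x. (y, x) \<in> ?I \<times> ?J}" for y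
      unfolding fib using sub_x_bij[of y] by (auto simp: bij_betw_def)
    have m: "set_borel_measurable borel (?I \<times> ?J) G" "set_borel_measurable borel (?I \<times> ?I) H"
      unfolding set_borel_measurable_def by simp_all
    have der: "(sub_x y has_real_derivative sub_x' y x) (at x within A)" if "(y, x) \<in> ?I \<times> ?I" for y x A
      using that by (auto intro: sub_x_deriv)
    note * = fibre_substitution[of "?I \<times> ?I" "?I \<times> ?J" sub_x sub_x' G, unfolded H', OF _ _ der bij m Hi]
    show "set_integrable lborel (?I \<times> ?J) G" by (rule *) auto
    show "(LINT p:?I \<times> ?J|lborel. G p) = (LINT p:?I \<times> ?I|lborel. H p)" by (rule *) auto
  qed
  have G': "(\<lambda>(y, x). G (y, x)) = G" by auto
  note sw = set_integrable_pair_swap[of ?I ?J G, unfolded G', OF Gi]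
  have G2: "(\<lambda>(y, x). \<bar>sub_t' y x\<bar> *\<^sub>R F (y, sub_t y x)) = (\<lambda>(y, x). G (x, y))"
    by (auto simp: G_def)
  have "set_integrable lborel (?J \<times> ?I) F" and FI: "(LINT p:?J \<times> ?I|lborel. F p) = (LINT (y, x):?J \<times> ?I|lborel. G (x, y))"
  proof -
    have bij: "bij_betw (sub_t y) {x. (y, x) \<in> ?J \<times> ?I} {x. (y, x) \<in> ?J \<times> ?I}" for y
      unfolding fib using sub_t_bij[of y] by (auto simp: bij_betw_def)
    have m: "set_borel_measurable borel (?J \<times> ?I) F" "set_borel_measurable borel (?J \<times> ?I) (\<lambda>(y, x). G (x, y))"
      unfolding set_borel_measurable_def case_prod_unfold
      by (measurable; simp add: borel_prod[symmetric])+
    have der: "(sub_t y has_real_derivative sub_t' y x) (at x within A)" if "(y, x) \<in> ?J \<times> ?I" for y x A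
      using that by (auto intro: sub_t_deriv)
    note * = fibre_substitution[of "?J \<times> ?I" "?J \<times> ?I" sub_t sub_t' F, unfolded G2, OF _ _ der bij m sw(1)]
    show "set_integrable lborel (?J \<times> ?I) F" by (rule *) auto
    show "(LINT p:?J \<times> ?I|lborel. F p) = (LINT (y, x):?J \<times> ?I|lborel. G (x, y))" by (rule *) auto
  qed
  then show "set_integrable lborel ({1<..} \<times> {0<..<1}) (\<lambda>(x, t). plane_integrand x t)" by (simp add: F_def)
  show "(LINT (x, t):{1<..} \<times> {0<..<1}|lborel. plane_integrand x t) = rpow u2 a *
      ((LINT t:{0<..<1}|lborel. rpow t (a + c) * rpow (1 - t) (b + c) * rpow (u1 + t) (- c - 1)) *
       (LINT t:{0<..<1}|lborel. rpow t c * rpow (1 - t) (a + b + c) * rpow (u2 + t) (- a - c - 1)))"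
    using FI sw(2) GI HI by (simp add: F_def f1_def f2_def mult_ac)
qed

end

subsection \<open>Euler's integral and the continuation of the Gauss series\<close>

lemma Re_pos_not_nonpos_Ints: "Re z > 0 \<Longrightarrow> z \<notin> \<int>\<^sub>\<le>\<^sub>0"
  by (auto elim!: nonpos_Ints_cases)

lemma set_integral_termwise:
  fixes w :: "real \<Rightarrow> complex" and p :: "nat \<Rightarrow> real \<Rightarrow> real"
  assumes w: "set_integrable lborel S w" and S: "S \<in> sets borel"
    and p: "\<And>n. p n \<in> borel_measurable borel" "\<And>n t. t \<in> S \<Longrightarrow> \<bar>p n t\<bar> \<le> 1"
    and k: "summable (\<lambda>n. norm (k n))"
  shows "(\<lambda>n. k n * (LINT t:S|lborel. w t * of_real (p n t))) sums
    (LINT t:S|lborel. w t * (\<Sum>n. k n * of_real (p n t)))"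
proof -
  define W where "W t = indicator S t *\<^sub>R w t" for t
  have W: "integrable lborel W" using w by (simp add: W_def[abs_def] set_integrable_def)
  have [measurable]: "W \<in> borel_measurable borel" using borel_measurable_integrable[OF W] by simp
  have bd: "norm (W t * of_real (p n t)) \<le> norm (W t)" for n t
    using p(2)[of t n] by (auto simp: W_def norm_mult indicator_def intro: mult_left_le)
  have kint: "integrable lborel (\<lambda>t. k n * (W t * of_real (p n t)))" for n
    using p(1)[of n] bd
    by (intro integrable_mult_right Bochner_Integration.integrable_bound[OF W]) auto
  have sm: "summable (\<lambda>n. norm (k n * (W t * of_real (p n t))))" for t
    by (rule summable_comparison_test'[OF summable_mult2[OF k, of "norm (W t)"]])
       (use bd in \<open>auto simp: norm_mult intro!: mult_left_mono\<close>)
  have sm2: "summable (\<lambda>n. \<integral>t. norm (k n * (W t * of_real (p n t))) \<partial>lborel)"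
  proof (rule summable_comparison_test'[OF summable_mult2[OF k, of "\<integral>t. norm (W t) \<partial>lborel"]])
    fix n
    have "integrable lborel (\<lambda>t. W t * of_real (p n t))"
      using p(1)[of n] bd by (intro Bochner_Integration.integrable_bound[OF W]) auto
    then have "(\<integral>t. norm (k n) * norm (W t * of_real (p n t)) \<partial>lborel) \<le> (\<integral>t. norm (k n) * norm (W t) \<partial>lborel)"
      using W bd by (intro integral_mono integrable_mult_right integrable_norm mult_left_mono) auto
    then show "norm (\<integral>t. norm (k n * (W t * of_real (p n t))) \<partial>lborel) \<le> norm (k n) * (\<integral>t. norm (W t) \<partial>lborel)"
      by (simp only: norm_mult[of "k n"]) simp
  qed
  have "(\<lambda>n. \<integral>t. k n * (W t * of_real (p n t)) \<partial>lborel) sums (\<integral>t. (\<Sum>n. k n * (W t * of_real (p n t))) \<partial>lborel)"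
    by (rule sums_integral[OF kint _ sm2]) (use sm in auto)
  also have "(\<lambda>t. \<Sum>n. k n * (W t * of_real (p n t))) = (\<lambda>t. indicator S t *\<^sub>R (w t * (\<Sum>n. k n * of_real (p n t))))"
  proof
    fix t
    show "(\<Sum>n. k n * (W t * of_real (p n t))) = indicator S t *\<^sub>R (w t * (\<Sum>n. k n * of_real (p n t)))"
    proof (cases "t \<in> S")
      case True
      have "summable (\<lambda>n. k n * of_real (p n t))"
        by (rule summable_comparison_test'[OF k]) (use p(2)[OF True] in \<open>auto simp: norm_mult intro: mult_left_le\<close>)
      then have "(\<Sum>n. w t * (k n * of_real (p n t))) = w t * (\<Sum>n. k n * of_real (p n t))"
        by (rule suminf_mult)
      then show ?thesis using True by (simp add: W_def mult.left_commute)
    qed (simp add: W_def)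
  qed
  also have "(\<lambda>n. \<integral>t. k n * (W t * of_real (p n t)) \<partial>lborel) =
    (\<lambda>n. k n * (\<integral>t. indicator S t *\<^sub>R (w t * of_real (p n t)) \<partial>lborel))"
    by (simp add: W_def flip: integral_mult_right_zero)
  finally show ?thesis unfolding set_lebesgue_integral_def .
qed

lemma pochhammer_sums_powr:
  fixes z a :: complex
  assumes "norm z < 1"
  shows "(\<lambda>n. pochhammer a n / fact n * z ^ n) sums ((1 - z) powr (- a))"
proof -
  have "(\<lambda>n. ((- a) gchoose n) * (- z) ^ n) sums (1 + (- z)) powr (- a)"
    using assms by (intro gen_binomial_complex) simp
  also have "(\<lambda>n. ((- a) gchoose n) * (- z) ^ n) = (\<lambda>n. pochhammer a n / fact n * z ^ n)"
  proof
    fix n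
    have "((- a) gchoose n) * (- z) ^ n = ((- 1) ^ n * (- 1) ^ n) * (pochhammer a n / fact n * z ^ n)"
      unfolding power_minus[of z] gbinomial_pochhammer by simp
    then show "((- a) gchoose n) * (- z) ^ n = pochhammer a n / fact n * z ^ n" by simp
  qed
  finally show ?thesis by simp
qed

lemma summable_norm_pochhammer_powr:
  fixes z a :: complex
  assumes "norm z < 1"
  shows "summable (\<lambda>n. norm (pochhammer a n / fact n * z ^ n))"
proof -
  obtain r where r: "norm z < r" "r < 1" using assms dense by blast
  have "r > 0" using r(1) norm_ge_zero[of z] by linarith
  then have "norm (complex_of_real r) < 1" using r(2) by simp
  from sums_summable[OF pochhammer_sums_powr[OF this, of a]] show ?thesis
    by (rule powser_insidea) (use r \<open>r > 0\<close> in simp)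
qed

lemma continuous_on_powr_const:
  fixes f :: "'a :: topological_space \<Rightarrow> complex"
  assumes "continuous_on A f" "\<And>z. z \<in> A \<Longrightarrow> f z \<notin> \<real>\<^sub>\<le>\<^sub>0"
  shows "continuous_on A (\<lambda>z. f z powr c)"
proof -
  have "continuous_on A (\<lambda>z. exp (c * Ln (f z)))"
    using assms by (intro continuous_intros) auto
  moreover have "f z powr c = exp (c * Ln (f z))" if "z \<in> A" for z
    using assms(2)[OF that] by (auto simp: powr_def)
  ultimately show ?thesis by (simp cong: continuous_on_cong)
qed

definition slit :: "complex set" where "slit = - (complex_of_real ` {1..})"

lemma slit: "open slit" "connected slit" "norm z < 1 \<Longrightarrow> z \<in> slit"
proof -
  show "open slit" unfolding slit_def by (intro open_Compl closed_slot_right)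
  show "connected slit" unfolding slit_def
    by (intro starlike_imp_connected starlike_slotted_complex_plane_right)
  show "norm z < 1 \<Longrightarrow> z \<in> slit" unfolding slit_def by auto
qed

lemma slit_one_minus:
  assumes "z \<in> slit" "t \<in> {0..1}"
  shows "1 - of_real t * z \<notin> \<real>\<^sub>\<le>\<^sub>0"
proof
  assume *: "1 - of_real t * z \<in> \<real>\<^sub>\<le>\<^sub>0"
  then obtain r where r: "r \<le> 0" "1 - of_real t * z = of_real r" by (auto elim: nonpos_Reals_cases)
  have "t \<noteq> 0"
  proof
    assume "t = 0"
    then have "complex_of_real r = 1" using r(2) by simp
    then show False using r(1) by (simp only: of_real_eq_1_iff)
  qed
  have "of_real t * z = 1 - of_real r" using r(2) by (simp add: algebra_simps)
  then have "z = of_real ((1 - r) / t)" using \<open>t \<noteq> 0\<close> by (simp add: field_simps)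
  moreover have "(1 - r) / t \<ge> 1" using r assms(2) \<open>t \<noteq> 0\<close> by (simp add: field_simps)
  ultimately have "z \<in> complex_of_real ` {1..}" by (intro image_eqI[of _ _ "(1 - r) / t"]) simp_all
  then show False using assms(1) by (simp add: slit_def)
qed

definition euler_integral :: "complex \<Rightarrow> complex \<Rightarrow> complex \<Rightarrow> complex \<Rightarrow> complex" where
  "euler_integral a b c z = rGamma b * rGamma (c - b) *
     (LINT t:{0<..<1}|lborel. rpow t (b - 1) * rpow (1 - t) (c - b - 1) * (1 - of_real t * z) powr (- a))"

text \<open>The binomial series of (1 - t z)^(-a) is integrated term by term; the n-th moment is
  Beta (b + n) (c - b), whose constant Gamma factors cancel against the two \<open>rGamma\<close> in
  front.\<close>

lemma euler_integral_eq_series: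
  assumes b: "Re b > 0" "Re (c - b) > 0" and z: "norm z < 1"
  shows "euler_integral a b c z = regF_series a b c z"
proof -
  define w where "w t = rpow t (b - 1) * rpow (1 - t) (c - b - 1)" for t
  define k where "k n = pochhammer a n / fact n * z ^ n" for n
  have w: "set_integrable lborel {0<..<1} w"
    using Beta_integral_integrable[OF b] by (simp add: w_def[abs_def])
  have "(\<lambda>n. k n * (LINT t:{0<..<1}|lborel. w t * of_real (t ^ n))) sums
    (LINT t:{0<..<1}|lborel. w t * (\<Sum>n. k n * of_real (t ^ n)))"
    by (rule set_integral_termwise[OF w])
       (use summable_norm_pochhammer_powr[OF z] in \<open>auto simp: k_def power_le_one\<close>)
  also have "(LINT t:{0<..<1}|lborel. w t * (\<Sum>n. k n * of_real (t ^ n))) =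
    (LINT t:{0<..<1}|lborel. rpow t (b - 1) * rpow (1 - t) (c - b - 1) * (1 - of_real t * z) powr (- a))"
  proof (intro set_lebesgue_integral_cong allI impI)
    fix t :: real assume t: "t \<in> {0<..<1}"
    have "norm (of_real t * z) < 1" using t z mult_strict_mono[of t 1 "norm z" 1] by (auto simp: norm_mult)
    from pochhammer_sums_powr[OF this, of a]
    have "(\<lambda>n. k n * of_real (t ^ n)) sums ((1 - of_real t * z) powr (- a))"
      by (simp add: k_def power_mult_distrib mult_ac)
    then show "w t * (\<Sum>n. k n * of_real (t ^ n)) =
        rpow t (b - 1) * rpow (1 - t) (c - b - 1) * (1 - of_real t * z) powr (- a)"
      by (simp add: sums_iff w_def)
  qed auto
  finally have S: "(\<lambda>n. k n * (LINT t:{0<..<1}|lborel. w t * of_real (t ^ n))) sums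
    (LINT t:{0<..<1}|lborel. rpow t (b - 1) * rpow (1 - t) (c - b - 1) * (1 - of_real t * z) powr (- a))" .
  have mom: "(LINT t:{0<..<1}|lborel. w t * of_real (t ^ n)) = pochhammer b n * Gamma b * Gamma (c - b) * rGamma (c + of_nat n)" for n
  proof -
    have "(LINT t:{0<..<1}|lborel. w t * of_real (t ^ n)) =
        (LINT t:{0<..<1}|lborel. rpow t ((b + of_nat n) - 1) * rpow (1 - t) (c - b - 1))"
    proof (intro set_lebesgue_integral_cong allI impI)
      fix t :: real assume t: "t \<in> {0<..<1}"
      have "rpow t (of_nat n) = of_real (t ^ n)"
        using t rpow_of_real[of t "of_nat n"] by (simp add: powr_realpow)
      moreover have "rpow t (b + of_nat n - 1) = rpow t (b - 1) * rpow t (of_nat n)"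
        using rpow_add[of t "b - 1" "of_nat n"] by (simp add: algebra_simps)
      ultimately show "w t * of_real (t ^ n) = rpow t (b + of_nat n - 1) * rpow (1 - t) (c - b - 1)"
        by (simp add: w_def)
    qed auto
    also have "\<dots> = Beta (b + of_nat n) (c - b)"
      using b by (intro Beta_integral_complex) auto
    also have "\<dots> = Gamma (b + of_nat n) * Gamma (c - b) * rGamma (c + of_nat n)"
      by (simp add: Beta_altdef algebra_simps)
    also have "Gamma (b + of_nat n) = pochhammer b n * Gamma b"
      using pochhammer_Gamma[of b n] Re_pos_not_nonpos_Ints[OF b(1)] by (simp add: Gamma_eq_zero_iff)
    finally show ?thesis by simp
  qed
  note * = S[unfolded mom]
  have nz: "Gamma b \<noteq> 0" "Gamma (c - b) \<noteq> 0"
    using b Re_pos_not_nonpos_Ints by (simp_all add: Gamma_eq_zero_iff)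
  have "(\<lambda>n. pochhammer a n * pochhammer b n * rGamma (c + of_nat n) * (z ^ n / fact n)) sums euler_integral a b c z"
  proof -
    have "rGamma b * rGamma (c - b) * (k n * (pochhammer b n * Gamma b * Gamma (c - b) * rGamma (c + of_nat n)))
      = pochhammer a n * pochhammer b n * rGamma (c + of_nat n) * (z ^ n / fact n)" for n
      using nz by (simp add: rGamma_inverse_Gamma k_def field_simps)
    then show ?thesis
      using sums_mult[OF *, of "rGamma b * rGamma (c - b)"] by (simp add: euler_integral_def)
  qed
  then show ?thesis by (simp add: regF_series_def sums_iff)
qed

lemma euler_integral_holomorphic:
  assumes b: "Re b > 0" "Re (c - b) > 0"
  shows "euler_integral a b c holomorphic_on slit"
proof -
  have cont: "continuous_on ({0..1} \<times> slit) (\<lambda>(t, z). (1 - of_real t * z) powr (- a))"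
    unfolding case_prod_unfold
    by (rule continuous_on_powr_const) (use slit_one_minus in \<open>auto intro!: continuous_intros\<close>)
  have "(\<lambda>z. \<integral>t. indicator {0<..<1} t *\<^sub>R (rpow t (b - 1) * rpow (1 - t) (c - b - 1) *
    (1 - of_real t * z) powr (- a)) \<partial>lborel) holomorphic_on slit"
  proof (rule holomorphic_on_lebesgue_integral)
    fix t :: real
    show "(\<lambda>z. indicator {0<..<1} t *\<^sub>R (rpow t (b - 1) * rpow (1 - t) (c - b - 1) * (1 - of_real t * z) powr (- a))) holomorphic_on slit"
    proof (cases "t \<in> {0<..<1}")
      case True
      then show ?thesis using slit_one_minus[of _ t] by (auto intro!: holomorphic_intros)
    qed simp
  next
    fix z assume z: "z \<in> slit"
    have "continuous_on {0<..<1} (\<lambda>t. (1 - of_real t * z) powr (- a))"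
      by (rule continuous_on_powr_const) (use slit_one_minus[OF z] in \<open>auto intro!: continuous_intros\<close>)
    then have "(\<lambda>t. indicator {0<..<1} t *\<^sub>R (1 - of_real t * z) powr (- a)) \<in> borel_measurable borel"
      by (intro borel_measurable_continuous_on_indicator) auto
    then have "(\<lambda>t. rpow t (b - 1) * rpow (1 - t) (c - b - 1) * indicator {0<..<1} t *\<^sub>R (1 - of_real t * z) powr (- a)) \<in> borel_measurable borel"
      by measurable
    then show "(\<lambda>t. indicator {0<..<1} t *\<^sub>R (rpow t (b - 1) * rpow (1 - t) (c - b - 1) * (1 - of_real t * z) powr (- a))) \<in> borel_measurable lborel"
      by simp
  next
    fix z0 assume z0: "z0 \<in> slit"
    obtain e where e: "e > 0" "cball z0 e \<subseteq> slit"
      using slit(1) z0 open_contains_cball by blast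
    have "compact ((\<lambda>(t, z). (1 - of_real t * z) powr (- a)) ` ({0..1} \<times> cball z0 e))"
      by (intro compact_continuous_image continuous_on_subset[OF cont] compact_Times) (use e in auto)
    then obtain M where M': "\<forall>x\<in>(\<lambda>(t, z). (1 - of_real t * z) powr (- a)) ` ({0..1} \<times> cball z0 e). norm x \<le> M"
      using compact_imp_bounded bounded_iff by blast
    have M: "norm ((1 - of_real t * z) powr (- a)) \<le> M" if "t \<in> {0..1}" "z \<in> cball z0 e" for t z
      using bspec[OF M', of "(1 - of_real t * z) powr (- a)"] that by force
    define w where "w t = indicator {0<..<1} t *\<^sub>R (rpow t (b - 1) * rpow (1 - t) (c - b - 1))" for t :: real
    define g where "g t = norm (w t) * M" for t
    have "integrable lborel w"
      using Beta_integral_integrable[OF b] by (simp add: set_integrable_def w_def[abs_def])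
    then have "integrable lborel g"
      unfolding g_def by (intro integrable_mult_left integrable_norm)
    moreover have "norm (indicator {0<..<1} t *\<^sub>R (rpow t (b - 1) * rpow (1 - t) (c - b - 1) * (1 - of_real t * z) powr (- a))) \<le> g t"
      if z: "z \<in> ball z0 e \<inter> slit" for z t
    proof (cases "t \<in> {0<..<1}")
      case True
      then have "norm ((1 - of_real t * z) powr (- a)) \<le> M" using M[of t z] z by auto
      then have "norm (w t) * norm ((1 - of_real t * z) powr (- a)) \<le> norm (w t) * M"
        by (rule mult_left_mono) simp
      moreover have "norm (indicator {0<..<1} t *\<^sub>R (rpow t (b - 1) * rpow (1 - t) (c - b - 1) * (1 - of_real t * z) powr (- a)))
        = norm (w t) * norm ((1 - of_real t * z) powr (- a))" using True by (simp add: w_def norm_mult)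
      ultimately show ?thesis by (simp add: g_def)
    qed (simp add: g_def w_def)
    ultimately show "\<exists>e>0. \<exists>g. integrable lborel g \<and> (\<forall>z\<in>ball z0 e \<inter> slit. \<forall>t\<in>space lborel.
      norm (indicator {0<..<1} t *\<^sub>R (rpow t (b - 1) * rpow (1 - t) (c - b - 1) * (1 - of_real t * z) powr (- a))) \<le> g t)"
      using e(1) by blast
  qed (rule slit)
  then show ?thesis
    unfolding euler_integral_def[abs_def] set_lebesgue_integral_def by (intro holomorphic_intros)
qed

text \<open>Euler's integral is a witness for the \<open>SOME\<close> in \<open>regF\<close>, and by
  the identity theorem every other continuation agrees with it on the connected set
  \<open>slit\<close>.\<close>

lemma regF_eq_euler_integral:
  assumes b: "Re b > 0" "Re (c - b) > 0" and z: "z \<in> slit"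
  shows "regF a b c z = euler_integral a b c z"
proof (cases "norm z < 1")
  case True
  then show ?thesis by (simp add: regF_def euler_integral_eq_series[OF b])
next
  case False
  define P where "P f \<longleftrightarrow> f holomorphic_on slit \<and> (\<forall>w. norm w < 1 \<longrightarrow> f w = regF_series a b c w)" for f
  have "P (euler_integral a b c)"
    using euler_integral_holomorphic[OF b] euler_integral_eq_series[OF b] by (auto simp: P_def)
  then have S: "P (SOME f. P f)" by (rule someI[of P])
  have "(SOME f. P f) z = euler_integral a b c z"
    by (rule analytic_eq_from_real[where f = "SOME f. P f" and g = "euler_integral a b c" and S = slit and a = 0 and b = 1])
       (use S z slit euler_integral_holomorphic[OF b] euler_integral_eq_series[OF b] in \<open>auto simp: P_def\<close>)
  then show ?thesis using False by (simp add: regF_def P_def slit_def)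
qed

text \<open>The predicate under \<open>SOME\<close> mentions only the symmetric series, so both
  sides make the same choice. This symmetry gives one Gauss function two Euler integrals.\<close>

lemma regF_commute: "regF a b c z = regF b a c z"
proof -
  have "regF_series a b c = regF_series b a c" by (simp add: regF_series_def fun_eq_iff mult_ac)
  then show ?thesis by (simp add: regF_def)
qed

lemma regF_holomorphic:
  assumes "Re b > 0" "Re (c - b) > 0"
  shows "regF a b c holomorphic_on slit"
  using euler_integral_holomorphic[OF assms] by (rule holomorphic_transform) (simp add: regF_eq_euler_integral[OF assms])

lemma regF_negative_real:
  assumes "Re b > 0" "Re (c - b) > 0" "u > 0"
  shows "regF a b c (- 1 / of_real u) = rpow u a * rGamma b * rGamma (c - b) *
    (LINT t:{0<..<1}|lborel. rpow t (b - 1) * rpow (1 - t) (c - b - 1) * rpow (u + t) (- a))"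
proof -
  have "- 1 / of_real u \<in> slit"
  proof -
    have "- 1 / of_real u = complex_of_real (- 1 / u)" by simp
    moreover have "complex_of_real (- 1 / u) \<notin> complex_of_real ` {1..}"
    proof
      assume "complex_of_real (- 1 / u) \<in> complex_of_real ` {1..}"
      then obtain y where y: "y \<ge> 1" "complex_of_real (- 1 / u) = complex_of_real y" by blast
      then have "- 1 / u = y" by (simp only: of_real_eq_iff)
      then show False using y(1) assms(3) divide_neg_pos[of "- 1" u] by linarith
    qed
    ultimately show ?thesis unfolding slit_def by simp
  qed
  moreover have "(LINT t:{0<..<1}|lborel. rpow t (b - 1) * rpow (1 - t) (c - b - 1) * (1 - of_real t * (- 1 / of_real u)) powr (- a))
      = (LINT t:{0<..<1}|lborel. rpow u a * (rpow t (b - 1) * rpow (1 - t) (c - b - 1) * rpow (u + t) (- a)))"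
  proof (intro set_lebesgue_integral_cong allI impI)
    fix t :: real assume t: "t \<in> {0<..<1}"
    have "1 - of_real t * (- 1 / of_real u) = complex_of_real ((u + t) / u)"
      using assms(3) by (simp add: field_simps)
    also have "\<dots> powr (- a) = rpow ((u + t) / u) (- a)" using t assms(3) by (intro powr_eq_rpow) auto
    also have "\<dots> = rpow u a * rpow (u + t) (- a)" using t assms(3) by (simp add: rpow_divide rpow_minus)
    finally show "rpow t (b - 1) * rpow (1 - t) (c - b - 1) * (1 - of_real t * (- 1 / of_real u)) powr (- a) =
       rpow u a * (rpow t (b - 1) * rpow (1 - t) (c - b - 1) * rpow (u + t) (- a))" by simp
  qed auto
  ultimately show ?thesis by (simp add: regF_eq_euler_integral[OF assms(1,2)] euler_integral_def)
qed

subsection \<open>Integral representations of the kernel\<close>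

lemma set_integral_reflect:
  fixes f :: "real \<Rightarrow> complex"
  assumes f: "set_integrable lborel {0<..<c} f" and e: "\<And>x. x \<in> {0<..<c} \<Longrightarrow> f (- x) = e * f x" and c: "c > 0"
    and m: "f \<in> borel_measurable borel"
  shows "set_integrable lborel {-c<..<c} f"
    and "(LINT x:{-c<..<c}|lborel. f x) = (1 + e) * (LINT x:{0<..<c}|lborel. f x)"
proof -
  have eq: "{-c<..<c} = ({-c<..<0} \<union> {0<..<c}) \<union> {0}" using c by auto
  have m': "(\<lambda>x. f (- x)) \<in> borel_measurable borel" using m by measurable
  have bij: "bij_betw uminus {0<..<c} {-c<..<0}"
    by (rule bij_betw_byWitness[where f' = uminus]) auto
  have mm: "set_borel_measurable borel {-c<..<0} f" "set_borel_measurable borel {0<..<c} (\<lambda>x. \<bar>- 1\<bar> *\<^sub>R f (- x))"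
    using m m' unfolding set_borel_measurable_def by measurable
  have der: "(uminus has_real_derivative - 1) (at x within {0<..<c})" for x :: real
    by (auto intro!: derivative_eq_intros)
  note sub = set_integral_substitution[OF _ _ der bij mm]
  have "set_integrable lborel {0<..<c} (\<lambda>x. \<bar>- 1\<bar> *\<^sub>R f (- x))"
    using set_integrable_mult_right[OF f, of e] e by (subst set_integrable_cong[OF refl refl]) auto
  then have L: "set_integrable lborel {-c<..<0} f" using sub(1) by auto
  have "(LINT x:{0<..<c}|lborel. \<bar>- 1\<bar> *\<^sub>R f (- x)) = (LINT x:{0<..<c}|lborel. e * f x)"
    using e by (intro set_lebesgue_integral_cong) auto
  then have LI: "(LINT x:{-c<..<0}|lborel. f x) = e * (LINT x:{0<..<c}|lborel. f x)" using sub(2) by auto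
  have LR: "set_integrable lborel ({-c<..<0} \<union> {0<..<c}) f" by (rule set_integrable_Un[OF L f]) auto
  have N1: "(\<lambda>x. indicat_real {0} x *\<^sub>R f x) = (\<lambda>x. indicat_real {0} x *\<^sub>R f 0)"
    by (auto simp: indicator_def)
  have N0: "set_integrable lborel {0} f" unfolding set_integrable_def N1 by simp
  show "set_integrable lborel {-c<..<c} f" unfolding eq by (rule set_integrable_Un[OF LR N0]) auto
  have "(LINT x:{-c<..<c}|lborel. f x) = (LINT x:{-c<..<0} \<union> {0<..<c}|lborel. f x) + (LINT x:{0}|lborel. f x)"
    unfolding eq by (rule set_integral_Un[OF _ LR N0]) auto
  also have "(LINT x:{0}|lborel. f x) = 0"
    unfolding set_lebesgue_integral_def N1 by simp
  also have "(LINT x:{-c<..<0} \<union> {0<..<c}|lborel. f x) = (LINT x:{-c<..<0}|lborel. f x) + (LINT x:{0<..<c}|lborel. f x)"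
    by (rule set_integral_Un[OF _ L f]) auto
  finally show "(LINT x:{-c<..<c}|lborel. f x) = (1 + e) * (LINT x:{0<..<c}|lborel. f x)"
    by (simp add: LI algebra_simps)
qed

lemma gegenbauer_moment:
  assumes s: "Re s > - 1"
  shows "set_integrable lborel {-1<..<1} (\<lambda>u. rpow (1 - u\<^sup>2) s * of_real (u ^ k))"
    and "(LINT u:{-1<..<1}|lborel. rpow (1 - u\<^sup>2) s * of_real (u ^ k)) =
      (if even k then Beta ((of_nat k + 1) / 2) (s + 1) else 0)"
proof -
  let ?f = "\<lambda>v. (1 / 2) * (rpow v ((of_nat k + 1) / 2 - 1) * rpow (1 - v) ((s + 1) - 1))"
  let ?g = "\<lambda>u. rpow (1 - u\<^sup>2) s * complex_of_real (u ^ k)"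
  have re: "Re ((of_nat k + 1) / 2) > 0" "Re (s + 1) > 0" using s by auto
  have f: "set_integrable lborel {0<..<1} ?f"
    by (intro set_integrable_mult_right Beta_integral_integrable re)
  have fI: "(LINT v:{0<..<1}|lborel. ?f v) = (1 / 2) * Beta ((of_nat k + 1) / 2) (s + 1)"
    using Beta_integral_complex[OF re] by simp
  have eq: "\<bar>2 * u\<bar> *\<^sub>R ?f (u\<^sup>2) = ?g u" if "u \<in> {0<..<1}" for u
  proof -
    have "rpow (u\<^sup>2) ((of_nat k + 1) / 2 - 1) = rpow u (of_nat k) / of_real u"
    proof -
      have "of_nat 2 * ((of_nat k + 1) / 2 - 1) = (of_nat k - 1 :: complex)" by (simp add: field_simps)
      then have "rpow (u\<^sup>2) ((of_nat k + 1) / 2 - 1) = rpow u (of_nat k - 1)"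
        using that by (subst rpow_power) (simp_all only:, auto)
      then show ?thesis
        using that by (simp add: rpow_1 rpow_diff)
    qed
    also have "rpow u (of_nat k) = of_real (u ^ k)"
      using that rpow_of_real[of u "of_nat k"] by (simp add: powr_realpow)
    finally show ?thesis using that by (simp add: scaleR_conv_of_real)
  qed
  have bij: "bij_betw (\<lambda>u. u\<^sup>2) {0<..<1} {0<..<1::real}"
    by (rule bij_betw_byWitness[where f' = sqrt]) (auto simp: power_less_one_iff)
  have der: "((\<lambda>u. u\<^sup>2) has_real_derivative 2 * u) (at u within {0<..<1})" for u :: real
    by (auto intro!: derivative_eq_intros)
  have m: "set_borel_measurable borel {0<..<1} ?f" "set_borel_measurable borel {0<..<1} (\<lambda>u. \<bar>2 * u\<bar> *\<^sub>R ?f (u\<^sup>2))"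
    unfolding set_borel_measurable_def by measurable
  note sub = set_integral_substitution[OF _ _ der bij m]
  have g: "set_integrable lborel {0<..<1} ?g"
  proof -
    have "set_integrable lborel {0<..<1} (\<lambda>u. \<bar>2 * u\<bar> *\<^sub>R ?f (u\<^sup>2)) \<longleftrightarrow> set_integrable lborel {0<..<1} ?g"
      by (rule set_integrable_cong[OF refl refl eq])
    then show ?thesis using f sub(1) by (simp only: borel_open open_greaterThanLessThan)
  qed
  have "(LINT u:{0<..<1}|lborel. \<bar>2 * u\<bar> *\<^sub>R ?f (u\<^sup>2)) = (LINT u:{0<..<1}|lborel. ?g u)"
    using eq by (intro set_lebesgue_integral_cong) auto
  then have gI: "(LINT u:{0<..<1}|lborel. ?g u) = (1 / 2) * Beta ((of_nat k + 1) / 2) (s + 1)"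
    using sub(2) fI by auto
  have mg: "?g \<in> borel_measurable borel" by measurable
  have ref: "?g (- u) = (- 1) ^ k * ?g u" for u
    unfolding power_minus[of u] by simp
  note R = set_integral_reflect[OF g ref _ mg]
  show "set_integrable lborel {-1<..<1} ?g" using R(1) by simp
  show "(LINT u:{-1<..<1}|lborel. ?g u) = (if even k then Beta ((of_nat k + 1) / 2) (s + 1) else 0)"
  proof -
    have "(LINT u:{-1<..<1}|lborel. ?g u) = (1 + (- 1) ^ k) * ((1 / 2) * Beta ((of_nat k + 1) / 2) (s + 1))"
      unfolding gI[symmetric] using R(2) by simp
    then show ?thesis by (cases "even k") simp_all
  qed
qed

lemma gegenbauer_termwise:
  assumes s: "Re s > - 1" and \<kappa>: "summable (\<lambda>k. norm (\<kappa> k))"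
  shows "(\<lambda>n. \<kappa> (2 * n) * Beta (of_nat n + 1 / 2) (s + 1)) sums
    (LINT u:{-1<..<1}|lborel. rpow (1 - u\<^sup>2) s * (\<Sum>k. \<kappa> k * of_real (u ^ k)))"
proof -
  have w: "set_integrable lborel {-1<..<1} (\<lambda>u. rpow (1 - u\<^sup>2) s)"
    using gegenbauer_moment(1)[OF s, of 0] by simp
  have "\<bar>t ^ n\<bar> \<le> 1" if "t \<in> {-1<..<1}" for t :: real and n
    using that by (auto simp: power_abs intro!: power_le_one)
  then have *: "(\<lambda>k. \<kappa> k * (LINT u:{-1<..<1}|lborel. rpow (1 - u\<^sup>2) s * of_real (u ^ k))) sums
    (LINT u:{-1<..<1}|lborel. rpow (1 - u\<^sup>2) s * (\<Sum>k. \<kappa> k * of_real (u ^ k)))"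
    by (intro set_integral_termwise[OF w _ _ _ \<kappa>]) auto
  have "(\<lambda>n. \<kappa> (2 * n) * (LINT u:{-1<..<1}|lborel. rpow (1 - u\<^sup>2) s * of_real (u ^ (2 * n)))) sums
    (LINT u:{-1<..<1}|lborel. rpow (1 - u\<^sup>2) s * (\<Sum>k. \<kappa> k * of_real (u ^ k)))"
  proof (subst sums_mono_reindex[where g = "\<lambda>n. 2 * n"])
    fix n :: nat assume "n \<notin> range (\<lambda>n. 2 * n)"
    then have "odd n" by (auto elim!: evenE)
    then show "\<kappa> n * (LINT u:{-1<..<1}|lborel. rpow (1 - u\<^sup>2) s * of_real (u ^ n)) = 0"
      by (simp only: gegenbauer_moment(2)[OF s]) simp
  qed (use * in \<open>simp_all add: strict_mono_def\<close>)
  then show ?thesis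
    by (simp only: gegenbauer_moment[OF s]) (simp add: add_divide_distrib)
qed

text \<open>Duplication: (s)_2n = 4^n (s/2)_n ((s+1)/2)_n and (2n)! = 4^n (1/2)_n n!, while the
  half-integer Gamma value contributes (1/2)_n sqrt pi. So the even terms of a binomial series in w
  form a Gauss series in w^2.\<close>

lemma regF_series_half_term:
  fixes a a' s w g :: complex
  assumes "a' = a + of_nat n + 1 / 2"
  shows "pochhammer s (2 * n) / fact (2 * n) * (- w) ^ (2 * n) * (Gamma (of_nat n + 1 / 2) * g * rGamma a')
    = (of_real (sqrt pi) * g) * (pochhammer (s / 2) n * pochhammer ((s + 1) / 2) n * rGamma ((a + 1 / 2) + of_nat n) * ((w\<^sup>2) ^ n / fact n))"
proof -
  have 1: "pochhammer s (2 * n) = 2 ^ (2 * n) * (pochhammer (s / 2) n * pochhammer ((s + 1) / 2) n)"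
    using pochhammer_double[of "s / 2" n] by (simp add: add_divide_distrib)
  have 2: "fact (2 * n) = (2 ^ (2 * n) * pochhammer (1 / 2) n * fact n :: complex)"
    using fact_double[of n, where 'a = complex] by simp
  have half: "(1 / 2 :: complex) \<notin> \<int>\<^sub>\<le>\<^sub>0" by (rule Re_pos_not_nonpos_Ints) simp
  have 3: "Gamma (of_nat n + 1 / 2) = pochhammer (1 / 2 :: complex) n * of_real (sqrt pi)"
    using pochhammer_Gamma[OF half, of n] by (simp add: Gamma_one_half_complex field_simps)
  have 4: "pochhammer (1 / 2 :: complex) n \<noteq> 0"
  proof
    assume "pochhammer (1 / 2 :: complex) n = 0"
    then obtain k where "(1 / 2 :: complex) = - of_nat k" unfolding pochhammer_eq_0_iff by blast
    then have "Re (1 / 2) = Re (- of_nat k)" by (rule arg_cong)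
    then show False by simp
  qed
  have 5: "(- w) ^ (2 * n) = (w\<^sup>2) ^ n" by (simp add: power_mult)
  have 6: "a' = (a + 1 / 2) + of_nat n" using assms by simp
  show ?thesis
    unfolding 1 2 3 5 6 using 4 by (simp add: field_simps)
qed

lemma neg_prod_power: "(- complex_of_real (w * u)) ^ k = (- of_real w) ^ k * of_real (u ^ k)"
proof -
  have "- complex_of_real (w * u) = (- of_real w) * of_real u" by simp
  then show ?thesis by (simp only: power_mult_distrib of_real_power)
qed

lemma gegenbauer_regF_series:
  assumes s: "Re s > - 1" and \<kappa>: "summable (\<lambda>k. norm (\<kappa> k))" and C: "C \<noteq> 0"
    and eq: "\<And>n. \<kappa> (2 * n) * Beta (of_nat n + 1 / 2) (s + 1) =
      C * (pochhammer a n * pochhammer b n * rGamma (c + of_nat n) * (z ^ n / fact n))"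
  shows "(LINT u:{-1<..<1}|lborel. rpow (1 - u\<^sup>2) s * (\<Sum>k. \<kappa> k * of_real (u ^ k))) = C * regF_series a b c z"
proof -
  have "regF_series a b c z = (LINT u:{-1<..<1}|lborel. rpow (1 - u\<^sup>2) s * (\<Sum>k. \<kappa> k * of_real (u ^ k))) / C"
    unfolding regF_series_def
    by (rule sums_unique[OF sums_mult_D[OF gegenbauer_termwise[OF s \<kappa>, unfolded eq] C], symmetric])
  then show ?thesis using C by simp
qed

text \<open>The weight is even, so only even powers in the binomial expansion of (1 + w u)^(-s)
  survive, each against a Beta moment.\<close>

lemma kernel_rep:
  assumes a: "Re a > 0" and w: "w \<in> {0..<1}"
  shows "(LINT u:{-1<..<1}|lborel. rpow (1 - u\<^sup>2) (a - 1) * rpow (1 + w * u) (- s)) =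
    of_real (sqrt pi) * Gamma a * regF_series (s / 2) ((s + 1) / 2) (a + 1 / 2) (of_real (w\<^sup>2))"
proof -
  define \<kappa> where "\<kappa> k = pochhammer s k / fact k * (- of_real w) ^ k" for k
  have nw: "norm (- complex_of_real w) < 1" using w by simp
  have \<kappa>: "summable (\<lambda>k. norm (\<kappa> k))"
    unfolding \<kappa>_def by (rule summable_norm_pochhammer_powr[OF nw])
  have s1: "Re (a - 1) > - 1" using a by simp
  have "(LINT u:{-1<..<1}|lborel. rpow (1 - u\<^sup>2) (a - 1) * rpow (1 + w * u) (- s)) =
     (LINT u:{-1<..<1}|lborel. rpow (1 - u\<^sup>2) (a - 1) * (\<Sum>k. \<kappa> k * of_real (u ^ k)))"
  proof (intro set_lebesgue_integral_cong allI impI)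
    fix u :: real assume u: "u \<in> {-1<..<1}"
    have wu: "\<bar>w * u\<bar> < 1" using u w mult_strict_mono'[of w 1 "\<bar>u\<bar>" 1] by (auto simp: abs_mult)
    then have "norm (- complex_of_real (w * u)) < 1" by (simp only: norm_minus_cancel norm_of_real)
    from pochhammer_sums_powr[OF this, of s]
    have "(\<lambda>k. \<kappa> k * of_real (u ^ k)) sums (1 - (- of_real (w * u))) powr (- s)"
      by (simp only: \<kappa>_def neg_prod_power mult.assoc)
    then have "(\<lambda>k. \<kappa> k * of_real (u ^ k)) sums (of_real (1 + w * u) powr (- s))"
      by simp
    then show "rpow (1 - u\<^sup>2) (a - 1) * rpow (1 + w * u) (- s) = rpow (1 - u\<^sup>2) (a - 1) * (\<Sum>k. \<kappa> k * of_real (u ^ k))"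
      using wu powr_eq_rpow[of "1 + w * u" "- s"] by (simp add: sums_iff abs_less_iff)
  qed auto
  also have "\<dots> = of_real (sqrt pi) * Gamma a * regF_series (s / 2) ((s + 1) / 2) (a + 1 / 2) (of_real (w\<^sup>2))"
  proof -
    let ?t = "\<lambda>n. pochhammer (s / 2) n * pochhammer ((s + 1) / 2) n * rGamma ((a + 1 / 2) + of_nat n) * (of_real (w\<^sup>2) ^ n / fact n)"
    have "\<kappa> (2 * n) * Beta (of_nat n + 1 / 2) (a - 1 + 1) = (of_real (sqrt pi) * Gamma a) * ?t n" for n
      using regF_series_half_term[of "a + of_nat n + 1 / 2" a n s "of_real w" "Gamma a"]
      by (simp add: \<kappa>_def Beta_altdef add_ac)
    moreover have "of_real (sqrt pi) * Gamma a \<noteq> 0"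
      using Re_pos_not_nonpos_Ints[OF a] by (simp add: Gamma_eq_zero_iff)
    ultimately show ?thesis by (intro gegenbauer_regF_series s1 \<kappa>)
  qed
  finally show ?thesis .
qed

text \<open>
  For \<open>Re a > - 1 / 2\<close> the weight \<open>(1 - u\<^sup>2)\<^bsup>a-1\<^esup>\<close> of \<open>kernel_rep\<close> is not integrable. Integrating its
  part \<open>u\<^sup>2 (1 - u\<^sup>2)\<^bsup>a-1\<^esup>\<close> by parts raises the exponent by one and leaves the bracket below.
\<close>

lemma kernel_rep_regularized:
  assumes a: "Re a > - 1 / 2" and w: "w \<in> {0..<1}"
  shows "(LINT u:{-1<..<1}|lborel. rpow (1 - u\<^sup>2) a *
      ((a + 1 / 2) * rpow (1 + w * u) (- s) - s / 2 * of_real (w * u) * rpow (1 + w * u) (- s - 1))) =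
    of_real (sqrt pi) * Gamma (a + 1) * regF_series (s / 2) ((s + 1) / 2) (a + 1 / 2) (of_real (w\<^sup>2))"
proof -
  define \<kappa>0 where "\<kappa>0 k = pochhammer s k / fact k * (- of_real w) ^ k" for k
  \<comment> \<open>At k = 2n the factor is a + n + 1/2, which lowers the \<open>rGamma\<close>
    argument of the moment by one and so undoes the raised weight exponent. Multiplication by k/2 is
    the operator (u/2) d/du on the series; it produces the second term of the bracket.\<close>
  define \<kappa> where "\<kappa> k = (a + 1 / 2) * \<kappa>0 k + of_nat k / 2 * \<kappa>0 k" for k
  have nw: "norm (- complex_of_real w) < 1" using w by simp
  have \<kappa>0: "summable (\<lambda>k. norm (\<kappa>0 k))"
    unfolding \<kappa>0_def by (rule summable_norm_pochhammer_powr[OF nw])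
  have shift: "of_nat (Suc k) / 2 * (pochhammer s (Suc k) / fact (Suc k) * z ^ Suc k)
      = s / 2 * z * (pochhammer (s + 1) k / fact k * z ^ k)" for k and z :: complex
  proof -
    define m where "m = (of_nat (Suc k) :: complex)"
    have m: "m \<noteq> 0" unfolding m_def by (simp del: of_nat_Suc)
    have "fact (Suc k) = m * (fact k :: complex)" unfolding m_def by (rule fact_Suc)
    then show ?thesis unfolding m_def[symmetric] pochhammer_rec using m by simp
  qed
  have "summable (\<lambda>k. norm (of_nat k / 2 * \<kappa>0 k))"
  proof (subst summable_Suc_iff[symmetric])
    show "summable (\<lambda>k. norm (of_nat (Suc k) / 2 * \<kappa>0 (Suc k)))"
      using summable_mult[OF summable_norm_pochhammer_powr[OF nw, of "s + 1"], of "norm (s / 2 * - of_real w)"]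
      unfolding \<kappa>0_def shift by (simp only: norm_mult)
  qed
  then have "summable (\<lambda>k. norm (a + 1 / 2) * norm (\<kappa>0 k) + norm (of_nat k / 2 * \<kappa>0 k))"
    by (intro summable_add summable_mult \<kappa>0)
  then have \<kappa>: "summable (\<lambda>k. norm (\<kappa> k))"
  proof (rule summable_comparison_test'[where N = 0])
    show "norm (norm (\<kappa> k)) \<le> norm (a + 1 / 2) * norm (\<kappa>0 k) + norm (of_nat k / 2 * \<kappa>0 k)" for k
      using norm_triangle_ineq[of "(a + 1 / 2) * \<kappa>0 k" "of_nat k / 2 * \<kappa>0 k"]
      unfolding \<kappa>_def by (simp only: norm_mult[of "a + 1 / 2"] real_norm_def abs_norm_cancel)
  qed
  have s1: "Re a > - 1" using a by simp
  have "(LINT u:{-1<..<1}|lborel. rpow (1 - u\<^sup>2) a *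
      ((a + 1 / 2) * rpow (1 + w * u) (- s) - s / 2 * of_real (w * u) * rpow (1 + w * u) (- s - 1))) =
     (LINT u:{-1<..<1}|lborel. rpow (1 - u\<^sup>2) a * (\<Sum>k. \<kappa> k * of_real (u ^ k)))"
  proof (intro set_lebesgue_integral_cong allI impI)
    fix u :: real assume u: "u \<in> {-1<..<1}"
    have wu: "\<bar>w * u\<bar> < 1" using u w mult_strict_mono'[of w 1 "\<bar>u\<bar>" 1] by (auto simp: abs_mult)
    define z where "z = - complex_of_real (w * u)"
    have z: "norm z < 1" using wu unfolding z_def by (simp only: norm_minus_cancel norm_of_real)
    have z1: "1 - z = of_real (1 + w * u)" by (simp add: z_def)
    have k0: "\<kappa>0 k * of_real (u ^ k) = pochhammer s k / fact k * z ^ k" for k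
      by (simp only: \<kappa>0_def z_def neg_prod_power mult.assoc)
    have A: "(\<lambda>k. \<kappa>0 k * of_real (u ^ k)) sums ((1 - z) powr (- s))"
      unfolding k0 by (rule pochhammer_sums_powr[OF z])
    have "(\<lambda>k. of_nat (Suc k) / 2 * (\<kappa>0 (Suc k) * of_real (u ^ Suc k))) sums (s / 2 * z * (1 - z) powr (- (s + 1)))"
      unfolding k0 shift by (intro sums_mult pochhammer_sums_powr[OF z])
    then have B: "(\<lambda>k. of_nat k / 2 * (\<kappa>0 k * of_real (u ^ k))) sums (s / 2 * z * (1 - z) powr (- (s + 1)))"
      by (subst (asm) sums_Suc_iff) simp
    have "(\<lambda>k. \<kappa> k * of_real (u ^ k)) sums ((a + 1 / 2) * (1 - z) powr (- s) + s / 2 * z * (1 - z) powr (- (s + 1)))"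
      using sums_add[OF sums_mult[OF A, of "a + 1 / 2"] B] by (simp add: \<kappa>_def distrib_right mult.assoc)
    then show "rpow (1 - u\<^sup>2) a * ((a + 1 / 2) * rpow (1 + w * u) (- s) - s / 2 * of_real (w * u) * rpow (1 + w * u) (- s - 1))
      = rpow (1 - u\<^sup>2) a * (\<Sum>k. \<kappa> k * of_real (u ^ k))"
      using wu powr_eq_rpow[of "1 + w * u"] unfolding z1 by (simp add: sums_iff abs_less_iff z_def)
  qed auto
  also have "\<dots> = of_real (sqrt pi) * Gamma (a + 1) * regF_series (s / 2) ((s + 1) / 2) (a + 1 / 2) (of_real (w\<^sup>2))"
  proof -
    let ?t = "\<lambda>n. pochhammer (s / 2) n * pochhammer ((s + 1) / 2) n * rGamma ((a + 1 / 2) + of_nat n) * (of_real (w\<^sup>2) ^ n / fact n)"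
    have "\<kappa> (2 * n) * Beta (of_nat n + 1 / 2) (a + 1) = (of_real (sqrt pi) * Gamma (a + 1)) * ?t n" for n
    proof -
      have "\<kappa> (2 * n) * Beta (of_nat n + 1 / 2) (a + 1) = \<kappa>0 (2 * n) * (Gamma (of_nat n + 1 / 2) * Gamma (a + 1) *
         ((a + of_nat n + 1 / 2) * rGamma ((a + of_nat n + 1 / 2) + 1)))"
        by (simp add: \<kappa>_def Beta_altdef algebra_simps)
      also have "(a + of_nat n + 1 / 2) * rGamma ((a + of_nat n + 1 / 2) + 1) = rGamma (a + of_nat n + 1 / 2)"
        by (rule rGamma_plus1)
      finally show ?thesis
        using regF_series_half_term[of "a + of_nat n + 1 / 2" a n s "of_real w" "Gamma (a + 1)"]
        by (simp add: \<kappa>0_def)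
    qed
    moreover have "of_real (sqrt pi) * Gamma (a + 1) \<noteq> 0"
      using Re_pos_not_nonpos_Ints[of "a + 1"] a by (simp add: Gamma_eq_zero_iff)
    ultimately show ?thesis by (intro gegenbauer_regF_series s1 \<kappa>)
  qed
  finally show ?thesis .
qed

subsection \<open>The product formula for positive real part of the first parameter\<close>

text \<open>Euler's integral of the Gauss function in \<open>jacobi_Q\<close> with the numerator
  parameter a + c + 1 in the exponent of t. It needs Re (a + c) > -1 and Re (b + c) > -1, so for
  fixed b and c with Re (b + c) > -1 and Re c > -1/2 it is available on all of Re a > -1/2.\<close>

definition jac_int1 :: "complex \<Rightarrow> complex \<Rightarrow> complex \<Rightarrow> real \<Rightarrow> complex" where
  "jac_int1 a b c u = (LINT t:{0<..<1}|lborel. rpow t (a + c) * rpow (1 - t) (b + c) * rpow (u + t) (- c - 1))"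

text \<open>The same Gauss function with the other numerator parameter, c + 1, in the exponent of t.
  It needs Re c > -1 and Re (a + b + c) > -1; given Re (b + c) > -1, the latter is automatic only
  for Re a \<ge> 0.\<close>

definition jac_int2 :: "complex \<Rightarrow> complex \<Rightarrow> complex \<Rightarrow> real \<Rightarrow> complex" where
  "jac_int2 a b c u = (LINT t:{0<..<1}|lborel. rpow t c * rpow (1 - t) (a + b + c) * rpow (u + t) (- a - c - 1))"

lemma powr_between_le:
  fixes x y z :: real
  assumes "0 < x" "x \<le> y" "y \<le> z"
  shows "y powr e \<le> x powr e + z powr e"
proof (cases "e \<ge> 0")
  case True
  then have "y powr e \<le> z powr e" using assms by (intro powr_mono2) auto
  then show ?thesis by (simp add: add_increasing)
next
  case False
  then have "y powr e \<le> x powr e" using assms by (intro powr_mono2') auto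
  then show ?thesis by (simp add: add_increasing2)
qed

lemma set_integrable_dominated:
  fixes f g :: "real \<Rightarrow> complex"
  assumes g: "set_integrable lborel S g" and m: "set_borel_measurable borel S f"
    and b: "\<And>x. x \<in> S \<Longrightarrow> norm (f x) \<le> M * norm (g x)" and M: "M \<ge> 0"
  shows "set_integrable lborel S f"
  unfolding set_integrable_def
proof (rule Bochner_Integration.integrable_bound)
  show "integrable lborel (\<lambda>x. M *\<^sub>R (indicator S x *\<^sub>R g x))"
    using g unfolding set_integrable_def by (rule integrable_scaleR_right)
  show "AE x in lborel. norm (indicator S x *\<^sub>R f x) \<le> norm (M *\<^sub>R (indicator S x *\<^sub>R g x))"
    using b M by (auto intro!: AE_I2 simp: indicator_def)
qed (use m in \<open>simp add: set_borel_measurable_def\<close>)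

text \<open>The lower bound 1 - w is uniform in u and the lower bound (1 + u) / 2 is uniform in w.
  Using one for a part of an exponent and the other for the rest separates the growth as w -> 1 from
  the singularity at u = -1.\<close>

lemma one_plus_bounds:
  assumes "w \<in> {0<..<1}" "u \<in> {-1<..<1::real}"
  shows "1 - w \<le> 1 + w * u" "1 + w * u \<le> 2" "(1 + u) / 2 \<le> 1 + w * u" "1 + w * u > 0" "\<bar>w * u\<bar> \<le> 1"
proof -
  have "w * (- 1) \<le> w * u" using assms by (intro mult_left_mono) auto
  then show 1: "1 - w \<le> 1 + w * u" by simp
  have "w * u \<le> 1 * 1"
  proof (cases "u \<ge> 0")
    case True
    then show ?thesis using assms by (intro mult_mono) auto
  next
    case False
    then have "w * u \<le> 0" using assms by (intro mult_nonneg_nonpos) auto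
    then show ?thesis by simp
  qed
  then show "1 + w * u \<le> 2" "\<bar>w * u\<bar> \<le> 1"
    using \<open>w * (- 1) \<le> w * u\<close> assms by (simp_all add: abs_le_iff)
  show "1 + w * u > 0" using assms 1 by simp
  show "(1 + u) / 2 \<le> 1 + w * u"
  proof (cases "u \<ge> 0")
    case True
    then have "w * u \<ge> 0" using assms by simp
    then show ?thesis using assms by simp
  next
    case False
    then have "u \<le> w * u" using assms mult_left_mono_neg[of w 1 u] by (simp add: mult.commute)
    moreover have "u > - 1" using assms by simp
    ultimately show ?thesis by (simp add: field_simps)
  qed
qed

lemma gegenbauer_integrable:
  assumes a: "Re a > - 1" and w: "w \<in> {0<..<1}"
  shows "set_integrable lborel {-1<..<1} (\<lambda>u. rpow (1 - u\<^sup>2) a * (of_real (u ^ k) * rpow (1 + w * u) e))"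
proof (rule set_integrable_dominated[where M = "(1 - w) powr Re e + (1 + w) powr Re e"])
  show "set_integrable lborel {-1<..<1} (\<lambda>u. rpow (1 - u\<^sup>2) a)"
    using gegenbauer_moment(1)[OF a, of 0] by simp
  show "set_borel_measurable borel {-1<..<1} (\<lambda>u. rpow (1 - u\<^sup>2) a * (of_real (u ^ k) * rpow (1 + w * u) e))"
    unfolding set_borel_measurable_def by measurable
  fix u :: real assume u: "u \<in> {-1<..<1}"
  note bd = one_plus_bounds[OF w u]
  have "w * u \<le> w * 1" using w u by (intro mult_left_mono) auto
  then have n: "norm (rpow (1 + w * u) e) \<le> (1 - w) powr Re e + (1 + w) powr Re e"
    using powr_between_le[of "1 - w" "1 + w * u" "1 + w" "Re e"] bd w by (simp add: norm_rpow)
  have "\<bar>u\<bar> ^ k \<le> 1" using u by (intro power_le_one) auto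
  then have "norm (complex_of_real (u ^ k)) \<le> 1" by (simp add: power_abs norm_power)
  then have "norm (complex_of_real (u ^ k)) * norm (rpow (1 + w * u) e) \<le> 1 * ((1 - w) powr Re e + (1 + w) powr Re e)"
    using n by (intro mult_mono) auto
  from mult_left_mono[OF this, of "norm (rpow (1 - u\<^sup>2) a)"]
  show "norm (rpow (1 - u\<^sup>2) a * (of_real (u ^ k) * rpow (1 + w * u) e))
      \<le> ((1 - w) powr Re e + (1 + w) powr Re e) * norm (rpow (1 - u\<^sup>2) a)"
    by (simp add: norm_mult mult.commute del: of_real_power)
qed simp

lemma set_integrable_Beta_bounded:
  assumes "Re p > - 1" "Re q > - 1" "u > 0"
  shows "set_integrable lborel {0<..<1} (\<lambda>t. rpow t p * rpow (1 - t) q * rpow (u + t) e)"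
proof (rule set_integrable_dominated[where M = "u powr Re e + (u + 1) powr Re e"])
  show "set_integrable lborel {0<..<1} (\<lambda>t. rpow t p * rpow (1 - t) q)"
    using Beta_integral_integrable[of "p + 1" "q + 1"] assms by simp
  show "set_borel_measurable borel {0<..<1} (\<lambda>t. rpow t p * rpow (1 - t) q * rpow (u + t) e)"
    unfolding set_borel_measurable_def by measurable
  fix t :: real assume t: "t \<in> {0<..<1}"
  then have "norm (rpow (u + t) e) \<le> u powr Re e + (u + 1) powr Re e"
    using assms(3) powr_between_le[of u "u + t" "u + 1" "Re e"] by (simp add: norm_rpow)
  from mult_left_mono[OF this norm_ge_zero[of "rpow t p * rpow (1 - t) q"]]
  show "norm (rpow t p * rpow (1 - t) q * rpow (u + t) e)
      \<le> (u powr Re e + (u + 1) powr Re e) * norm (rpow t p * rpow (1 - t) q)"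
    by (simp add: norm_mult mult.commute)
qed simp

section \<open>The Jacobi function at 2 y^2 - 1 through both Euler integrals\<close>

lemma jacobi_Q_eq_regF:
  assumes "y > 1"
  shows "jacobi_Q c a b (of_real (2 * y\<^sup>2 - 1)) =
    1 / 2 * Gamma (a + c + 1) * Gamma (b + c + 1) / (rpow (y\<^sup>2 - 1) (a + c + 1) * rpow y (2 * b)) *
      regF (c + 1) (a + c + 1) (a + b + 2 * c + 2) (- 1 / of_real (y\<^sup>2 - 1))"
proof -
  define u where "u = y\<^sup>2 - 1"
  have u: "u > 0" using assms by (simp add: u_def power2_eq_square less_1_mult)
  have z: "of_real (2 * y\<^sup>2 - 1) - 1 = complex_of_real (2 * u)" "of_real (2 * y\<^sup>2 - 1) + 1 = complex_of_real (2 * y ^ 2)"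
    by (simp_all add: u_def)
  have z2: "2 / (1 - complex_of_real (2 * y\<^sup>2 - 1)) = - 1 / of_real u"
  proof -
    have "1 - complex_of_real (2 * y\<^sup>2 - 1) = - 2 * of_real u" by (simp add: u_def)
    then show ?thesis using u by (simp only:) simp
  qed
  have p1: "complex_of_real (2 * u) powr (a + c + 1) = rpow 2 (a + c + 1) * rpow u (a + c + 1)"
    using u by (subst powr_eq_rpow) (simp_all add: rpow_mult)
  have p2: "complex_of_real (2 * y ^ 2) powr b = rpow 2 b * rpow y (2 * b)"
    using assms by (subst powr_eq_rpow) (simp_all add: rpow_mult rpow_power)
  have p3: "2 powr (a + b + c) = rpow 2 (a + b + c)"
    using powr_eq_rpow[of 2 "a + b + c"] by simp
  have two: "rpow 2 (a + b + c) = rpow 2 (a + c + 1) * rpow 2 b / 2"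
  proof -
    have "rpow 2 (a + b + c) = rpow 2 (a + c + 1 + b - 1)" by (rule arg_cong) simp
    then show ?thesis by (simp only: rpow_diff rpow_add rpow_1[of 2]) simp
  qed
  show ?thesis
    unfolding jacobi_Q_def z z2 p1 p2 p3 two u_def[symmetric] by simp
qed

text \<open>In the first form the Gamma factors of \<open>jacobi_Q\<close> cancel those of Euler's
  integral; in the second a quotient of four Gamma values remains.\<close>

lemma jacobi_Q_eq_jac_int1:
  assumes "Re (a + c) > - 1" "Re (b + c) > - 1" "y > 1"
  shows "jacobi_Q c a b (of_real (2 * y\<^sup>2 - 1)) =
    1 / 2 * rpow (y\<^sup>2 - 1) (- a) * rpow y (- 2 * b) * jac_int1 a b c (y\<^sup>2 - 1)"
    and "Re c > - 1 \<Longrightarrow> Re (a + b + c) > - 1 \<Longrightarrow> jacobi_Q c a b (of_real (2 * y\<^sup>2 - 1)) =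
    1 / 2 * (Gamma (a + c + 1) * Gamma (b + c + 1) / (Gamma (c + 1) * Gamma (a + b + c + 1))) *
      rpow y (- 2 * b) * jac_int2 a b c (y\<^sup>2 - 1)"
proof -
  define u where "u = y\<^sup>2 - 1"
  have u: "u > 0" using assms(3) by (simp add: u_def power2_eq_square less_1_mult)
  have nz: "Gamma (a + c + 1) \<noteq> 0" "Gamma (b + c + 1) \<noteq> 0"
    using Re_pos_not_nonpos_Ints[of "a + c + 1"] Re_pos_not_nonpos_Ints[of "b + c + 1"] assms
    by (auto simp: Gamma_eq_zero_iff)
  note Q = jacobi_Q_eq_regF[OF assms(3), of c a b, folded u_def]
  have V: "rpow y (- 2 * b) = 1 / rpow y (2 * b)"
    using rpow_minus[of y "2 * b"] by simp
  have e1: "a + b + 2 * c + 2 - (a + c + 1) = b + c + 1" "a + c + 1 - 1 = a + c" "b + c + 1 - 1 = b + c"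
    "- (c + 1) = - c - 1" by simp_all
  have re: "Re (a + c + 1) > 0" "Re (b + c + 1) > 0" using assms by simp_all
  have R: "regF (c + 1) (a + c + 1) (a + b + 2 * c + 2) (- 1 / of_real u) =
     rpow u (c + 1) * rGamma (a + c + 1) * rGamma (b + c + 1) * jac_int1 a b c u"
    unfolding jac_int1_def by (rule regF_negative_real[of "a + c + 1" "a + b + 2 * c + 2" u "c + 1", unfolded e1, OF re u])
  have G: "Gamma (a + c + 1) * Gamma (b + c + 1) * (rpow u (c + 1) * rGamma (a + c + 1) * rGamma (b + c + 1) * jac_int1 a b c u)
      = rpow u (c + 1) * jac_int1 a b c u"
  proof -
    have g: "Gamma (a + c + 1) * rGamma (a + c + 1) = 1" "Gamma (b + c + 1) * rGamma (b + c + 1) = 1"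
      using nz by (simp_all add: rGamma_inverse_Gamma)
    have "Gamma (a + c + 1) * Gamma (b + c + 1) * (rpow u (c + 1) * rGamma (a + c + 1) * rGamma (b + c + 1) * jac_int1 a b c u)
      = (Gamma (a + c + 1) * rGamma (a + c + 1)) * (Gamma (b + c + 1) * rGamma (b + c + 1)) * (rpow u (c + 1) * jac_int1 a b c u)"
      by (simp only: mult_ac)
    then show ?thesis unfolding g by simp
  qed
  have U: "rpow u (- a) = rpow u (c + 1) / rpow u (a + c + 1)"
    using rpow_diff[of u "c + 1" "a + c + 1"] by simp
  show "jacobi_Q c a b (of_real (2 * y\<^sup>2 - 1)) =
    1 / 2 * rpow (y\<^sup>2 - 1) (- a) * rpow y (- 2 * b) * jac_int1 a b c (y\<^sup>2 - 1)"
  proof -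
    have "jacobi_Q c a b (of_real (2 * y\<^sup>2 - 1)) = 1 / 2 * (Gamma (a + c + 1) * Gamma (b + c + 1) *
       (rpow u (c + 1) * rGamma (a + c + 1) * rGamma (b + c + 1) * jac_int1 a b c u)) / (rpow u (a + c + 1) * rpow y (2 * b))"
      unfolding Q R by simp
    then show ?thesis unfolding G u_def[symmetric] V U by simp
  qed
  assume c: "Re c > - 1" "Re (a + b + c) > - 1"
  have e2: "a + b + 2 * c + 2 - (c + 1) = a + b + c + 1" "c + 1 - 1 = c" "a + b + c + 1 - 1 = a + b + c"
    "- (a + c + 1) = - a - c - 1" by simp_all
  have re2: "Re (c + 1) > 0" "Re (a + b + c + 1) > 0" using c by simp_all
  have R2: "regF (c + 1) (a + c + 1) (a + b + 2 * c + 2) (- 1 / of_real u) =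
     rpow u (a + c + 1) * rGamma (c + 1) * rGamma (a + b + c + 1) * jac_int2 a b c u"
    unfolding jac_int2_def regF_commute[of "c + 1"]
    by (rule regF_negative_real[of "c + 1" "a + b + 2 * c + 2" u "a + c + 1", unfolded e2, OF re2 u])
  show "jacobi_Q c a b (of_real (2 * y\<^sup>2 - 1)) =
    1 / 2 * (Gamma (a + c + 1) * Gamma (b + c + 1) / (Gamma (c + 1) * Gamma (a + b + c + 1))) *
      rpow y (- 2 * b) * jac_int2 a b c (y\<^sup>2 - 1)"
    unfolding Q u_def[symmetric] V R2 rGamma_inverse_Gamma inverse_eq_divide by (simp add: mult_ac)
qed

text \<open>The common core of both integrands: up to constants it is the Gegenbauer factor and also
  the Legendre factor at z = A / sqrt (A^2 - 1), see \<open>gegenbauer_kernel\<close> and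
  \<open>legendre_kernel\<close>. For A > 1 the argument 1 / z^2 = 1 - 1 / A^2 lies in (0,1), where
  the series itself is the value of \<open>regF\<close>.\<close>

definition kern :: "complex \<Rightarrow> complex \<Rightarrow> real \<Rightarrow> complex" where
  "kern a b A = rpow (A\<^sup>2 - 1) (a - 1 / 2) * rpow A (- (a + b)) *
     regF_series ((a + b) / 2) ((a + b + 1) / 2) (a + 1 / 2) (of_real (1 - 1 / A\<^sup>2))"

text \<open>With u_i = y_i^2 - 1, X = y^2 and Y = y1 y2 this is 2 A y Y x - y^2 - Y^2 x^2: a
  quadratic in x with vertex y A / Y, yet linear in X. The same power can therefore be integrated in
  either variable.\<close>

definition Z_poly :: "real \<Rightarrow> real \<Rightarrow> real \<Rightarrow> real \<Rightarrow> real" where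
  "Z_poly u1 u2 X x = X * (x - 1) - x * ((1 + u1) * (1 + u2) * x - 1 - u1 - u2)"

text \<open>A > 1 is (y - y1 y2)^2 > (y1^2 - 1) (y2^2 - 1) rearranged; the lower limit is the larger
  root of A = 1.\<close>

lemma A_arg_gt_1:
  assumes "y1 > 1" "y2 > 1" "y > lower_limit y1 y2"
  shows "A_arg y1 y2 y > 1" "y > y1 * y2" "y > 1"
proof -
  define s where "s = sqrt ((y1\<^sup>2 - 1) * (y2\<^sup>2 - 1))"
  have u: "y1\<^sup>2 - 1 > 0" "y2\<^sup>2 - 1 > 0" using assms by (simp_all add: power2_eq_square less_1_mult)
  have s: "s > 0" "s * s = (y1\<^sup>2 - 1) * (y2\<^sup>2 - 1)" using u by (simp_all add: s_def)
  have Y: "y1 * y2 > 1" using assms by (simp add: less_1_mult)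
  have y: "y > y1 * y2 + s" using assms(3) by (simp add: lower_limit_def s_def)
  show "y > y1 * y2" "y > 1" using y s Y by auto
  have "(y - y1 * y2) * (y - y1 * y2) > s * s" using y s by (intro mult_strict_mono) auto
  then have "y1\<^sup>2 + y2\<^sup>2 + y\<^sup>2 - 1 > 2 * y1 * y2 * y" by (simp add: s(2) power2_eq_square algebra_simps)
  moreover have "2 * y1 * y2 * y > 0" using assms \<open>y > 1\<close> by simp
  ultimately show "A_arg y1 y2 y > 1" by (simp add: A_arg_def less_divide_eq)
qed

text \<open>Completing the square at the vertex leaves A^2 (1 - w^2 u^2) - 1, and A^2 w^2 = A^2 - 1
  by the choice of w.\<close>

lemma Z_poly_factor:
  assumes y1: "y1 > 1" and y2: "y2 > 1" and y: "y > lower_limit y1 y2"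
  defines "A \<equiv> A_arg y1 y2 y" and "w \<equiv> sqrt (1 - 1 / (A_arg y1 y2 y)\<^sup>2)"
  shows "Z_poly (y1\<^sup>2 - 1) (y2\<^sup>2 - 1) (y\<^sup>2) (y * A / (y1 * y2) * (1 + w * u)) = y\<^sup>2 * (A\<^sup>2 - 1) * (1 - u\<^sup>2)"
proof -
  define Y where "Y = y1 * y2"
  have Y: "Y > 1" using assms by (simp add: less_1_mult Y_def)
  have A: "A > 1" "y > 1" using A_arg_gt_1[OF assms(1-3)] by (auto simp: A_def)
  have w2: "w\<^sup>2 = 1 - 1 / A\<^sup>2" using A(1) by (simp add: w_def A_def[symmetric])
  have AY: "y1\<^sup>2 + y2\<^sup>2 + y\<^sup>2 - 1 = 2 * A * y * Y"
    using assms Y A(2) by (simp add: A_def A_arg_def Y_def field_simps)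
  have "Z_poly (y1\<^sup>2 - 1) (y2\<^sup>2 - 1) (y\<^sup>2) x = x * (y1\<^sup>2 + y2\<^sup>2 + y\<^sup>2 - 1) - y\<^sup>2 - Y\<^sup>2 * x\<^sup>2" for x
    by (simp add: Z_poly_def Y_def power2_eq_square algebra_simps)
  then have Z: "Z_poly (y1\<^sup>2 - 1) (y2\<^sup>2 - 1) (y\<^sup>2) x = x * (2 * A * y * Y) - y\<^sup>2 - Y\<^sup>2 * x\<^sup>2" for x
    unfolding AY .
  have "y * A / Y * (1 + w * u) * (2 * A * y * Y) - y\<^sup>2 - Y\<^sup>2 * (y * A / Y * (1 + w * u))\<^sup>2
     = y\<^sup>2 * (A\<^sup>2 * (1 - w\<^sup>2 * u\<^sup>2) - 1)"
    using Y by (simp add: power2_eq_square field_simps)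
  also have "A\<^sup>2 * (1 - w\<^sup>2 * u\<^sup>2) - 1 = (A\<^sup>2 - 1) * (1 - u\<^sup>2)"
    unfolding w2 using A(1) by (simp add: field_simps)
  finally show ?thesis unfolding Z Y_def[symmetric] by (simp add: mult_ac)
qed

text \<open>With v = x - 1, P = (1 + u1) (1 + u2) and N = u1 u2, positivity says X > P v + N / v + P
  + N, and P v + N / v \<ge> 2 sqrt (P N). The resulting bound is (sqrt P + sqrt N)^2, the square of
  the lower limit of integration.\<close>

lemma Z_poly_pos_imp:
  assumes "u1 > 0" "u2 > 0" "x > 1" "Z_poly u1 u2 X x > 0"
  shows "X > ((1 + u1) * (1 + u2)) + u1 * u2 + 2 * sqrt ((1 + u1) * (1 + u2) * (u1 * u2))"
proof -
  define v where "v = x - 1"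
  have v: "v > 0" using assms by (simp add: v_def)
  define P where "P = (1 + u1) * (1 + u2)"
  define N where "N = u1 * u2"
  have PN: "P > 0" "N > 0" using assms by (simp_all add: P_def N_def)
  have "Z_poly u1 u2 X x = X * v - (v + 1) * (P * v + N)"
    by (simp add: Z_poly_def v_def P_def N_def algebra_simps)
  also have "\<dots> = X * v - (P * v\<^sup>2 + (P + N) * v + N)"
    by (simp add: power2_eq_square algebra_simps)
  finally have 1: "X * v > P * v\<^sup>2 + (P + N) * v + N" using assms(4) by simp
  have "2 * sqrt (P * N) * v \<le> P * v\<^sup>2 + N"
  proof -
    have "0 \<le> (sqrt P * v - sqrt N)\<^sup>2" by simp
    also have "\<dots> = P * v\<^sup>2 + N - 2 * (sqrt P * sqrt N) * v"
      using PN by (simp add: power2_diff power_mult_distrib algebra_simps)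
    finally show ?thesis by (simp add: real_sqrt_mult)
  qed
  with 1 have "X * v > (P + N + 2 * sqrt (P * N)) * v" by (simp add: algebra_simps)
  then show ?thesis using v by (simp add: P_def N_def)
qed

text \<open>
  The affine map centred at the vertex of the quadratic \<open>Z_poly\<close>; its positive part is the image of \<open>(- 1, 1)\<close>.
\<close>

lemma kernel_fibre_bij:
  assumes y1: "y1 > 1" and y2: "y2 > 1" and y: "y > lower_limit y1 y2"
  defines "A \<equiv> A_arg y1 y2 y" and "w \<equiv> sqrt (1 - 1 / (A_arg y1 y2 y)\<^sup>2)"
  shows "bij_betw (\<lambda>u. y * A / (y1 * y2) * (1 + w * u)) {-1<..<1} {x. x > 1 \<and> Z_poly (y1\<^sup>2 - 1) (y2\<^sup>2 - 1) (y\<^sup>2) x > 0}"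
proof -
  define Y where "Y = y1 * y2"
  define m where "m = y * A / Y"
  have Y: "Y > 1" using assms by (simp add: less_1_mult Y_def)
  have A: "A > 1" "y > 1" "y > Y" using A_arg_gt_1[OF assms(1-3)] by (auto simp: A_def Y_def)
  have A2: "A\<^sup>2 > 1" using A by (simp add: power2_eq_square less_1_mult)
  have m: "m > 1" using A Y mult_strict_mono[of 1 A Y y] by (simp add: m_def mult_ac)
  have w: "0 < w" "w < 1"
    using A2 by (auto simp: w_def A_def[symmetric] real_sqrt_lt_1_iff divide_less_eq)
  note Zf = Z_poly_factor[OF assms(1-3), folded w_def, folded A_def, folded Y_def, folded m_def]
  let ?Z = "Z_poly (y1\<^sup>2 - 1) (y2\<^sup>2 - 1) (y\<^sup>2)"
  have pos: "?Z (m * (1 + w * u)) > 0 \<longleftrightarrow> u \<in> {-1<..<1}" for u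
  proof -
    have P: "y\<^sup>2 * (A\<^sup>2 - 1) > 0" using A A2 by simp
    have "y\<^sup>2 * (A\<^sup>2 - 1) * (1 - u\<^sup>2) > 0 \<longleftrightarrow> u\<^sup>2 < 1"
      unfolding zero_less_mult_iff[of "y\<^sup>2 * (A\<^sup>2 - 1)"] using P less_asym[OF P] by simp
    then show ?thesis unfolding Zf by (auto simp: abs_square_less_1)
  qed
  have one: "?Z 1 < 0"
  proof -
    have "?Z 1 = - ((y1\<^sup>2 - 1) * (y2\<^sup>2 - 1))" by (simp add: Z_poly_def algebra_simps)
    moreover have "y1\<^sup>2 - 1 > 0" "y2\<^sup>2 - 1 > 0" using y1 y2 by (simp_all add: power2_eq_square less_1_mult)
    ultimately show ?thesis by simp
  qed
  \<comment> \<open>The interval of positivity is centred at m > 1. If it reached down to 1 or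
    below, it would contain 1, where the quadratic is negative.\<close>
  have gt: "m * (1 + w * u) > 1" if u: "u \<in> {-1<..<1}" for u
  proof (rule ccontr)
    assume le: "\<not> m * (1 + w * u) > 1"
    define v where "v = (1 / m - 1) / w"
    have v: "m * (1 + w * v) = 1" using m w by (simp add: v_def)
    have "m * (1 + w * u) \<le> m * (1 + w * v)" using le v by simp
    then have uv: "u \<le> v" using m w by simp
    have "1 / m < 1" using m by simp
    then have "v < 0" using w by (simp add: v_def divide_less_0_iff)
    then have "v \<in> {-1<..<1}" using u uv by auto
    then show False using pos[of v] one v by simp
  qed
  show ?thesis unfolding Y_def[symmetric] m_def[symmetric]
  proof (rule bij_betw_byWitness[where f' = "\<lambda>x. (x / m - 1) / w"])
    show inv: "\<forall>x\<in>{x. x > 1 \<and> ?Z x > 0}. m * (1 + w * ((x / m - 1) / w)) = x"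
    proof
      fix x
      have "m * (1 + w * ((x / m - 1) / w)) = m * (x / m)" using w(1) by simp
      then show "m * (1 + w * ((x / m - 1) / w)) = x" using m by simp
    qed
    show "(\<lambda>x. (x / m - 1) / w) ` {x. x > 1 \<and> ?Z x > 0} \<subseteq> {-1<..<1}"
    proof (rule image_subsetI)
      fix x assume x: "x \<in> {x. x > 1 \<and> ?Z x > 0}"
      have "m * (1 + w * ((x / m - 1) / w)) = x" using bspec[OF inv x] .
      then have "?Z (m * (1 + w * ((x / m - 1) / w))) > 0" using x by simp
      then show "(x / m - 1) / w \<in> {-1<..<1}" unfolding pos .
    qed
    show "(\<lambda>u. m * (1 + w * u)) ` {-1<..<1} \<subseteq> {x. x > 1 \<and> ?Z x > 0}"
    proof (rule image_subsetI)
      fix u assume u: "u \<in> {-1<..<1::real}"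
      then have "?Z (m * (1 + w * u)) > 0" unfolding pos .
      then show "m * (1 + w * u) \<in> {x. x > 1 \<and> ?Z x > 0}" using gt[OF u] by blast
    qed
    show "\<forall>u\<in>{-1<..<1}. (m * (1 + w * u) / m - 1) / w = u" using m w by simp
  qed
qed

text \<open>The affine map of \<open>kernel_fibre_bij\<close> turns the fibre integral over x into
  \<open>kernel_rep\<close> with s = a + b; the powers of y, Y, A and A^2 - 1 that it splits off are
  those in \<open>kern\<close> and in the prefactor.\<close>

lemma kernel_fibre_integral:
  fixes a b :: complex
  assumes y1: "y1 > 1" and y2: "y2 > 1" and y: "y > lower_limit y1 y2" and a: "Re a > 0"
  defines "I \<equiv> {x. x > 1 \<and> Z_poly (y1\<^sup>2 - 1) (y2\<^sup>2 - 1) (y\<^sup>2) x > 0}"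
    and "f \<equiv> \<lambda>x. rpow (Z_poly (y1\<^sup>2 - 1) (y2\<^sup>2 - 1) (y\<^sup>2) x) (a - 1) * rpow x (- a - b)"
  shows "set_integrable lborel I f"
    and "(LINT x:I|lborel. f x) = of_real (sqrt pi) * Gamma a * rpow y (a - b - 1) * rpow (y1 * y2) (a + b - 1) * kern a b (A_arg y1 y2 y)"
proof -
  define A where "A = A_arg y1 y2 y"
  define w where "w = sqrt (1 - 1 / A\<^sup>2)"
  define Y where "Y = y1 * y2"
  define m where "m = y * A / Y"
  have Y: "Y > 1" using assms by (simp add: less_1_mult Y_def)
  have A: "A > 1" "y > 1" using A_arg_gt_1[OF y1 y2 y] by (auto simp: A_def)
  have A2: "A\<^sup>2 - 1 > 0" using A by (simp add: power2_eq_square less_1_mult)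
  have m: "m > 0" using A Y by (simp add: m_def)
  have w: "0 < w" "w < 1"
    using A2 by (auto simp: w_def real_sqrt_lt_1_iff divide_less_eq)
  have "1 / A\<^sup>2 < 1" using A2 by (simp add: divide_less_eq)
  then have w2: "w\<^sup>2 = 1 - 1 / A\<^sup>2" by (simp add: w_def)
  have w': "w = sqrt (A\<^sup>2 - 1) / A"
  proof -
    have "1 - 1 / A\<^sup>2 = (A\<^sup>2 - 1) / A\<^sup>2" using A by (simp add: field_simps)
    then show ?thesis using A by (simp add: w_def real_sqrt_divide)
  qed
  note bij = kernel_fibre_bij[OF y1 y2 y, folded A_def, folded w_def, folded Y_def, folded m_def, folded I_def]
  note Zf = Z_poly_factor[OF y1 y2 y, folded A_def, folded w_def, folded Y_def, folded m_def]
  define C where "C = rpow y (a - b - 1) * rpow Y (a + b - 1) * rpow (A\<^sup>2 - 1) (a - 1 / 2) * rpow A (- (a + b))"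
  let ?g = "\<lambda>u. rpow (1 - u\<^sup>2) (a - 1) * rpow (1 + w * u) (- (a + b))"
  have eq: "\<bar>m * w\<bar> *\<^sub>R f (m * (1 + w * u)) = C * ?g u" if u: "u \<in> {-1<..<1}" for u
  proof -
    have "\<bar>u\<bar> < 1" using u by auto
    then have "u\<^sup>2 < 1" by (simp add: abs_square_less_1)
    have "\<bar>w * u\<bar> < 1" using mult_strict_mono'[of w 1 "\<bar>u\<bar>" 1] w \<open>\<bar>u\<bar> < 1\<close> by (simp add: abs_mult)
    then have wu: "1 + w * u > 0" by (simp add: abs_less_iff)
    have mw: "\<bar>m * w\<bar> = y / Y * sqrt (A\<^sup>2 - 1)" using A Y A2 by (simp add: m_def w')
    have 1: "\<bar>m * w\<bar> *\<^sub>R z = rpow (y / Y) 1 * rpow (A\<^sup>2 - 1) (1 / 2) * z" for z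
    proof -
      have "rpow (A\<^sup>2 - 1) (1 / 2) = of_real (sqrt (A\<^sup>2 - 1))"
        using rpow_of_real[OF A2, of "1 / 2"] A2 by (simp add: powr_half_sqrt)
      then show ?thesis unfolding mw using A Y by (simp add: rpow_1 scaleR_conv_of_real)
    qed
    define E where "E = A\<^sup>2 - 1"
    have "E > 0" using A2 by (simp add: E_def)
    show ?thesis
      unfolding 1 f_def Zf C_def unfolding m_def E_def[symmetric]
      using A \<open>E > 0\<close> Y wu \<open>u\<^sup>2 < 1\<close>
      by (simp add: rpow_def ln_mult ln_div power2_eq_square[of y] flip: exp_add exp_diff)
         (simp add: algebra_simps)
  qed
  have der: "((\<lambda>u. m * (1 + w * u)) has_real_derivative m * w) (at u within {-1<..<1})" for u
    by (auto intro!: derivative_eq_intros)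
  have I: "I \<in> sets borel" unfolding I_def Z_poly_def by measurable
  have ms: "set_borel_measurable borel I f" "set_borel_measurable borel {-1<..<1} (\<lambda>u. \<bar>m * w\<bar> *\<^sub>R f (m * (1 + w * u)))"
    unfolding set_borel_measurable_def f_def Z_poly_def using I by (measurable, measurable)
  note sub = set_integral_substitution[OF _ I der bij ms]
  have gi: "set_integrable lborel {-1<..<1} ?g"
    using gegenbauer_integrable[of "a - 1" w 0 "- (a + b)"] a w by simp
  have "set_integrable lborel {-1<..<1} (\<lambda>u. \<bar>m * w\<bar> *\<^sub>R f (m * (1 + w * u))) \<longleftrightarrow> set_integrable lborel {-1<..<1} (\<lambda>u. C * ?g u)"
    by (rule set_integrable_cong[OF refl refl eq])
  then show "set_integrable lborel I f" using sub(1) set_integrable_mult_right[OF gi, of C] by auto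
  have "(LINT x:I|lborel. f x) = (LINT u:{-1<..<1}|lborel. \<bar>m * w\<bar> *\<^sub>R f (m * (1 + w * u)))"
    using sub(2) by simp
  also have "\<dots> = (LINT u:{-1<..<1}|lborel. C * ?g u)"
    using eq by (intro set_lebesgue_integral_cong) auto
  also have "\<dots> = C * (of_real (sqrt pi) * Gamma a * regF_series ((a + b) / 2) ((a + b + 1) / 2) (a + 1 / 2) (of_real (w\<^sup>2)))"
    using kernel_rep[OF a, of w "a + b"] w by simp
  finally show "(LINT x:I|lborel. f x) = of_real (sqrt pi) * Gamma a * rpow y (a - b - 1) * rpow (y1 * y2) (a + b - 1) * kern a b (A_arg y1 y2 y)"
    by (simp add: C_def kern_def w2 Y_def A_def mult_ac)
qed

section \<open>The triple integral over x, t and X\<close>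

lemma borel_measurable_fst_snd [measurable]:
  "(fst :: 'a::topological_space \<times> 'b::topological_space \<Rightarrow> 'a) \<in> borel_measurable borel"
  "(snd :: 'a::topological_space \<times> 'b::topological_space \<Rightarrow> 'b) \<in> borel_measurable borel"
  by (intro borel_measurable_continuous_onI continuous_intros)+

lemma D_poly_pos:
  assumes "u1 > 0" "u2 > 0" "x > 1" "0 < t" "t < 1"
  shows "D_poly u1 u2 x t > 0"
proof -
  have "D_poly u1 u2 x t = (x - 1) * (x * ((1 + u1) * (1 + u2)) - 1 + t) + x * (u1 * u2)"
    by (simp add: D_poly_def[OF assms(1,2)] algebra_simps)
  moreover have "x * ((1 + u1) * (1 + u2)) \<ge> 1 * 1"
  proof (intro mult_mono)
    show "1 \<le> (1 + u1) * (1 + u2)" using assms mult_mono[of 1 "1 + u1" 1 "1 + u2"] by simp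
  qed (use assms in auto)
  then have "(x - 1) * (x * ((1 + u1) * (1 + u2)) - 1 + t) > 0" using assms by (intro mult_pos_pos) auto
  moreover have "x * (u1 * u2) > 0" using assms by simp
  ultimately show ?thesis by simp
qed

text \<open>Integration over x gives \<open>kern\<close>, over t it gives \<open>jac_int2\<close> at
  u = X - 1, over X a Beta integral. The nesting ((x, t), X) matches the two orders of integration
  that are compared.\<close>

definition space_integrand :: "real \<Rightarrow> real \<Rightarrow> complex \<Rightarrow> complex \<Rightarrow> complex \<Rightarrow> (real \<times> real) \<times> real \<Rightarrow> complex" where
  "space_integrand u1 u2 a b c = (\<lambda>((x, t), X). rpow (Z_poly u1 u2 X x) (a - 1) * rpow x (- a - b) *
     (rpow t c * rpow (1 - t) (a + b + c) * rpow (X - 1 + t) (- a - c - 1)))"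

text \<open>For fixed x the quadratic is (x - 1) * (X - X0), so \<open>Beta_integral_Ioi\<close>
  applies with lower limit X0 and shift t - 1; \<open>D_poly_pos\<close> is what makes its base
  positive.\<close>

lemma space_integrand_inner:
  assumes u: "u1 > 0" "u2 > 0" and ac: "Re a > 0" "Re c > - 1" and x: "x > 1" and t: "0 < t" "t < 1"
  shows "set_integrable lborel {X. Z_poly u1 u2 X x > 0} (\<lambda>X. space_integrand u1 u2 a b c ((x, t), X))"
    and "(LINT X:{X. Z_poly u1 u2 X x > 0}|lborel. space_integrand u1 u2 a b c ((x, t), X)) = Beta a (c + 1) * plane_integrand u1 u2 a b c x t"
    and "Z_poly u1 u2 X x > 0 \<Longrightarrow> X - 1 + t > 0"
proof -
  define X0 where "X0 = x * ((1 + u1) * (1 + u2) * x - 1 - u1 - u2) / (x - 1)"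
  have Z: "Z_poly u1 u2 X x = (x - 1) * (X - X0)" for X
    using x by (simp add: Z_poly_def X0_def field_simps)
  have set_eq: "{X. Z_poly u1 u2 X x > 0} = {X0<..}"
    using x unfolding Z by (auto simp: zero_less_mult_iff)
  have D: "D_poly u1 u2 x t = (x - 1) * (X0 + (t - 1))"
    using x by (simp add: D_poly_def[OF u] X0_def field_simps)
  have pos: "X0 + (t - 1) > 0" using D_poly_pos[OF u x t] x unfolding D by (simp add: zero_less_mult_iff)
  show "X - 1 + t > 0" if "Z_poly u1 u2 X x > 0"
  proof -
    have "X \<in> {X0<..}" using that unfolding set_eq[symmetric] by blast
    then show ?thesis using pos by simp
  qed
  define C where "C = rpow (x - 1) (a - 1) * rpow x (- a - b) * (rpow t c * rpow (1 - t) (a + b + c))"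
  have eq: "space_integrand u1 u2 a b c ((x, t), X) = C * (rpow (X - X0) (a - 1) * rpow (X + (t - 1)) (- a - (c + 1)))"
    if "X \<in> {X0<..}" for X
  proof -
    have e: "X - 1 + t = X + (t - 1)" "- a - c - 1 = - a - (c + 1)" by simp_all
    show ?thesis
      using that x unfolding space_integrand_def prod.case Z C_def e by (simp add: rpow_mult mult_ac)
  qed
  have re: "Re a > 0" "Re (c + 1) > 0" using ac by simp_all
  note B = Beta_integral_Ioi[OF re pos]
  show "set_integrable lborel {X. Z_poly u1 u2 X x > 0} (\<lambda>X. space_integrand u1 u2 a b c ((x, t), X))"
  proof -
    have "set_integrable lborel {X0<..} (\<lambda>X. space_integrand u1 u2 a b c ((x, t), X)) \<longleftrightarrow>
      set_integrable lborel {X0<..} (\<lambda>X. C * (rpow (X - X0) (a - 1) * rpow (X + (t - 1)) (- a - (c + 1))))"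
      by (rule set_integrable_cong[OF refl refl eq])
    then show ?thesis unfolding set_eq using set_integrable_mult_right[OF B(1)] by simp
  qed
  have "(LINT X:{X0<..}|lborel. space_integrand u1 u2 a b c ((x, t), X)) =
     (LINT X:{X0<..}|lborel. C * (rpow (X - X0) (a - 1) * rpow (X + (t - 1)) (- a - (c + 1))))"
    using eq by (intro set_lebesgue_integral_cong) auto
  also have "\<dots> = C * (rpow (X0 + (t - 1)) (- (c + 1)) * Beta a (c + 1))" by (simp add: B)
  also have "\<dots> = Beta a (c + 1) * plane_integrand u1 u2 a b c x t"
  proof -
    have e: "(a - 1) - (- c - 1) = a + c" "- (c + 1) = - c - 1" by simp_all
    have "rpow (x - 1) (a - 1) = rpow (x - 1) (a + c) * rpow (x - 1) (- c - 1)"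
      using rpow_add[of "x - 1" "a + c" "- c - 1"] by simp
    then show ?thesis
      using x pos unfolding plane_integrand_def[OF u] D e C_def by (simp add: rpow_mult mult_ac)
  qed
  finally show "(LINT X:{X. Z_poly u1 u2 X x > 0}|lborel. space_integrand u1 u2 a b c ((x, t), X)) = Beta a (c + 1) * plane_integrand u1 u2 a b c x t"
    unfolding set_eq .
qed

text \<open>All bases are positive, so taking norms replaces the parameters by their real parts.
  Absolute integrability then follows from the evaluation itself at real parameters.\<close>

lemma space_integrand_norm:
  assumes u: "u1 > 0" "u2 > 0" and x: "x > 1" and t: "0 < t" "t < 1" and Z: "Z_poly u1 u2 X x > 0"
  shows "space_integrand u1 u2 (of_real (Re a)) (of_real (Re b)) (of_real (Re c)) ((x, t), X) = of_real (norm (space_integrand u1 u2 a b c ((x, t), X)))"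
proof -
  have X: "X - 1 + t > 0" using space_integrand_inner(3)[OF u _ _ x t Z, of 1 0] by simp
  have r: "rpow z (of_real s) = of_real (norm (rpow z e))" if "z > 0" "s = Re e" for z s e
    using that by (simp add: rpow_of_real norm_rpow)
  have e: "complex_of_real (Re a) - 1 = of_real (Re a - 1)" "- complex_of_real (Re a) - of_real (Re b) = of_real (- Re a - Re b)"
    "complex_of_real (Re a) + of_real (Re b) + of_real (Re c) = of_real (Re a + Re b + Re c)"
    "- complex_of_real (Re a) - of_real (Re c) - 1 = of_real (- Re a - Re c - 1)" by simp_all
  have "rpow (Z_poly u1 u2 X x) (of_real (Re a - 1)) = of_real (norm (rpow (Z_poly u1 u2 X x) (a - 1)))"
    "rpow x (of_real (- Re a - Re b)) = of_real (norm (rpow x (- a - b)))"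
    "rpow t (of_real (Re c)) = of_real (norm (rpow t c))"
    "rpow (1 - t) (of_real (Re a + Re b + Re c)) = of_real (norm (rpow (1 - t) (a + b + c)))"
    "rpow (X - 1 + t) (of_real (- Re a - Re c - 1)) = of_real (norm (rpow (X - 1 + t) (- a - c - 1)))"
    by (rule r; use assms X in simp)+
  then show ?thesis unfolding space_integrand_def prod.case e norm_mult by simp
qed

lemma Z_poly_lower_limit:
  assumes "y1 > 1" "y2 > 1" "x > 1" "Z_poly (y1\<^sup>2 - 1) (y2\<^sup>2 - 1) X x > 0"
  shows "X > (lower_limit y1 y2)\<^sup>2"
proof -
  have u: "y1\<^sup>2 - 1 > 0" "y2\<^sup>2 - 1 > 0" using assms by (simp_all add: power2_eq_square less_1_mult)
  have "(lower_limit y1 y2)\<^sup>2 = y1\<^sup>2 * y2\<^sup>2 + (y1\<^sup>2 - 1) * (y2\<^sup>2 - 1) + 2 * (y1 * y2 * sqrt ((y1\<^sup>2 - 1) * (y2\<^sup>2 - 1)))"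
    using u by (simp add: lower_limit_def power2_sum power_mult_distrib)
  also have "y1 * y2 * sqrt ((y1\<^sup>2 - 1) * (y2\<^sup>2 - 1)) = sqrt (y1\<^sup>2 * y2\<^sup>2 * ((y1\<^sup>2 - 1) * (y2\<^sup>2 - 1)))"
    using assms by (simp add: real_sqrt_mult)
  finally show ?thesis using Z_poly_pos_imp[OF u assms(3,4)] by (simp add: mult.assoc)
qed

text \<open>Two evaluations of the integral of h are equated. Innermost integration over (x, t)
  gives the y3-integral; innermost integration over X gives \<open>plane_integrand\<close> and hence
  the two Jacobi functions.\<close>

lemma product_formula_pos:
  fixes a b c :: complex
  assumes y1: "y1 > 1" and y2: "y2 > 1" and a: "Re a > 0" and bc: "Re (b + c) > - 1" and c: "Re c > - 1"
  defines "q \<equiv> \<lambda>y::real. jacobi_Q c a b (of_real (2 * y\<^sup>2 - 1))"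
  shows "of_real (sqrt pi) * Gamma (a + c + 1) *
      (LINT y:{lower_limit y1 y2<..}|lborel. q y * rpow y (a + b) * kern a b (A_arg y1 y2 y)) =
    Gamma (c + 1) * rpow (y1 * y2) (b - a + 1) * rpow ((y1\<^sup>2 - 1) * (y2\<^sup>2 - 1)) a * (q y1 * q y2)"
proof -
  define u1 u2 L where "u1 = y1\<^sup>2 - 1" and "u2 = y2\<^sup>2 - 1" and "L = lower_limit y1 y2"
  have u: "u1 > 0" "u2 > 0" using y1 y2 by (simp_all add: u1_def u2_def power2_eq_square less_1_mult)
  have L: "L > 1"
  proof -
    have "y1 * y2 > 1" "sqrt (u1 * u2) \<ge> 0" using y1 y2 u by (simp_all add: less_1_mult)
    then show ?thesis unfolding L_def lower_limit_def u1_def u2_def by linarith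
  qed
  let ?I = "{1<..} \<times> {0<..<1} :: (real \<times> real) set"
  define Om where "Om = {p :: (real \<times> real) \<times> real. fst p \<in> ?I \<and> Z_poly u1 u2 (snd p) (fst (fst p)) > 0}"
  define h where "h p = indicator Om p *\<^sub>R space_integrand u1 u2 a b c p" for p
  have h_fib: "h ((x, t), X) = (if (x, t) \<in> ?I then indicator {X. Z_poly u1 u2 X x > 0} X *\<^sub>R space_integrand u1 u2 a b c ((x, t), X) else 0)" for x t X
    by (auto simp: h_def Om_def indicator_def)
  have bnd: "set_integrable lborel {0<..<1} (\<lambda>t. rpow t (a + c) * rpow (1 - t) (b + c) * rpow (u1 + t) (- c - 1))"
    "set_integrable lborel {0<..<1} (\<lambda>t. rpow t c * rpow (1 - t) (a + b + c) * rpow (u + t) (- a - c - 1))"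
    if "Re a > 0" "Re (b + c) > - 1" "Re c > - 1" "u > 0" for a b c :: complex and u
    by (rule set_integrable_Beta_bounded; use that assms \<open>u1 > 0\<close> in simp)+
  note midI = plane_integral[OF u bnd[OF _ _ _ u(2)]]
  have h_meas: "h \<in> borel_measurable (lborel \<Otimes>\<^sub>M lborel)"
  proof -
    have Om_eq: "Om = {p. 1 < fst (fst p) \<and> 0 < snd (fst p) \<and> snd (fst p) < 1 \<and> 0 < Z_poly u1 u2 (snd p) (fst (fst p))}"
      by (auto simp: Om_def)
    have "Om \<in> sets borel" unfolding Om_eq Z_poly_def
      by (rule pred_Collect_borel) measurable
    moreover have "space_integrand u1 u2 a b c \<in> borel_measurable borel"
      unfolding space_integrand_def case_prod_unfold Z_poly_def by measurable
    ultimately show ?thesis unfolding h_def lborel_prod by simp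
  qed
  have h_AE: "integrable lborel (\<lambda>X. h (p, X))" for p
  proof (cases p)
    case (Pair x t)
    show ?thesis
    proof (cases "(x, t) \<in> ?I")
      case True
      then show ?thesis using space_integrand_inner(1)[OF u a c, of x t b] by (simp add: Pair h_fib set_integrable_def)
    next
      case False
      then have "h (p, X) = 0" for X by (auto simp: h_def Om_def Pair)
      then show ?thesis by simp
    qed
  qed
  \<comment> \<open>The inner integral of the norm is the inner integral at the real parts of the
    parameters, known in closed form, so the hypothesis of Fubini reduces to
    \<open>plane_integral\<close> at real parameters.\<close>
  have h_norm: "complex_of_real (\<integral>X. norm (h (p, X)) \<partial>lborel) = indicator ?I p *\<^sub>R
     (Beta (of_real (Re a)) (of_real (Re c) + 1) * (case p of (x, t) \<Rightarrow> plane_integrand u1 u2 (of_real (Re a)) (of_real (Re b)) (of_real (Re c)) x t))" for p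
  proof (cases "p \<in> ?I")
    case True
    then obtain x t where p: "p = (x, t)" "x > 1" "0 < t" "t < 1" by auto
    have "complex_of_real (\<integral>X. norm (h (p, X)) \<partial>lborel) = (\<integral>X. complex_of_real (norm (h (p, X))) \<partial>lborel)" by simp
    also have "\<dots> = (LINT X:{X. Z_poly u1 u2 X x > 0}|lborel. space_integrand u1 u2 (of_real (Re a)) (of_real (Re b)) (of_real (Re c)) ((x, t), X))"
      unfolding set_lebesgue_integral_def
      by (intro Bochner_Integration.integral_cong) (use p space_integrand_norm[OF u p(2-4)] in \<open>auto simp: h_fib indicator_def\<close>)
    also have "\<dots> = Beta (of_real (Re a)) (of_real (Re c) + 1) * plane_integrand u1 u2 (of_real (Re a)) (of_real (Re b)) (of_real (Re c)) x t"
      by (rule space_integrand_inner) (use u a c p in auto)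
    finally show ?thesis using True p(1) by simp
  qed (cases p, auto simp: h_fib)
  have h_int: "integrable (lborel \<Otimes>\<^sub>M lborel) h"
  proof (rule lborel_pair.Fubini_integrable[OF h_meas])
    have "set_integrable lborel ?I (\<lambda>(x, t). plane_integrand u1 u2 (of_real (Re a)) (of_real (Re b)) (of_real (Re c)) x t)"
      by (rule midI) (use a bc c in auto)
    then have "integrable lborel (\<lambda>p. indicator ?I p *\<^sub>R (Beta (of_real (Re a)) (of_real (Re c) + 1) *
        (case p of (x, t) \<Rightarrow> plane_integrand u1 u2 (of_real (Re a)) (of_real (Re b)) (of_real (Re c)) x t)))"
      using set_integrable_mult_right unfolding set_integrable_def by blast
    then have "integrable lborel (\<lambda>p. complex_of_real (\<integral>X. norm (h (p, X)) \<partial>lborel))" unfolding h_norm .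
    then show "integrable lborel (\<lambda>p. \<integral>X. norm (h (p, X)) \<partial>lborel)"
      using integrable_Re by fastforce
  qed (use h_AE in auto)
  define \<Phi> where "\<Phi> X = (\<integral>p. h (p, X) \<partial>lborel)" for X
  have "(\<integral>X. \<Phi> X \<partial>lborel) = (\<integral>p. \<integral>X. h (p, X) \<partial>lborel \<partial>lborel)"
    unfolding \<Phi>_def by (rule lborel_pair.Fubini_integral[of "\<lambda>p X. h (p, X)"]) (use h_int in simp)
  also have "(\<lambda>p. \<integral>X. h (p, X) \<partial>lborel) = (\<lambda>p. indicator ?I p *\<^sub>R (Beta a (c + 1) * (case p of (x, t) \<Rightarrow> plane_integrand u1 u2 a b c x t)))"
  proof
    fix p
    show "(\<integral>X. h (p, X) \<partial>lborel) = indicator ?I p *\<^sub>R (Beta a (c + 1) * (case p of (x, t) \<Rightarrow> plane_integrand u1 u2 a b c x t))"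
    proof (cases "p \<in> ?I")
      case True
      then obtain x t where p: "p = (x, t)" "x > 1" "0 < t" "t < 1" by auto
      have "(\<integral>X. h (p, X) \<partial>lborel) = (LINT X:{X. Z_poly u1 u2 X x > 0}|lborel. space_integrand u1 u2 a b c ((x, t), X))"
        using p by (simp add: h_fib set_lebesgue_integral_def)
      then show ?thesis using True p space_integrand_inner(2)[OF u a c p(2-4)] by simp
    qed (cases p, auto simp: h_fib)
  qed
  also have "(\<integral>p. indicator ?I p *\<^sub>R (Beta a (c + 1) * (case p of (x, t) \<Rightarrow> plane_integrand u1 u2 a b c x t)) \<partial>lborel)
     = Beta a (c + 1) * (rpow u2 a * (jac_int1 a b c u1 * jac_int2 a b c u2))"
    using midI(2)[OF a bc c a bc c] unfolding set_lebesgue_integral_def[symmetric] jac_int1_def jac_int2_def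
    by simp
  finally have PhiI: "(\<integral>X. \<Phi> X \<partial>lborel) = Beta a (c + 1) * (rpow u2 a * (jac_int1 a b c u1 * jac_int2 a b c u2))" .
  have Phi_meas [measurable]: "\<Phi> \<in> borel_measurable borel"
  proof -
    have "(\<lambda>(X, p). h (p, X)) \<in> borel_measurable (lborel \<Otimes>\<^sub>M lborel)"
      using h_meas by (simp add: measurable_pair_swap_iff[symmetric] case_prod_unfold) 
    then have "(\<lambda>X. \<integral>p. h (p, X) \<partial>lborel) \<in> borel_measurable lborel"
      by (intro lborel.borel_measurable_lebesgue_integral) 
    then show ?thesis by (simp add: \<Phi>_def[abs_def])
  qed
  \<comment> \<open>Below the square of the lower limit every fibre is empty. Hence X = y^2 maps the
    range of integration exactly onto y > L.\<close>
  have Phi0: "\<Phi> X = 0" if "X \<notin> {L\<^sup>2<..}" for X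
  proof -
    have "h (p, X) = 0" for p
      using that Z_poly_lower_limit[OF y1 y2, folded u1_def u2_def L_def]
      by (cases p) (auto simp: h_fib indicator_def)
    then show ?thesis by (simp add: \<Phi>_def)
  qed
  \<comment> \<open>The Gamma quotient between \<open>q\<close> and \<open>jac_int2\<close>. It
    enters both sides of \<open>main\<close> through \<open>jac_int2\<close>, under the integral and
    at y2, and cancels in the end.\<close>
  define kap where "kap = Gamma (a + c + 1) * Gamma (b + c + 1) / (Gamma (c + 1) * Gamma (a + b + c + 1))"
  have abc: "Re (a + c) > - 1" "Re (a + b + c) > - 1" using a bc c by simp_all
  have nz: "Gamma (a + c + 1) \<noteq> 0" "Gamma (b + c + 1) \<noteq> 0" "Gamma (c + 1) \<noteq> 0" "Gamma (a + b + c + 1) \<noteq> 0" "Gamma a \<noteq> 0"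
    using Re_pos_not_nonpos_Ints[of "a + c + 1"] Re_pos_not_nonpos_Ints[of "b + c + 1"] Re_pos_not_nonpos_Ints[of "c + 1"]
      Re_pos_not_nonpos_Ints[of "a + b + c + 1"] Re_pos_not_nonpos_Ints[of a] a bc c abc by (auto simp: Gamma_eq_zero_iff)
  have kap: "kap \<noteq> 0" using nz by (simp add: kap_def)
  have q2: "q y = 1 / 2 * kap * rpow y (- 2 * b) * jac_int2 a b c (y\<^sup>2 - 1)" if "y > 1" for y
    unfolding q_def kap_def by (rule jacobi_Q_eq_jac_int1(2)[OF abc(1) bc that c abc(2)])
  have q1: "q y = 1 / 2 * rpow (y\<^sup>2 - 1) (- a) * rpow y (- 2 * b) * jac_int1 a b c (y\<^sup>2 - 1)" if "y > 1" for y
    unfolding q_def by (rule jacobi_Q_eq_jac_int1(1)[OF abc(1) bc that])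
  \<comment> \<open>The 4 combines dX = 2 y dy with the factor 1/2 that relates \<open>q\<close> to
    its Euler integral.\<close>
  define C where "C = 4 * of_real (sqrt pi) * Gamma a * rpow (y1 * y2) (a + b - 1) / kap"
  have Phi_eq: "\<bar>2 * y\<bar> *\<^sub>R \<Phi> (y\<^sup>2) = C * (q y * rpow y (a + b) * kern a b (A_arg y1 y2 y))" if "y \<in> {L<..}" for y
  proof -
    have y: "y > L" "y > 1" using that L by auto
    define I where "I = {x. x > 1 \<and> Z_poly u1 u2 (y\<^sup>2) x > 0}"
    define f where "f x = rpow (Z_poly u1 u2 (y\<^sup>2) x) (a - 1) * rpow x (- a - b)" for x
    define g where "g t = rpow t c * rpow (1 - t) (a + b + c) * rpow ((y\<^sup>2 - 1) + t) (- a - c - 1)" for t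
    have "y\<^sup>2 - 1 > 0" using y by (simp add: power2_eq_square less_1_mult)
    then have g: "set_integrable lborel {0<..<1} g"
      using bnd(2)[OF a bc c, of "y\<^sup>2 - 1"] by (simp add: g_def[abs_def])
    note f = kernel_fibre_integral[OF y1 y2 y(1)[unfolded L_def] a, folded u1_def u2_def, where b = b, folded I_def f_def]
    have "\<Phi> (y\<^sup>2) = (LINT (x, t):I \<times> {0<..<1}|lborel. f x * g t)"
      unfolding \<Phi>_def set_lebesgue_integral_def
    proof (intro Bochner_Integration.integral_cong refl)
      fix p :: "real \<times> real"
      show "h (p, y\<^sup>2) = indicator (I \<times> {0<..<1}) p *\<^sub>R (case p of (x, t) \<Rightarrow> f x * g t)"
        by (cases p) (auto simp: h_fib I_def f_def g_def space_integrand_def indicator_def)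
    qed
    also have "\<dots> = (LINT x:I|lborel. f x) * (LINT t:{0<..<1}|lborel. g t)"
      by (rule set_integrable_pair_mult(2)[OF _ g]) (use f(1) in \<open>simp add: f_def[abs_def]\<close>)
    also have "(LINT t:{0<..<1}|lborel. g t) = jac_int2 a b c (y\<^sup>2 - 1)"
      by (simp add: jac_int2_def g_def)
    also have "jac_int2 a b c (y\<^sup>2 - 1) = 2 / kap * (rpow y (2 * b) * q y)"
      using kap rpow_minus[of y "2 * b"] unfolding q2[OF y(2)] by simp
    also have "(LINT x:I|lborel. f x) = of_real (sqrt pi) * Gamma a * rpow y (a - b - 1) * rpow (y1 * y2) (a + b - 1) * kern a b (A_arg y1 y2 y)"
      using f(2) by (simp add: f_def[abs_def])
    finally have "\<bar>2 * y\<bar> *\<^sub>R \<Phi> (y\<^sup>2) = C * (q y * (rpow y 1 * rpow y (a - b - 1) * rpow y (2 * b)) * kern a b (A_arg y1 y2 y))"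
      using y by (simp add: C_def rpow_1 scaleR_conv_of_real mult_ac)
    also have "rpow y 1 * rpow y (a - b - 1) * rpow y (2 * b) = rpow y (a + b)"
      unfolding rpow_add[symmetric] by (rule arg_cong) simp
    finally show ?thesis .
  qed
  have bij: "bij_betw (\<lambda>y. y\<^sup>2) {L<..} {L\<^sup>2<..}"
  proof (rule bij_betw_byWitness[where f' = sqrt])
    show "sqrt ` {L\<^sup>2<..} \<subseteq> {L<..}" using L by (auto simp: real_less_rsqrt)
    show "\<forall>x\<in>{L\<^sup>2<..}. (sqrt x)\<^sup>2 = x"
    proof
      fix x assume "x \<in> {L\<^sup>2<..}"
      then have "x \<ge> 0" using zero_le_power2[of L] order_trans[of 0 "L\<^sup>2" x] by simp
      then show "(sqrt x)\<^sup>2 = x" by simp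
    qed
  qed (use L in \<open>auto intro!: power_strict_mono\<close>)
  have der: "((\<lambda>y. y\<^sup>2) has_real_derivative 2 * y) (at y within {L<..})" for y :: real
    by (auto intro!: derivative_eq_intros)
  have ms: "set_borel_measurable borel {L\<^sup>2<..} \<Phi>" "set_borel_measurable borel {L<..} (\<lambda>y. \<bar>2 * y\<bar> *\<^sub>R \<Phi> (y\<^sup>2))"
    unfolding set_borel_measurable_def by measurable
  have "(\<integral>X. \<Phi> X \<partial>lborel) = (LINT X:{L\<^sup>2<..}|lborel. \<Phi> X)"
    unfolding set_lebesgue_integral_def
    by (intro Bochner_Integration.integral_cong refl) (use Phi0 in \<open>auto simp: indicator_def\<close>)
  also have "\<dots> = (LINT y:{L<..}|lborel. \<bar>2 * y\<bar> *\<^sub>R \<Phi> (y\<^sup>2))"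
    using set_integral_substitution(2)[OF _ _ der bij ms] by simp
  also have "\<dots> = (LINT y:{L<..}|lborel. C * (q y * rpow y (a + b) * kern a b (A_arg y1 y2 y)))"
    using Phi_eq by (intro set_lebesgue_integral_cong) auto
  also have "\<dots> = C * (LINT y:{L<..}|lborel. q y * rpow y (a + b) * kern a b (A_arg y1 y2 y))" by simp
  finally have main: "C * (LINT y:{L<..}|lborel. q y * rpow y (a + b) * kern a b (A_arg y1 y2 y))
     = Beta a (c + 1) * (rpow u2 a * (jac_int1 a b c u1 * jac_int2 a b c u2))" using PhiI by simp
  have j1: "jac_int1 a b c u1 = 2 * rpow u1 a * rpow y1 (2 * b) * q y1"
    using q1[OF y1] rpow_minus[of y1 "2 * b"] rpow_minus[of u1 a] by (simp add: u1_def)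
  have j2: "jac_int2 a b c u2 = 2 / kap * (rpow y2 (2 * b) * q y2)"
    using q2[OF y2] rpow_minus[of y2 "2 * b"] kap by (simp add: u2_def)
  define Q where "Q = (LINT y:{L<..}|lborel. q y * rpow y (a + b) * kern a b (A_arg y1 y2 y))"
  have B: "Beta a (c + 1) = Gamma a * Gamma (c + 1) / Gamma (a + c + 1)" by (simp add: Beta_def add_ac)
  have Y: "rpow (y1 * y2) (b - a + 1) * rpow (y1 * y2) (a + b - 1) = rpow y1 (2 * b) * rpow y2 (2 * b)"
  proof -
    have "rpow (y1 * y2) (b - a + 1) * rpow (y1 * y2) (a + b - 1) = rpow (y1 * y2) (2 * b)"
      unfolding rpow_add[symmetric] by (rule arg_cong) simp
    then show ?thesis using y1 y2 by (simp add: rpow_mult)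
  qed
  have "of_real (sqrt pi) * Gamma (a + c + 1) * rpow (y1 * y2) (a + b - 1) * Q
     = Gamma (c + 1) * (rpow u1 a * rpow u2 a) * (rpow y1 (2 * b) * rpow y2 (2 * b)) * (q y1 * q y2)"
    using main nz kap unfolding j1 j2 B C_def Q_def[symmetric] by (simp add: field_simps)
  also have "\<dots> = rpow (y1 * y2) (a + b - 1) * (Gamma (c + 1) * rpow (y1 * y2) (b - a + 1) * (rpow u1 a * rpow u2 a) * (q y1 * q y2))"
    unfolding Y[symmetric] by simp
  finally have "of_real (sqrt pi) * Gamma (a + c + 1) * Q = Gamma (c + 1) * rpow (y1 * y2) (b - a + 1) * (rpow u1 a * rpow u2 a) * (q y1 * q y2)"
    by (simp add: mult_ac)
  then show ?thesis using u by (simp add: Q_def L_def u1_def u2_def rpow_mult)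
qed

subsection \<open>Growth of the integrand\<close>

lemma powr_comparable_le:
  fixes k K y z :: real
  assumes "0 < k" "0 < y" "k * y \<le> z" "z \<le> K * y"
  shows "z powr e \<le> (k powr e + K powr e) * y powr e"
proof -
  have "k * y \<le> K * y" using assms by linarith
  then have "K > 0" using assms by simp
  then have "(k * y) powr e + (K * y) powr e = (k powr e + K powr e) * y powr e"
    using assms by (simp add: powr_mult distrib_right)
  then show ?thesis using powr_between_le[of "k * y" z "K * y" e] assms by simp
qed

text \<open>Controls the kernel integral as w -> 1, that is, as A -> infinity. The rate d is left
  free above b so that it can later be balanced against the decay of the remaining factors.\<close>

lemma kernel_growth:
  fixes r b d :: real
  assumes r: "r > - 1" and d: "d \<ge> 0" "d > b"
  obtains C where "C \<ge> 0" "\<And>w. w \<in> {0<..<1} \<Longrightarrow>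
    (LINT u:{-1<..<1}|lborel. (1 - u\<^sup>2) powr r * (1 + w * u) powr (- (r + b) - 1)) \<le> C * (1 - w) powr (- d)"
    "\<And>w. w \<in> {0<..<1} \<Longrightarrow>
      set_integrable lborel {-1<..<1} (\<lambda>u. (1 - u\<^sup>2) powr r * (1 + w * u) powr (- (r + b) - 1))"
proof -
  \<comment> \<open>Splits the exponent -(r + b) - 1 as -d + e. The power -d is estimated by 1 - w;
    the power e is estimated by (1 + u) / 2 and 2, and near u = -1 integrability requires r + e >
    -1, which is d > b.\<close>
  define e where "e = d - b - r - 1"
  define g where "g u = (1 - u\<^sup>2) powr r * ((1 + u) / 2) powr e + (1 - u\<^sup>2) powr r * 2 powr e" for u :: real
  have B: "set_integrable lborel {-1<..<1} (\<lambda>u::real. (1 - u) powr p * (1 + u) powr q)" if "p > - 1" "q > - 1" for p q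
  proof -
    have bij: "bij_betw (\<lambda>t. 1 - 2 * t) {0<..<1} {-1<..<1::real}"
      by (rule bij_betw_byWitness[where f' = "\<lambda>u. (1 - u) / 2"]) (auto simp: field_simps)
    have der: "((\<lambda>t. 1 - 2 * t) has_real_derivative - 2) (at t within {0<..<1})" for t :: real
      by (auto intro!: derivative_eq_intros)
    have m: "set_borel_measurable borel {-1<..<1} (\<lambda>u::real. (1 - u) powr p * (1 + u) powr q)"
      "set_borel_measurable borel {0<..<1} (\<lambda>t::real. \<bar>- 2\<bar> *\<^sub>R ((1 - (1 - 2 * t)) powr p * (1 + (1 - 2 * t)) powr q))"
      unfolding set_borel_measurable_def
      by measurable
    have I: "set_integrable lborel {0<..<1} (\<lambda>t::real. (2 * 2 powr p * 2 powr q) * (t powr p * (1 - t) powr q))"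
    proof (rule set_integrable_mult_right)
      have "set_integrable lborel {0..1} (\<lambda>t::real. t powr p * (1 - t) powr q)"
        using integrable_Beta[of "p + 1" "q + 1"] that by simp
      then show "set_integrable lborel {0<..<1} (\<lambda>t::real. t powr p * (1 - t) powr q)"
        by (rule set_integrable_subset) auto
    qed
    have eq: "\<bar>- 2\<bar> *\<^sub>R ((1 - (1 - 2 * t)) powr p * (1 + (1 - 2 * t)) powr q) = (2 * 2 powr p * 2 powr q) * (t powr p * (1 - t) powr q)"
      if "t \<in> {0<..<1}" for t :: real
    proof -
      have e: "1 - (1 - 2 * t) = 2 * t" "1 + (1 - 2 * t) = 2 * (1 - t)" by simp_all
      have p: "(2 * t) powr p = 2 powr p * t powr p" "(2 * (1 - t)) powr q = 2 powr q * (1 - t) powr q"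
        by (rule powr_mult)+
      show ?thesis unfolding e p by (simp only: mult_ac real_scaleR_def abs_minus_cancel abs_numeral)
    qed
    have "set_integrable lborel {0<..<1} (\<lambda>t::real. \<bar>- 2\<bar> *\<^sub>R ((1 - (1 - 2 * t)) powr p * (1 + (1 - 2 * t)) powr q))"
      by (rule iffD2[OF set_integrable_cong[OF refl refl eq] I])
    then show ?thesis using set_integral_substitution(1)[OF _ _ der bij m] by simp
  qed
  have split: "(1 - u\<^sup>2) powr r = (1 - u) powr r * (1 + u) powr r" if "u \<in> {-1<..<1}" for u :: real
  proof -
    have "1 - u\<^sup>2 = (1 - u) * (1 + u)" by (simp add: power2_eq_square algebra_simps)
    then show ?thesis using that by (simp add: powr_mult)
  qed
  have g: "set_integrable lborel {-1<..<1} g"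
  proof -
    have I: "set_integrable lborel {-1<..<1} (\<lambda>u. (2 powr (- e)) * ((1 - u) powr r * (1 + u) powr (r + e)) + 2 powr e * ((1 - u) powr r * (1 + u) powr r))"
      by (intro set_integral_add set_integrable_mult_right B) (use r d in \<open>auto simp: e_def\<close>)
    have eq: "g u = (2 powr (- e)) * ((1 - u) powr r * (1 + u) powr (r + e)) + 2 powr e * ((1 - u) powr r * (1 + u) powr r)"
      if "u \<in> {-1<..<1}" for u
    proof -
      have "((1 + u) / 2) powr e = (1 + u) powr e * 2 powr (- e)"
        using that by (simp add: powr_divide powr_minus_divide)
      moreover have "(1 + u) powr (r + e) = (1 + u) powr r * (1 + u) powr e" by (rule powr_add)
      ultimately show ?thesis unfolding g_def split[OF that] by (simp only: mult_ac)
    qed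
    show ?thesis by (rule iffD2[OF set_integrable_cong[OF refl refl eq] I])
  qed
  have bd: "(1 - u\<^sup>2) powr r * (1 + w * u) powr (- (r + b) - 1) \<le> (1 - w) powr (- d) * g u"
    if w: "w \<in> {0<..<1}" and u: "u \<in> {-1<..<1}" for w u
  proof -
    note bds = one_plus_bounds[OF w u]
    have "(1 + w * u) powr (- (r + b) - 1) = (1 + w * u) powr (- d) * (1 + w * u) powr e"
      by (simp add: e_def flip: powr_add) (simp add: algebra_simps)
    also have "\<dots> \<le> (1 - w) powr (- d) * (((1 + u) / 2) powr e + 2 powr e)"
    proof (intro mult_mono)
      show "(1 + w * u) powr (- d) \<le> (1 - w) powr (- d)"
        using bds(1) w d by (intro powr_mono2') auto
      show "(1 + w * u) powr e \<le> ((1 + u) / 2) powr e + 2 powr e"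
        using bds u by (intro powr_between_le) auto
    qed auto
    finally have "(1 - u\<^sup>2) powr r * (1 + w * u) powr (- (r + b) - 1) \<le> (1 - u\<^sup>2) powr r * ((1 - w) powr (- d) * (((1 + u) / 2) powr e + 2 powr e))"
      by (intro mult_left_mono) auto
    then show ?thesis by (simp add: g_def algebra_simps)
  qed
  have int: "set_integrable lborel {-1<..<1} (\<lambda>u. (1 - u\<^sup>2) powr r * (1 + w * u) powr (- (r + b) - 1))"
    if w: "w \<in> {0<..<1}" for w
    unfolding set_integrable_def
  proof (rule Bochner_Integration.integrable_bound)
    show "integrable lborel (\<lambda>u. indicat_real {-1<..<1} u *\<^sub>R ((1 - w) powr (- d) * g u))"
      using set_integrable_mult_right[OF g, of "(1 - w) powr (- d)"] by (simp add: set_integrable_def)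
    show "AE u in lborel. norm (indicat_real {-1<..<1} u *\<^sub>R ((1 - u\<^sup>2) powr r * (1 + w * u) powr (- (r + b) - 1)))
       \<le> norm (indicat_real {-1<..<1} u *\<^sub>R ((1 - w) powr (- d) * g u))"
      using order_trans[OF bd[OF w] abs_ge_self] by (auto intro!: AE_I2 simp: indicator_def)
  qed measurable
  show ?thesis
  proof (rule that[of "\<bar>LINT u:{-1<..<1}|lborel. g u\<bar>"])
    fix w :: real assume w: "w \<in> {0<..<1}"
    have "(LINT u:{-1<..<1}|lborel. (1 - u\<^sup>2) powr r * (1 + w * u) powr (- (r + b) - 1)) \<le> (LINT u:{-1<..<1}|lborel. (1 - w) powr (- d) * g u)"
      by (rule set_integral_mono[OF int[OF w] set_integrable_mult_right[OF g]]) (use bd[OF w] in auto)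
    also have "\<dots> = (1 - w) powr (- d) * (LINT u:{-1<..<1}|lborel. g u)" by simp
    also have "\<dots> \<le> (1 - w) powr (- d) * \<bar>LINT u:{-1<..<1}|lborel. g u\<bar>" by (intro mult_left_mono) auto
    finally show "(LINT u:{-1<..<1}|lborel. (1 - u\<^sup>2) powr r * (1 + w * u) powr (- (r + b) - 1)) \<le> \<bar>LINT u:{-1<..<1}|lborel. g u\<bar> * (1 - w) powr (- d)"
      by (simp only: mult.commute)
    show "set_integrable lborel {-1<..<1} (\<lambda>u. (1 - u\<^sup>2) powr r * (1 + w * u) powr (- (r + b) - 1))"
      by (rule int[OF w])
  qed simp
qed

text \<open>The case x0 = L, r = 0 of \<open>Beta_integral_Ioi\<close>; its two conditions are
  integrability at L and at infinity.\<close>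

lemma algebraic_tail_integrable:
  fixes p e L :: real
  assumes "L > 0" "p > - 1" "p + e < - 1"
  shows "set_integrable lborel {L<..} (\<lambda>y. (y - L) powr p * y powr e)"
proof -
  have "set_integrable lborel {L<..} (\<lambda>x. rpow (x - L) (of_real (p + 1) - 1) * rpow (x + 0) (- of_real (p + 1) - of_real (- e - p - 1)))"
    by (rule Beta_integral_Ioi) (use assms in auto)
  then show ?thesis
    unfolding set_integrable_def
  proof (rule Bochner_Integration.integrable_bound)
    show "AE x in lborel. norm (indicat_real {L<..} x *\<^sub>R ((x - L) powr p * x powr e)) \<le>
      norm (indicat_real {L<..} x *\<^sub>R (rpow (x - L) (of_real (p + 1) - 1) * rpow (x + 0) (- of_real (p + 1) - of_real (- e - p - 1))))"
      using assms(1) by (auto intro!: AE_I2 simp: indicator_def norm_mult norm_rpow)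
  qed measurable
qed

section \<open>Behaviour of the y3-integrand at the lower limit and at infinity\<close>

locale two_points =
  fixes y1 y2 :: real
  assumes y1: "y1 > 1" and y2: "y2 > 1"
begin

abbreviation "Llim \<equiv> lower_limit y1 y2"

abbreviation "AA \<equiv> A_arg y1 y2"

text \<open>A grows linearly, and A^2 - 1 has exactly a simple zero at the lower limit. The
  constants are uniform in y, so endpoint singularity and growth at infinity are captured by one
  estimate.\<close>

lemma A_comparable:
  obtains k K where "k > 0" "K > 0"
    "\<And>y. y > Llim \<Longrightarrow> k * y\<^sup>2 \<le> y\<^sup>2 - 1" "\<And>y. y > Llim \<Longrightarrow> k * y \<le> AA y" "\<And>y. y > Llim \<Longrightarrow> AA y \<le> K * y"
    "\<And>y. y > Llim \<Longrightarrow> k * y \<le> ((AA y)\<^sup>2 - 1) / (y - Llim)" "\<And>y. y > Llim \<Longrightarrow> ((AA y)\<^sup>2 - 1) / (y - Llim) \<le> K * y"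
proof -
  define N Y s where "N = (y1\<^sup>2 - 1) * (y2\<^sup>2 - 1)" and "Y = y1 * y2" and "s = sqrt N"
  have u: "y1\<^sup>2 - 1 > 0" "y2\<^sup>2 - 1 > 0" using y1 y2 by (simp_all add: power2_eq_square less_1_mult)
  have Y: "Y > 1" using y1 y2 by (simp add: Y_def less_1_mult)
  have s: "s > 0" "s * s = N" using u by (simp_all add: s_def N_def)
  have L: "Llim = Y + s" by (simp add: lower_limit_def Y_def s_def N_def)
  define k0 where "k0 = y1\<^sup>2 + y2\<^sup>2 - 1"
  have k0: "k0 > 0" using u by (simp add: k0_def)
  have NY: "Y * Y - s * s = k0" by (simp add: s(2) N_def Y_def k0_def power2_eq_square algebra_simps)
  have sY: "s < Y"
  proof (rule ccontr)
    assume "\<not> s < Y"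
    then have "Y * Y \<le> s * s" using Y by (intro mult_mono) auto
    then show False using NY k0 by simp
  qed
  have L1: "Llim > 1" using L Y s by simp
  \<comment> \<open>The value of (y - (Y - s)) / y at y = Y + s, its minimum over the range of
    integration.\<close>
  define \<delta> where "\<delta> = 2 * s / (Y + s)"
  have \<delta>: "0 < \<delta>" "\<delta> * (Y + s) = 2 * s" using s Y by (auto simp: \<delta>_def)
  define k1 where "k1 = 1 - 1 / Llim\<^sup>2"
  have k1: "k1 > 0" using L1 by (simp add: k1_def power2_eq_square less_1_mult divide_less_eq)
  have yy: "y > Llim \<Longrightarrow> k1 * y\<^sup>2 \<le> y\<^sup>2 - 1" for y
  proof -
    assume y: "y > Llim"
    have "1 \<le> y\<^sup>2 / Llim\<^sup>2" using y L1 power_mono[of Llim y 2] by (simp add: le_divide_eq)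
    then show ?thesis by (simp add: k1_def algebra_simps)
  qed
  have A: "AA y = (y\<^sup>2 + k0) / (2 * Y * y)" for y
    by (simp add: A_arg_def k0_def Y_def algebra_simps)
  have A1: "y / (2 * Y) \<le> AA y" "AA y \<le> (1 + k0) / (2 * Y) * y" if y: "y > Llim" for y
  proof -
    have y1': "y > 1" using y L1 by simp
    have A': "AA y = y / (2 * Y) + k0 / (2 * Y * y)" unfolding A using y1' Y by (simp add: field_simps power2_eq_square)
    have "k0 / (2 * Y * y) \<ge> 0" using y1' Y k0 by simp
    then show "y / (2 * Y) \<le> AA y" unfolding A' by simp
    have "1 \<le> y * y" using y1' mult_mono[of 1 y 1 y] by simp
    then have "k0 \<le> k0 * (y * y)" using k0 by simp
    then have "k0 / (2 * Y * y) \<le> k0 / (2 * Y) * y" using y1' Y by (simp add: field_simps)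
    moreover have "(1 + k0) / (2 * Y) * y = y / (2 * Y) + k0 / (2 * Y) * y"
      by (simp add: add_divide_distrib distrib_right)
    ultimately show "AA y \<le> (1 + k0) / (2 * Y) * y" unfolding A' by linarith
  qed
  \<comment> \<open>The roots of A = 1 are Y + s and Y - s, with product Y^2 - s^2 = k0. Only the
    larger one lies at the end of the range, and dividing by y - \<open>Llim\<close> removes
    it.\<close>
  have E: "((AA y)\<^sup>2 - 1) / (y - Llim) = (y - (Y - s)) / y * ((AA y + 1) / (2 * Y))" if y: "y > Llim" for y
  proof -
    have yp: "y > 0" using y L1 by simp
    have "(AA y - 1) * (2 * Y * y) = y\<^sup>2 + k0 - 2 * Y * y"
      unfolding A using yp Y by (simp add: field_simps)
    also have "\<dots> = (y - Llim) * (y - (Y - s))"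
      unfolding L NY[symmetric] by (simp add: power2_eq_square algebra_simps)
    finally have "AA y - 1 = (y - Llim) * (y - (Y - s)) / (2 * Y * y)"
      using yp Y by (simp add: field_simps)
    moreover have "(AA y)\<^sup>2 - 1 = (AA y - 1) * (AA y + 1)" by (simp add: power2_eq_square algebra_simps)
    ultimately show ?thesis using y by simp
  qed
  have E1: "\<delta> * (y / (4 * Y * Y)) \<le> ((AA y)\<^sup>2 - 1) / (y - Llim)"
    "((AA y)\<^sup>2 - 1) / (y - Llim) \<le> 1 * (((1 + k0) / (2 * Y) * y + y) / (2 * Y))" if y: "y > Llim" for y
  proof -
    have yp: "y > 1" using y L1 by simp
    have "(y - (Y - s)) / y = 1 - (Y - s) / y" using yp by (simp add: diff_divide_distrib)
    have lo: "\<delta> \<le> (y - (Y - s)) / y"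
    proof -
      have "(Y - s) / y \<le> (Y - s) / (Y + s)" using y L sY Y s by (intro divide_left_mono mult_pos_pos) auto
      also have "\<dots> = 1 - \<delta>" using Y s by (simp add: \<delta>_def field_simps)
      finally show ?thesis using yp by (simp add: diff_divide_distrib)
    qed
    have hi: "(y - (Y - s)) / y \<le> 1" using yp sY by simp
    have lo2: "y / (4 * Y * Y) \<le> (AA y + 1) / (2 * Y)"
    proof -
      have "y / (2 * Y) / (2 * Y) \<le> (AA y + 1) / (2 * Y)"
        using A1(1)[OF y] Y by (intro divide_right_mono) auto
      then show ?thesis by (simp add: mult_ac)
    qed
    have hi2: "(AA y + 1) / (2 * Y) \<le> ((1 + k0) / (2 * Y) * y + y) / (2 * Y)"
      using A1(2)[OF y] yp Y by (intro divide_right_mono) auto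
    have pos: "0 \<le> y / (4 * Y * Y)" using yp Y by simp
    show "\<delta> * (y / (4 * Y * Y)) \<le> ((AA y)\<^sup>2 - 1) / (y - Llim)"
      unfolding E[OF y] using lo lo2 pos \<delta>(1) by (intro mult_mono) auto
    show "((AA y)\<^sup>2 - 1) / (y - Llim) \<le> 1 * (((1 + k0) / (2 * Y) * y + y) / (2 * Y))"
      unfolding E[OF y] using hi hi2 pos lo2 by (intro mult_mono) auto
  qed
  define k where "k = Min {k1, 1 / (2 * Y), \<delta> / (4 * Y * Y)}"
  define K where "K = Max {(1 + k0) / (2 * Y), ((1 + k0) / (2 * Y) + 1) / (2 * Y)}"
  have kle: "k \<le> k1" "k \<le> 1 / (2 * Y)" "k \<le> \<delta> / (4 * Y * Y)" "k > 0" using k1 \<delta> Y by (auto simp: k_def)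
  have Kge: "(1 + k0) / (2 * Y) \<le> K" "((1 + k0) / (2 * Y) + 1) / (2 * Y) \<le> K" by (auto simp: K_def)
  have "(1 + k0) / (2 * Y) > 0" using k0 Y by simp
  then have Kpos: "K > 0" using Kge(1) by linarith
  show ?thesis
  proof (rule that[of k K])
    fix y assume y: "y > Llim"
    then have yp: "y > 0" using L1 by simp
    show "k * y\<^sup>2 \<le> y\<^sup>2 - 1" using yy[OF y] mult_right_mono[OF kle(1), of "y\<^sup>2"] by simp
    show "k * y \<le> AA y" using A1(1)[OF y] mult_right_mono[OF kle(2), of y] yp by simp
    show "AA y \<le> K * y" using A1(2)[OF y] mult_right_mono[OF Kge(1), of y] yp by simp
    show "k * y \<le> ((AA y)\<^sup>2 - 1) / (y - Llim)" using E1(1)[OF y] mult_right_mono[OF kle(3), of y] yp by simp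
    have "((1 + k0) / (2 * Y) * y + y) / (2 * Y) = ((1 + k0) / (2 * Y) + 1) / (2 * Y) * y"
      using Y by (simp add: field_simps)
    then show "((AA y)\<^sup>2 - 1) / (y - Llim) \<le> K * y"
      using E1(2)[OF y] mult_right_mono[OF Kge(2), of y] yp by linarith
  qed (use kle Kpos in auto)
qed

definition modulus :: "real \<Rightarrow> real" where "modulus y = sqrt (1 - 1 / (AA y)\<^sup>2)"

text \<open>The last bound comes from (1 - w) (1 + w) = 1 / A^2 with 1 + w \<le> 2. It turns a power
  (1 - w)^(-d) into growth of order A^(2d).\<close>

lemma modulus: "y > Llim \<Longrightarrow> modulus y \<in> {0<..<1}" "y > Llim \<Longrightarrow> (modulus y)\<^sup>2 = 1 - 1 / (AA y)\<^sup>2"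
  "y > Llim \<Longrightarrow> 1 - modulus y \<ge> 1 / (2 * (AA y)\<^sup>2)"
proof -
  assume y: "y > Llim"
  have A: "AA y > 1" using A_arg_gt_1[OF y1 y2 y] by simp
  then have A2: "(AA y)\<^sup>2 > 1" by (simp add: power2_eq_square less_1_mult)
  then have "1 / (AA y)\<^sup>2 < 1" "1 / (AA y)\<^sup>2 > 0" using A by (simp_all add: divide_less_eq)
  then show w: "modulus y \<in> {0<..<1}" and w2: "(modulus y)\<^sup>2 = 1 - 1 / (AA y)\<^sup>2" by (auto simp: modulus_def)
  have "1 / (AA y)\<^sup>2 = (1 - modulus y) * (1 + modulus y)" using w2 by (simp add: power2_eq_square algebra_simps)
  also have "\<dots> \<le> (1 - modulus y) * 2" using w by (intro mult_left_mono) auto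
  finally show "1 - modulus y \<ge> 1 / (2 * (AA y)\<^sup>2)" by simp
qed

text \<open>What remains of 2 * Q * y^(a+b) * \<open>kern\<close>, with Q the Jacobi function at 2
  y^2 - 1, once \<open>jac_int1\<close> and the Gauss series of \<open>kern\<close> are taken
  out.\<close>

definition prefactor :: "complex \<Rightarrow> complex \<Rightarrow> real \<Rightarrow> complex" where
  "prefactor a b y = rpow (y\<^sup>2 - 1) (- a) * rpow y (a - b) * (rpow ((AA y)\<^sup>2 - 1) (a - 1 / 2) * rpow (AA y) (- (a + b)))"

definition jacobi_weight :: "complex \<Rightarrow> complex \<Rightarrow> complex \<Rightarrow> real \<Rightarrow> real \<Rightarrow> complex" where
  "jacobi_weight a b c y t = rpow t (a + c) * rpow (1 - t) (b + c) * rpow (y\<^sup>2 - 1 + t) (- c - 1)"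

text \<open>A pure product of powers, hence exponential in a. \<open>kernel_weight\<close>, the
  integrand of \<open>kernel_rep_regularized\<close> at s = a + b, is this times a factor bounded in
  y and u (\<open>kernel_weight_eq\<close>).\<close>

definition kernel_majorant :: "complex \<Rightarrow> complex \<Rightarrow> real \<Rightarrow> real \<Rightarrow> complex" where
  "kernel_majorant a b y u = rpow (1 - u\<^sup>2) a * rpow (1 + modulus y * u) (- (a + b) - 1)"

definition kernel_weight :: "complex \<Rightarrow> complex \<Rightarrow> real \<Rightarrow> real \<Rightarrow> complex" where
  "kernel_weight a b y u = rpow (1 - u\<^sup>2) a * ((a + 1 / 2) * rpow (1 + modulus y * u) (- (a + b)) -
      (a + b) / 2 * of_real (modulus y * u) * rpow (1 + modulus y * u) (- (a + b) - 1))"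

text \<open>Every base is replaced by a constant multiple of a power of y, except the simple zero of
  A^2 - 1 at the lower limit. The exponent of y adds up from 2 (-a - c - 1), a - b, a - 1/2 and 2 d
  - a - b.\<close>

lemma prefactor_bound:
  fixes a b c :: real
  assumes bc: "b + c > - 1" and c: "c > - 1" and d: "d \<ge> 0"
  obtains C where "C \<ge> 0" "\<And>y. y > Llim \<Longrightarrow>
    norm (prefactor (of_real a) (of_real b) y) * ((y\<^sup>2 - 1) powr (- c - 1) * (1 - modulus y) powr (- d))
      \<le> C * ((y - Llim) powr (a - 1 / 2) * y powr (2 * d - a - 2 * b - 2 * c - 5 / 2))"
proof -
  obtain k K where kK: "k > 0" "K > 0"
    and h1: "\<And>y. y > Llim \<Longrightarrow> k * y\<^sup>2 \<le> y\<^sup>2 - 1" and h2: "\<And>y. y > Llim \<Longrightarrow> k * y \<le> AA y" "\<And>y. y > Llim \<Longrightarrow> AA y \<le> K * y"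
    and h3: "\<And>y. y > Llim \<Longrightarrow> k * y \<le> ((AA y)\<^sup>2 - 1) / (y - Llim)" "\<And>y. y > Llim \<Longrightarrow> ((AA y)\<^sup>2 - 1) / (y - Llim) \<le> K * y"
    using A_comparable by blast
  define C1 C2 C3 C4 where "C1 = k powr (- a - c - 1) + 1 powr (- a - c - 1)"
    and "C2 = k powr (a - 1 / 2) + K powr (a - 1 / 2)" and "C3 = k powr (2 * d - a - b) + K powr (2 * d - a - b)"
    and "C4 = (1 / 2) powr (- d)"
  have Cpos: "C1 \<ge> 0" "C2 \<ge> 0" "C3 \<ge> 0" "C4 \<ge> 0" by (auto simp: C1_def C2_def C3_def C4_def)
  show ?thesis
  proof (rule that[of "C1 * C2 * C3 * C4"])
    fix y assume y: "y > Llim"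
    have A: "AA y > 1" "y > 1" using A_arg_gt_1[OF y1 y2 y] by auto
    have A2: "(AA y)\<^sup>2 - 1 > 0" using A by (simp add: power2_eq_square less_1_mult)
    have y2': "y\<^sup>2 - 1 > 0" using A by (simp add: power2_eq_square less_1_mult)
    have e: "- complex_of_real a = of_real (- a)" "complex_of_real a - of_real b = of_real (a - b)"
      "complex_of_real a - 1 / 2 = of_real (a - 1 / 2)" "- (complex_of_real a + of_real b) = of_real (- a - b)" by simp_all
    have n: "norm (prefactor (of_real a) (of_real b) y) = (y\<^sup>2 - 1) powr (- a) * y powr (a - b) * (((AA y)\<^sup>2 - 1) powr (a - 1 / 2) * AA y powr (- a - b))"
      unfolding prefactor_def e norm_mult using A A2 y2' by (simp only: norm_rpow Re_complex_of_real)
    have b1: "(y\<^sup>2 - 1) powr (- a - c - 1) \<le> C1 * (y\<^sup>2) powr (- a - c - 1)"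
      unfolding C1_def using kK h1[OF y] A by (intro powr_comparable_le) auto
    have b2: "((AA y)\<^sup>2 - 1) powr (a - 1 / 2) \<le> (y - Llim) powr (a - 1 / 2) * (C2 * y powr (a - 1 / 2))"
    proof -
      have "(AA y)\<^sup>2 - 1 = (y - Llim) * (((AA y)\<^sup>2 - 1) / (y - Llim))" using y by simp
      then have "((AA y)\<^sup>2 - 1) powr (a - 1 / 2) = (y - Llim) powr (a - 1 / 2) * (((AA y)\<^sup>2 - 1) / (y - Llim)) powr (a - 1 / 2)"
        using y A2 by (metis powr_mult)
      also have "\<dots> \<le> (y - Llim) powr (a - 1 / 2) * (C2 * y powr (a - 1 / 2))"
        unfolding C2_def using kK h3[OF y] A by (intro mult_left_mono powr_comparable_le) auto
      finally show ?thesis .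
    qed
    have b4: "(1 - modulus y) powr (- d) \<le> C4 * AA y powr (2 * d)"
    proof -
      have "(1 - modulus y) powr (- d) \<le> (1 / (2 * (AA y)\<^sup>2)) powr (- d)"
        using modulus(3)[OF y] d A by (intro powr_mono2') auto
      also have "1 / (2 * (AA y)\<^sup>2) = (1 / 2) * (AA y powr (- 2))" using A by (simp add: powr_minus_divide)
      also have "\<dots> powr (- d) = C4 * AA y powr (2 * d)" unfolding powr_mult powr_powr C4_def by simp
      finally show ?thesis .
    qed
    have b3: "AA y powr (2 * d - a - b) \<le> C3 * y powr (2 * d - a - b)"
      unfolding C3_def using kK h2[OF y] A by (intro powr_comparable_le) auto
    have "norm (prefactor (of_real a) (of_real b) y) * ((y\<^sup>2 - 1) powr (- c - 1) * (1 - modulus y) powr (- d))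
      = (y\<^sup>2 - 1) powr (- a - c - 1) * (y powr (a - b) * (((AA y)\<^sup>2 - 1) powr (a - 1 / 2) * (AA y powr (- a - b) * (1 - modulus y) powr (- d))))"
    proof -
      have "(y\<^sup>2 - 1) powr (- a - c - 1) = (y\<^sup>2 - 1) powr (- a + (- c - 1))" by (rule arg_cong) simp
      then have "(y\<^sup>2 - 1) powr (- a - c - 1) = (y\<^sup>2 - 1) powr (- a) * (y\<^sup>2 - 1) powr (- c - 1)"
        by (simp only: powr_add)
      then show ?thesis unfolding n by (simp only: mult_ac)
    qed
    also have "\<dots> \<le> (C1 * (y\<^sup>2) powr (- a - c - 1)) * (y powr (a - b) * (((y - Llim) powr (a - 1 / 2) * (C2 * y powr (a - 1 / 2))) * (C3 * C4 * y powr (2 * d - a - b))))"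
    proof -
      have "AA y powr (- a - b) * (1 - modulus y) powr (- d) \<le> AA y powr (- a - b) * (C4 * AA y powr (2 * d))"
        by (intro mult_left_mono b4) auto
      also have "\<dots> = C4 * AA y powr (2 * d - a - b)"
      proof -
        have "AA y powr (2 * d - a - b) = AA y powr ((- a - b) + 2 * d)" by (rule arg_cong) simp
        then show ?thesis by (simp only: powr_add mult_ac)
      qed
      also have "\<dots> \<le> C4 * (C3 * y powr (2 * d - a - b))" by (intro mult_left_mono b3 Cpos)
      finally have b34: "AA y powr (- a - b) * (1 - modulus y) powr (- d) \<le> C3 * C4 * y powr (2 * d - a - b)" by (simp add: mult_ac)
      show ?thesis
        by (rule mult_mono[OF b1 mult_left_mono[OF mult_mono[OF b2 b34]]]) (use Cpos in auto)
    qed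
    also have "\<dots> = C1 * C2 * C3 * C4 * ((y - Llim) powr (a - 1 / 2) * y powr (2 * d - a - 2 * b - 2 * c - 5 / 2))"
    proof -
      have "(y\<^sup>2) powr (- a - c - 1) = y powr (2 * (- a - c - 1))"
        using A powr_powr[of y 2 "- a - c - 1"] by simp
      moreover have "y powr (2 * d - a - 2 * b - 2 * c - 5 / 2) = y powr (2 * (- a - c - 1)) * y powr (a - b) * y powr (a - 1 / 2) * y powr (2 * d - a - b)"
      proof -
        have "y powr (2 * d - a - 2 * b - 2 * c - 5 / 2) = y powr (2 * (- a - c - 1) + (a - b) + (a - 1 / 2) + (2 * d - a - b))"
          by (rule arg_cong) (simp add: field_simps)
        then show ?thesis by (simp only: powr_add)
      qed
      ultimately show ?thesis by (simp only: mult_ac)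
    qed
    finally show "norm (prefactor (of_real a) (of_real b) y) * ((y\<^sup>2 - 1) powr (- c - 1) * (1 - modulus y) powr (- d))
      \<le> C1 * C2 * C3 * C4 * ((y - Llim) powr (a - 1 / 2) * y powr (2 * d - a - 2 * b - 2 * c - 5 / 2))" .
  qed (use Cpos in auto)
qed

end

subsection \<open>Continuation in the first parameter\<close>

lemma jac_int1_holomorphic:
  assumes c: "Re c > - 1 / 2" and bc: "Re (b + c) > - 1" and u: "u > 0"
  shows "(\<lambda>a. jac_int1 a b c u) holomorphic_on {a. Re a > - 1 / 2}"
  unfolding jac_int1_def set_lebesgue_integral_def
proof (rule holomorphic_on_lebesgue_integral)
  fix z0 :: complex assume z0: "z0 \<in> {a. Re a > - 1 / 2}"
  define e where "e = (Re z0 + 1 / 2) / 2"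
  have e: "e > 0" "Re z0 - e > - 1 / 2" using z0 by (auto simp: e_def field_simps)
  let ?h = "\<lambda>a t. indicator {0<..<1} t *\<^sub>R (rpow t (a + c) * rpow (1 - t) (b + c) * rpow (u + t) (- c - 1))"
  define g where "g t = norm (?h (of_real (Re z0 - e)) t) + norm (?h (of_real (Re z0 + e)) t)" for t :: real
  have int: "integrable lborel (?h (of_real r))" if "r > - 1 / 2" for r
    using set_integrable_Beta_bounded[of "of_real r + c" "b + c" u "- c - 1"] that c bc u
    unfolding set_integrable_def by simp
  have "integrable lborel g"
    unfolding g_def by (intro Bochner_Integration.integrable_add integrable_norm int) (use e in auto)
  moreover have "norm (?h z t) \<le> g t" if z: "z \<in> ball z0 e \<inter> {a. Re a > - 1 / 2}" for z t
  proof (cases "t \<in> {0<..<1}")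
    case True
    have "\<bar>Re (z0 - z)\<bar> < e" using z abs_Re_le_cmod[of "z0 - z"] by (auto simp: dist_norm)
    then have n: "norm (rpow t z) \<le> t powr (Re z0 - e) + t powr (Re z0 + e)"
      using True by (intro norm_rpow_le) auto
    define R where "R = norm (rpow t c * rpow (1 - t) (b + c) * rpow (u + t) (- c - 1))"
    have h: "norm (?h a t) = norm (rpow t a) * R" for a
      using True by (simp add: R_def norm_mult rpow_add)
    have "g t = (t powr (Re z0 - e) + t powr (Re z0 + e)) * R"
      unfolding g_def h using True by (simp add: norm_rpow distrib_right)
    then show ?thesis unfolding h using n by (simp add: mult_right_mono R_def)
  qed (simp add: g_def)
  ultimately show "\<exists>e>0. \<exists>g. integrable lborel g \<and> (\<forall>z\<in>ball z0 e \<inter> {a. Re a > - 1 / 2}. \<forall>t\<in>space lborel. norm (?h z t) \<le> g t)"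
    using e(1) by blast
qed (auto intro!: holomorphic_intros open_halfspace_Re_gt)

context two_points begin

definition "triple_domain = {Llim<..} \<times> ({0::real<..<1} \<times> {-1::real<..<1})"

definition majorant :: "complex \<Rightarrow> complex \<Rightarrow> complex \<Rightarrow> real \<times> (real \<times> real) \<Rightarrow> complex" where
  "majorant a b c = (\<lambda>(y, (t, u)). prefactor a b y * (jacobi_weight a b c y t * kernel_majorant a b y u))"

text \<open>Integrated over (t, u) it gives back the y3-integrand up to 2 sqrt pi Gamma (a + 1), see
  \<open>triple_integrand_fibre\<close>. Unlike the y3-integrand it is elementary in a, which makes
  holomorphy and domination visible.\<close>

definition triple_integrand :: "complex \<Rightarrow> complex \<Rightarrow> complex \<Rightarrow> real \<times> (real \<times> real) \<Rightarrow> complex" where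
  "triple_integrand a b c = (\<lambda>(y, (t, u)). prefactor a b y * (jacobi_weight a b c y t * kernel_weight a b y u))"

lemma triple_domain_borel [measurable]: "triple_domain \<in> sets borel"
  unfolding triple_domain_def by (intro borel_open open_Times) auto

lemma integrands_measurable [measurable]:
  "majorant a b c \<in> borel_measurable borel" "triple_integrand a b c \<in> borel_measurable borel"
  unfolding majorant_def triple_integrand_def prefactor_def jacobi_weight_def kernel_majorant_def kernel_weight_def modulus_def A_arg_def case_prod_unfold
  by measurable

lemma gt_facts:
  assumes "y > Llim"
  shows "y > 1" "y\<^sup>2 - 1 > 0" "AA y > 1" "(AA y)\<^sup>2 - 1 > 0"
  using A_arg_gt_1[OF y1 y2 assms] by (simp_all add: power2_eq_square less_1_mult)

lemma norm_prefactor: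
  assumes "y > Llim"
  shows "norm (prefactor a b y) = norm (prefactor (of_real (Re a)) (of_real (Re b)) y)"
  unfolding prefactor_def norm_mult using gt_facts[OF assms] by (simp add: norm_rpow)

lemma jacobi_weight_integrable:
  assumes "Re a > - 1 / 2" "Re (b + c) > - 1" "Re c > - 1 / 2" "y > Llim"
  shows "set_integrable lborel {0<..<1} (jacobi_weight a b c y)"
  unfolding jacobi_weight_def by (rule set_integrable_Beta_bounded) (use assms gt_facts[OF assms(4)] in simp_all)

lemma kernel_majorant_integrable:
  assumes "Re a > - 1 / 2" "y > Llim"
  shows "set_integrable lborel {-1<..<1} (kernel_majorant a b y)"
  using gegenbauer_integrable[OF _ modulus(1)[OF assms(2)], of a 0 "- (a + b) - 1"] assms(1)
  by (simp add: kernel_majorant_def[abs_def])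

lemma kernel_weight_eq:
  assumes "y > Llim" "u \<in> {-1<..<1}"
  shows "kernel_weight a b y u = kernel_majorant a b y u * ((a + 1 / 2) * of_real (1 + modulus y * u) - (a + b) / 2 * of_real (modulus y * u))"
proof -
  have "1 + modulus y * u > 0" by (rule one_plus_bounds[OF modulus(1)[OF assms(1)] assms(2)])
  then have "rpow (1 + modulus y * u) (- (a + b)) = of_real (1 + modulus y * u) * rpow (1 + modulus y * u) (- (a + b) - 1)"
    using rpow_add[of "1 + modulus y * u" 1 "- (a + b) - 1"] by (simp add: rpow_1)
  then show ?thesis unfolding kernel_weight_def kernel_majorant_def by (simp add: algebra_simps)
qed

lemma kernel_weight_integrable:
  assumes "Re a > - 1 / 2" "y > Llim"
  shows "set_integrable lborel {-1<..<1} (kernel_weight a b y)"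
proof -
  have a: "Re a > - 1" using assms by simp
  have 1: "kernel_weight a b y u = (a + 1 / 2) * (rpow (1 - u\<^sup>2) a * (of_real (u ^ 0) * rpow (1 + modulus y * u) (- (a + b)))) +
    (- ((a + b) / 2) * of_real (modulus y)) * (rpow (1 - u\<^sup>2) a * (of_real (u ^ 1) * rpow (1 + modulus y * u) (- (a + b) - 1)))" for u
    by (simp add: kernel_weight_def algebra_simps)
  show ?thesis unfolding 1
    by (intro set_integral_add set_integrable_mult_right gegenbauer_integrable a modulus(1) assms)
qed

lemma integrand_le_majorant:
  assumes "p \<in> triple_domain"
  shows "norm (triple_integrand a b c p) \<le> (2 * norm (a + 1 / 2) + norm (a + b) / 2) * norm (majorant a b c p)"
proof -
  obtain y t u where p: "p = (y, (t, u))" "y > Llim" "t \<in> {0<..<1}" "u \<in> {-1<..<1}"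
    using assms by (auto simp: triple_domain_def)
  note bd = one_plus_bounds[OF modulus(1)[OF p(2)] p(4)]
  define k where "k = (a + 1 / 2) * of_real (1 + modulus y * u) - (a + b) / 2 * of_real (modulus y * u)"
  have "norm k \<le> norm (a + 1 / 2) * \<bar>1 + modulus y * u\<bar> + norm ((a + b) / 2) * \<bar>modulus y * u\<bar>"
    unfolding k_def using norm_triangle_ineq4[of "(a + 1 / 2) * of_real (1 + modulus y * u)" "(a + b) / 2 * of_real (modulus y * u)"]
    by (simp only: norm_mult norm_of_real)
  also have "\<dots> \<le> norm (a + 1 / 2) * 2 + norm ((a + b) / 2) * 1"
    using bd by (intro add_mono mult_left_mono) auto
  finally have k: "norm k \<le> 2 * norm (a + 1 / 2) + norm (a + b) / 2" by (simp add: norm_divide)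
  have "triple_integrand a b c p = k * majorant a b c p"
    unfolding p(1) triple_integrand_def majorant_def prod.case kernel_weight_eq[OF p(2,4)] k_def by (simp only: mult_ac)
  then show ?thesis using mult_right_mono[OF k norm_ge_zero[of "majorant a b c p"]] by (simp add: norm_mult)
qed

text \<open>
  The integrand is \<open>W\<^sup>a\<close> times a factor free of \<open>a\<close>, with \<open>W > 0\<close>. Hence integrability at two real
  parameters dominates it on a whole strip.
\<close>

lemma majorant_between:
  assumes "p \<in> triple_domain" "\<bar>Re a - r\<bar> \<le> e"
  shows "norm (majorant a b c p) \<le> norm (majorant (of_real (r - e)) b c p) + norm (majorant (of_real (r + e)) b c p)"
proof -
  obtain y t u where p: "p = (y, (t, u))" "y > Llim" "t \<in> {0<..<1}" "u \<in> {-1<..<1}"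
    using assms(1) by (auto simp: triple_domain_def)
  define s where "s = 1 + modulus y * u"
  have s: "s > 0" unfolding s_def by (rule one_plus_bounds[OF modulus(1)[OF p(2)] p(4)])
  have "\<bar>u\<bar> < 1" using p(4) by auto
  then have u2: "1 - u\<^sup>2 > 0" by (simp add: abs_square_less_1)
  define q Q v where "q = y\<^sup>2 - 1" and "Q = (AA y)\<^sup>2 - 1" and "v = 1 - u\<^sup>2"
  note g = gt_facts[OF p(2)]
  have pos: "q > 0" "Q > 0" "v > 0" "t > 0" "y > 0" "AA y > 0" using g u2 p(3) by (simp_all add: q_def Q_def v_def)
  \<comment> \<open>Collects every base whose exponent contains a, in the numerator or denominator
    according to the sign of a there.\<close>
  define W where "W = t * Q * v * y / (q * AA y * s)"
  have W: "W > 0" using pos s by (simp add: W_def)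
  have eq: "majorant a b c p = rpow W a * majorant 0 b c p" for a
    unfolding p(1) majorant_def prod.case prefactor_def jacobi_weight_def kernel_majorant_def s_def[symmetric] q_def[symmetric] Q_def[symmetric] v_def[symmetric] W_def
    using pos s
    by (simp add: rpow_def ln_mult ln_div flip: exp_add exp_diff) (simp add: algebra_simps)
  have "norm (rpow W a) \<le> W powr (r - e) + W powr (r + e)" by (rule norm_rpow_le[OF W assms(2)])
  then have "norm (rpow W a) * norm (majorant 0 b c p) \<le> (W powr (r - e) + W powr (r + e)) * norm (majorant 0 b c p)"
    by (rule mult_right_mono) simp
  then show ?thesis
    unfolding eq[of a] eq[of "of_real (r - e)"] eq[of "of_real (r + e)"] norm_mult
    using W by (simp add: norm_rpow distrib_right)
qed

text \<open>Fubini with y outermost. The t-integral is bounded by a multiple of (y^2 - 1)^(-Re c -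
  1), the u-integral by \<open>kernel_growth\<close>, and \<open>prefactor_bound\<close> reduces the
  rest to an algebraic tail. Integrability at the lower limit is exactly Re a > -1/2.\<close>

lemma majorant_integrable:
  assumes a: "Re a > - 1 / 2" and bc: "Re (b + c) > - 1" and c: "Re c > 0"
  shows "set_integrable lborel triple_domain (majorant a b c)"
proof -
  define f where "f p = indicator triple_domain p *\<^sub>R majorant a b c p" for p
  have f_fib: "f (y, q) = (if y > Llim then prefactor a b y * (indicator ({0<..<1} \<times> {-1<..<1}) q *\<^sub>R (case q of (t, u) \<Rightarrow> jacobi_weight a b c y t * kernel_majorant a b y u)) else 0)" for y q
    by (cases q) (auto simp: f_def triple_domain_def majorant_def indicator_def)
  have fm: "f \<in> borel_measurable (lborel \<Otimes>\<^sub>M lborel)"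
    unfolding f_def lborel_prod by simp
  have c': "Re c > - 1 / 2" using c by simp
  have fi: "integrable lborel (\<lambda>q. f (y, q))" for y
  proof (cases "y > Llim")
    case True
    have "set_integrable lborel ({0<..<1} \<times> {-1<..<1}) (\<lambda>(t, u). jacobi_weight a b c y t * kernel_majorant a b y u)"
      by (intro set_integrable_pair_mult jacobi_weight_integrable kernel_majorant_integrable a bc c' True)
    then show ?thesis unfolding f_fib set_integrable_def using True
      by (simp only: if_True) (rule integrable_mult_right)
  qed (simp add: f_fib)
  define r \<beta> \<gamma> where "r = Re a" and "\<beta> = Re b" and "\<gamma> = Re c"
  \<comment> \<open>The midpoint between max \<beta> 0 and 1 + \<beta> + \<gamma>:
    \<open>kernel_growth\<close> asks for d \<ge> 0 and d > \<beta>, while convergence at infinity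
    asks for d < 1 + \<beta> + \<gamma>.\<close>
  define d where "d = (max \<beta> 0 + 1 + \<beta> + \<gamma>) / 2"
  have d: "d \<ge> 0" "d > \<beta>" "d < 1 + \<beta> + \<gamma>" using bc c by (auto simp: d_def \<beta>_def \<gamma>_def max_def)
  obtain Cg where Cg: "Cg \<ge> 0" "\<And>w. w \<in> {0<..<1} \<Longrightarrow>
    (LINT u:{-1<..<1}|lborel. (1 - u\<^sup>2) powr r * (1 + w * u) powr (- (r + \<beta>) - 1)) \<le> Cg * (1 - w) powr (- d)"
  proof -
    have r1: "r > - 1" using a by (simp add: r_def)
    show ?thesis by (rule kernel_growth[OF r1 d(1,2)]) (rule that)
  qed
  obtain Cp where Cp: "Cp \<ge> 0" "\<And>y. y > Llim \<Longrightarrow>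
    norm (prefactor (of_real r) (of_real \<beta>) y) * ((y\<^sup>2 - 1) powr (- \<gamma> - 1) * (1 - modulus y) powr (- d))
      \<le> Cp * ((y - Llim) powr (r - 1 / 2) * y powr (2 * d - r - 2 * \<beta> - 2 * \<gamma> - 5 / 2))"
  proof -
    have *: "\<beta> + \<gamma> > - 1" "\<gamma> > - 1" using bc c by (simp_all add: \<beta>_def \<gamma>_def)
    show ?thesis by (rule prefactor_bound[OF * d(1)]) (rule that)
  qed
  define w0 where "w0 t = rpow t (a + c) * rpow (1 - t) (b + c)" for t
  have w0: "set_integrable lborel {0<..<1} w0"
    using Beta_integral_integrable[of "a + c + 1" "b + c + 1"] a bc c by (simp add: w0_def[abs_def])
  define Bt where "Bt = (LINT t:{0<..<1}|lborel. norm (w0 t))"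
  have Bt: "Bt \<ge> 0" unfolding Bt_def set_lebesgue_integral_def by (intro integral_nonneg_AE) auto
  have normint: "set_integrable lborel S (\<lambda>x. norm (h x))" if "set_integrable lborel S h" for S and h :: "real \<Rightarrow> complex"
    using integrable_norm[OF that[unfolded set_integrable_def]] by (simp add: set_integrable_def)
  have bound: "(\<integral>q. norm (f (y, q)) \<partial>lborel) \<le> Cp * Bt * Cg * ((y - Llim) powr (r - 1 / 2) * y powr (2 * d - r - 2 * \<beta> - 2 * \<gamma> - 5 / 2))"
    if y: "y > Llim" for y
  proof -
    note g = gt_facts[OF y]
    have ftI: "(LINT t:{0<..<1}|lborel. norm (jacobi_weight a b c y t)) \<le> (y\<^sup>2 - 1) powr (- \<gamma> - 1) * Bt"
    proof -
      have "(LINT t:{0<..<1}|lborel. norm (jacobi_weight a b c y t)) \<le> (LINT t:{0<..<1}|lborel. (y\<^sup>2 - 1) powr (- \<gamma> - 1) * norm (w0 t))"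
      proof (rule set_integral_mono[OF normint[OF jacobi_weight_integrable[OF a bc c' y]] set_integrable_mult_right[OF normint[OF w0]]])
        fix t :: real assume t: "t \<in> {0<..<1}"
        have "(y\<^sup>2 - 1 + t) powr (- \<gamma> - 1) \<le> (y\<^sup>2 - 1) powr (- \<gamma> - 1)"
          using g t c by (intro powr_mono2') (auto simp: \<gamma>_def)
        moreover have "y\<^sup>2 - 1 + t > 0" using g(2) t add_pos_pos[of "y\<^sup>2 - 1" t] by (simp only: greaterThanLessThan_iff)
        ultimately have "norm (rpow (y\<^sup>2 - 1 + t) (- c - 1)) \<le> (y\<^sup>2 - 1) powr (- \<gamma> - 1)"
          by (simp only: norm_rpow \<gamma>_def minus_complex.sel uminus_complex.sel one_complex.sel)
        then show "norm (jacobi_weight a b c y t) \<le> (y\<^sup>2 - 1) powr (- \<gamma> - 1) * norm (w0 t)"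
          unfolding jacobi_weight_def w0_def norm_mult by (simp add: mult_left_mono mult.commute)
      qed
      then show ?thesis by (simp add: Bt_def)
    qed
    have guI: "(LINT u:{-1<..<1}|lborel. norm (kernel_majorant a b y u)) \<le> Cg * (1 - modulus y) powr (- d)"
    proof -
      have "(LINT u:{-1<..<1}|lborel. norm (kernel_majorant a b y u)) = (LINT u:{-1<..<1}|lborel. (1 - u\<^sup>2) powr r * (1 + modulus y * u) powr (- (r + \<beta>) - 1))"
      proof (intro set_lebesgue_integral_cong allI impI)
        fix u :: real assume u: "u \<in> {-1<..<1}"
        have "1 + modulus y * u > 0" by (rule one_plus_bounds[OF modulus(1)[OF y] u])
        moreover have "\<bar>u\<bar> < 1" using u by auto
        then have "1 - u\<^sup>2 > 0" by (simp add: abs_square_less_1)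
        ultimately show "norm (kernel_majorant a b y u) = (1 - u\<^sup>2) powr r * (1 + modulus y * u) powr (- (r + \<beta>) - 1)"
          by (simp add: kernel_majorant_def norm_mult norm_rpow r_def \<beta>_def)
      qed auto
      then show ?thesis using Cg(2)[OF modulus(1)[OF y]] by simp
    qed
    \<comment> \<open>The real norms are cast to complex numbers so that
      \<open>set_integrable_pair_mult\<close>, stated for complex functions, can factor the
      integral.\<close>
    have "complex_of_real (\<integral>q. norm (f (y, q)) \<partial>lborel) = (\<integral>q. complex_of_real (norm (f (y, q))) \<partial>lborel)" by simp
    also have "\<dots> = (\<integral>q. of_real (norm (prefactor a b y)) * (indicator ({0<..<1} \<times> {-1<..<1}) q *\<^sub>R
        (case q of (t, u) \<Rightarrow> of_real (norm (jacobi_weight a b c y t)) * of_real (norm (kernel_majorant a b y u)))) \<partial>lborel)"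
      using y by (intro Bochner_Integration.integral_cong refl) (auto simp: f_fib norm_mult indicator_def split: prod.splits)
    also have "\<dots> = of_real (norm (prefactor a b y)) * (LINT (t, u):{0<..<1} \<times> {-1<..<1}|lborel. complex_of_real (norm (jacobi_weight a b c y t)) * of_real (norm (kernel_majorant a b y u)))"
      unfolding set_lebesgue_integral_def by (rule integral_mult_right_zero)
    also have "(LINT (t, u):{0<..<1} \<times> {-1<..<1}|lborel. complex_of_real (norm (jacobi_weight a b c y t)) * of_real (norm (kernel_majorant a b y u)))
      = (LINT t:{0<..<1}|lborel. complex_of_real (norm (jacobi_weight a b c y t))) * (LINT u:{-1<..<1}|lborel. complex_of_real (norm (kernel_majorant a b y u)))"
      by (rule set_integrable_pair_mult(2))
         (use normint[OF jacobi_weight_integrable[OF a bc c' y]] normint[OF kernel_majorant_integrable[OF a y, of b]] in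
           \<open>auto simp: set_integrable_def scaleR_conv_of_real simp flip: of_real_mult\<close>)
    also have "\<dots> = of_real ((LINT t:{0<..<1}|lborel. norm (jacobi_weight a b c y t)) * (LINT u:{-1<..<1}|lborel. norm (kernel_majorant a b y u)))"
      unfolding set_lebesgue_integral_def by (simp add: scaleR_conv_of_real flip: of_real_mult)
    also have "of_real (norm (prefactor a b y)) * \<dots> = complex_of_real (norm (prefactor a b y) * ((LINT t:{0<..<1}|lborel. norm (jacobi_weight a b c y t)) * (LINT u:{-1<..<1}|lborel. norm (kernel_majorant a b y u))))"
      by (simp only: of_real_mult)
    finally have "(\<integral>q. norm (f (y, q)) \<partial>lborel) = norm (prefactor a b y) * ((LINT t:{0<..<1}|lborel. norm (jacobi_weight a b c y t)) * (LINT u:{-1<..<1}|lborel. norm (kernel_majorant a b y u)))"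
      by (simp only: of_real_eq_iff)
    also have "\<dots> \<le> norm (prefactor a b y) * (((y\<^sup>2 - 1) powr (- \<gamma> - 1) * Bt) * (Cg * (1 - modulus y) powr (- d)))"
    proof (intro mult_left_mono mult_mono ftI guI)
      show "0 \<le> (LINT u:{-1<..<1}|lborel. norm (kernel_majorant a b y u))"
        unfolding set_lebesgue_integral_def by (intro integral_nonneg_AE) auto
    qed (use Bt in auto)
    also have "\<dots> = (Bt * Cg) * (norm (prefactor (of_real r) (of_real \<beta>) y) * ((y\<^sup>2 - 1) powr (- \<gamma> - 1) * (1 - modulus y) powr (- d)))"
      unfolding norm_prefactor[OF y, of a b] r_def \<beta>_def by (simp only: mult_ac)
    also have "\<dots> \<le> (Bt * Cg) * (Cp * ((y - Llim) powr (r - 1 / 2) * y powr (2 * d - r - 2 * \<beta> - 2 * \<gamma> - 5 / 2)))"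
      using Bt Cg(1) Cp(2)[OF y] by (intro mult_left_mono) auto
    finally show ?thesis by (simp only: mult_ac)
  qed
  have Lpos: "Llim > 0"
    using y1 y2 by (simp add: lower_limit_def add_pos_nonneg)
  have "integrable (lborel \<Otimes>\<^sub>M lborel) f"
  proof (rule lborel_pair.Fubini_integrable[OF fm])
    have "set_integrable lborel {Llim<..} (\<lambda>y. (y - Llim) powr (r - 1 / 2) * y powr (2 * d - r - 2 * \<beta> - 2 * \<gamma> - 5 / 2))"
      by (rule algebraic_tail_integrable) (use Lpos a d in \<open>auto simp: r_def\<close>)
    then have "integrable lborel (\<lambda>y. (Cp * Bt * Cg) *\<^sub>R (indicator {Llim<..} y *\<^sub>R ((y - Llim) powr (r - 1 / 2) * y powr (2 * d - r - 2 * \<beta> - 2 * \<gamma> - 5 / 2))))"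
      unfolding set_integrable_def by (rule integrable_scaleR_right)
    then show "integrable lborel (\<lambda>y. \<integral>q. norm (f (y, q)) \<partial>lborel)"
    proof (rule Bochner_Integration.integrable_bound)
      show "(\<lambda>y. \<integral>q. norm (f (y, q)) \<partial>lborel) \<in> borel_measurable lborel"
        using fm by (intro lborel.borel_measurable_lebesgue_integral) (simp add: case_prod_unfold)
      show "AE y in lborel. norm (\<integral>q. norm (f (y, q)) \<partial>lborel) \<le>
        norm ((Cp * Bt * Cg) *\<^sub>R (indicat_real {Llim<..} y *\<^sub>R ((y - Llim) powr (r - 1 / 2) * y powr (2 * d - r - 2 * \<beta> - 2 * \<gamma> - 5 / 2))))"
      proof (intro AE_I2)
        fix y
        have "(\<integral>q. norm (f (y, q)) \<partial>lborel) \<ge> 0" by (intro integral_nonneg_AE) auto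
        then show "norm (\<integral>q. norm (f (y, q)) \<partial>lborel) \<le>
          norm ((Cp * Bt * Cg) *\<^sub>R (indicat_real {Llim<..} y *\<^sub>R ((y - Llim) powr (r - 1 / 2) * y powr (2 * d - r - 2 * \<beta> - 2 * \<gamma> - 5 / 2))))"
          using order_trans[OF bound[of y] abs_ge_self] by (cases "y > Llim") (auto simp: f_fib)
      qed
    qed
  qed (use fi in auto)
  then show ?thesis unfolding set_integrable_def f_def lborel_prod .
qed


lemma triple_integrand_integrable:
  assumes "Re a > - 1 / 2" "Re (b + c) > - 1" "Re c > 0"
  shows "set_integrable lborel triple_domain (triple_integrand a b c)"
  unfolding set_integrable_def
proof (rule Bochner_Integration.integrable_bound)
  let ?M = "2 * norm (a + 1 / 2) + norm (a + b) / 2"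
  show "integrable lborel (\<lambda>p. ?M *\<^sub>R (indicator triple_domain p *\<^sub>R majorant a b c p))"
    using majorant_integrable[OF assms] unfolding set_integrable_def by (rule integrable_scaleR_right)
  show "AE p in lborel. norm (indicator triple_domain p *\<^sub>R triple_integrand a b c p) \<le> norm (?M *\<^sub>R (indicator triple_domain p *\<^sub>R majorant a b c p))"
  proof (intro AE_I2)
    fix p
    define M where "M = ?M"
    have "M \<ge> 0" by (simp add: M_def)
    then have "norm (indicator triple_domain p *\<^sub>R triple_integrand a b c p) \<le> norm (M *\<^sub>R (indicator triple_domain p *\<^sub>R majorant a b c p))"
      using integrand_le_majorant[of p a b c, folded M_def] by (cases "p \<in> triple_domain") simp_all
    then show "norm (indicator triple_domain p *\<^sub>R triple_integrand a b c p) \<le> norm (?M *\<^sub>R (indicator triple_domain p *\<^sub>R majorant a b c p))"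
      unfolding M_def .
  qed
qed simp

lemma triple_integrand_fibre:
  assumes a: "Re a > - 1 / 2" and bc: "Re (b + c) > - 1" and c: "Re c > 0"
  shows "(\<integral>q. indicator triple_domain (y, q) *\<^sub>R triple_integrand a b c (y, q) \<partial>lborel) = 2 * of_real (sqrt pi) * Gamma (a + 1) *
    (indicator {Llim<..} y *\<^sub>R (jacobi_Q c a b (of_real (2 * y\<^sup>2 - 1)) * rpow y (a + b) * kern a b (AA y)))"
proof (cases "y > Llim")
  case True
  note g = gt_facts[OF True]
  have c': "Re c > - 1 / 2" using c by simp
  have "(\<integral>q. indicator triple_domain (y, q) *\<^sub>R triple_integrand a b c (y, q) \<partial>lborel) =
    (\<integral>q. prefactor a b y * (indicator ({0<..<1} \<times> {-1<..<1}) q *\<^sub>R (case q of (t, u) \<Rightarrow> jacobi_weight a b c y t * kernel_weight a b y u)) \<partial>lborel)"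
    using True by (intro Bochner_Integration.integral_cong refl) (auto simp: triple_domain_def triple_integrand_def indicator_def split: prod.splits)
  also have "\<dots> = prefactor a b y * (LINT (t, u):{0<..<1} \<times> {-1<..<1}|lborel. jacobi_weight a b c y t * kernel_weight a b y u)"
    unfolding set_lebesgue_integral_def by (rule integral_mult_right_zero)
  also have "(LINT (t, u):{0<..<1} \<times> {-1<..<1}|lborel. jacobi_weight a b c y t * kernel_weight a b y u) =
    (LINT t:{0<..<1}|lborel. jacobi_weight a b c y t) * (LINT u:{-1<..<1}|lborel. kernel_weight a b y u)"
    by (intro set_integrable_pair_mult jacobi_weight_integrable kernel_weight_integrable a bc c' True)
  also have "(LINT t:{0<..<1}|lborel. jacobi_weight a b c y t) = jac_int1 a b c (y\<^sup>2 - 1)"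
    by (simp add: jac_int1_def jacobi_weight_def)
  also have "(LINT u:{-1<..<1}|lborel. kernel_weight a b y u) = of_real (sqrt pi) * Gamma (a + 1) *
      regF_series ((a + b) / 2) ((a + b + 1) / 2) (a + 1 / 2) (of_real ((modulus y)\<^sup>2))"
    unfolding kernel_weight_def by (rule kernel_rep_regularized[OF a]) (use modulus(1)[OF True] in auto)
  also have "(modulus y)\<^sup>2 = 1 - 1 / (AA y)\<^sup>2" by (rule modulus(2)[OF True])
  finally have 1: "(\<integral>q. indicator triple_domain (y, q) *\<^sub>R triple_integrand a b c (y, q) \<partial>lborel) = prefactor a b y * (jac_int1 a b c (y\<^sup>2 - 1) *
    (of_real (sqrt pi) * Gamma (a + 1) * regF_series ((a + b) / 2) ((a + b + 1) / 2) (a + 1 / 2) (of_real (1 - 1 / (AA y)\<^sup>2))))" .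
  have "Re (a + c) > - 1" using a c by simp
  note q = jacobi_Q_eq_jac_int1(1)[OF this bc g(1)]
  have e: "rpow y (- 2 * b) * rpow y (a + b) = rpow y (a - b)"
    unfolding rpow_add[symmetric] by (rule arg_cong) simp
  have "2 * (jacobi_Q c a b (of_real (2 * y\<^sup>2 - 1)) * rpow y (a + b)) = rpow (y\<^sup>2 - 1) (- a) * (rpow y (- 2 * b) * rpow y (a + b)) * jac_int1 a b c (y\<^sup>2 - 1)"
    unfolding q by simp
  then have "2 * (jacobi_Q c a b (of_real (2 * y\<^sup>2 - 1)) * rpow y (a + b)) * kern a b (AA y) =
     prefactor a b y * (jac_int1 a b c (y\<^sup>2 - 1) * regF_series ((a + b) / 2) ((a + b + 1) / 2) (a + 1 / 2) (of_real (1 - 1 / (AA y)\<^sup>2)))"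
    unfolding e kern_def prefactor_def by (simp only: mult_ac)
  then show ?thesis using True unfolding 1 by (simp only: mult_ac) simp
next
  case False
  have "(\<integral>q. indicator triple_domain (y, q) *\<^sub>R triple_integrand a b c (y, q) \<partial>lborel) = (\<integral>q. 0 \<partial>(lborel :: (real \<times> real) measure))"
    using False by (intro Bochner_Integration.integral_cong refl) (simp add: triple_domain_def)
  then show ?thesis using False by simp
qed

text \<open>Fubini: the fibre integrals of an integrable function are integrable, and the constant
  in \<open>triple_integrand_fibre\<close> is nonzero. This is where the y3-integral is seen to
  converge absolutely on all of Re a > -1/2.\<close>

lemma integrand_integrable:
  assumes a: "Re a > - 1 / 2" and bc: "Re (b + c) > - 1" and c: "Re c > 0"
  shows "set_integrable lborel {Llim<..} (\<lambda>y. jacobi_Q c a b (of_real (2 * y\<^sup>2 - 1)) * rpow y (a + b) * kern a b (AA y))"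
    and "(LINT p:triple_domain|lborel. triple_integrand a b c p) = 2 * of_real (sqrt pi) * Gamma (a + 1) *
       (LINT y:{Llim<..}|lborel. jacobi_Q c a b (of_real (2 * y\<^sup>2 - 1)) * rpow y (a + b) * kern a b (AA y))"
proof -
  let ?C = "2 * of_real (sqrt pi) * Gamma (a + 1)"
  have nz: "?C \<noteq> 0" using Re_pos_not_nonpos_Ints[of "a + 1"] a by (simp add: Gamma_eq_zero_iff)
  have T: "integrable (lborel \<Otimes>\<^sub>M lborel) (\<lambda>p. indicator triple_domain p *\<^sub>R triple_integrand a b c p)"
    using triple_integrand_integrable[OF assms] unfolding set_integrable_def lborel_prod .
  show "set_integrable lborel {Llim<..} (\<lambda>y. jacobi_Q c a b (of_real (2 * y\<^sup>2 - 1)) * rpow y (a + b) * kern a b (AA y))"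
    using integrable_mult_right[OF lborel_pair.integrable_fst'[OF T], of "1 / ?C"] nz
    unfolding triple_integrand_fibre[OF assms] set_integrable_def by (simp add: mult.assoc)
  show "(LINT p:triple_domain|lborel. triple_integrand a b c p) = ?C *
       (LINT y:{Llim<..}|lborel. jacobi_Q c a b (of_real (2 * y\<^sup>2 - 1)) * rpow y (a + b) * kern a b (AA y))"
    using lborel_pair.integral_fst'[OF T] unfolding triple_integrand_fibre[OF assms] set_lebesgue_integral_def lborel_prod
    by (simp only: integral_mult_right_zero)
qed

lemma triple_integral_holomorphic:
  assumes bc: "Re (b + c) > - 1" and c: "Re c > 0"
  shows "(\<lambda>a. LINT p:triple_domain|lborel. triple_integrand a b c p) holomorphic_on {a. Re a > - 1 / 2}"
  unfolding set_lebesgue_integral_def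
proof (rule holomorphic_on_lebesgue_integral)
  fix p :: "real \<times> (real \<times> real)"
  show "(\<lambda>a. indicator triple_domain p *\<^sub>R triple_integrand a b c p) holomorphic_on {a. Re a > - 1 / 2}"
    unfolding triple_integrand_def prefactor_def jacobi_weight_def kernel_weight_def case_prod_unfold scaleR_conv_of_real
    by (intro holomorphic_intros) auto
next
  fix z0 :: complex assume z0: "z0 \<in> {a. Re a > - 1 / 2}"
  \<comment> \<open>The first bound keeps norm z \<le> norm z0 + 1, so that M below dominates the
    factor from \<open>integrand_le_majorant\<close>; the second keeps both real exponents above
    -1/2.\<close>
  define e where "e = min 1 ((Re z0 + 1 / 2) / 2)"
  have e: "e > 0" "Re z0 - e > - 1 / 2" "e \<le> 1" using z0 by (auto simp: e_def min_def field_simps)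
  define M where "M = 4 * (norm z0 + norm b + 3)"
  have M: "M \<ge> 0" by (simp add: M_def)
  define S where "S r p = norm (indicator triple_domain p *\<^sub>R majorant (of_real r) b c p)" for r p
  have S: "integrable lborel (S r)" if "r > - 1 / 2" for r
    unfolding S_def using majorant_integrable[of "of_real r" b c] that bc c
    by (intro integrable_norm) (simp add: set_integrable_def)
  have "integrable lborel (\<lambda>p. M * (S (Re z0 - e) p + S (Re z0 + e) p))"
    by (intro integrable_mult_right Bochner_Integration.integrable_add S) (use e in auto)
  moreover have "norm (indicator triple_domain p *\<^sub>R triple_integrand z b c p) \<le> M * (S (Re z0 - e) p + S (Re z0 + e) p)"
    if z: "z \<in> ball z0 e \<inter> {a. Re a > - 1 / 2}" for z p
  proof (cases "p \<in> triple_domain")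
    case True
    have d: "norm (z0 - z) < e" using z by (simp add: dist_norm)
    then have r: "\<bar>Re z - Re z0\<bar> \<le> e" using abs_Re_le_cmod[of "z0 - z"] by simp
    have zn: "norm z \<le> norm z0 + 1" using d e norm_triangle_ineq4[of z0 "z0 - z"] by simp
    have "2 * norm (z + 1 / 2) + norm (z + b) / 2 \<le> 2 * (norm z + 1 / 2) + (norm z + norm b) / 2"
    proof -
      have "norm (z + 1 / 2) \<le> norm z + 1 / 2" using norm_triangle_ineq[of z "1 / 2"] by simp
      then show ?thesis by (intro add_mono mult_left_mono divide_right_mono norm_triangle_ineq) auto
    qed
    also have "\<dots> \<le> M"
    proof -
      have "2 * (x + 1 / 2) + (x + y) / 2 \<le> 4 * (w + y + 3)" if "x \<le> w + 1" "0 \<le> y" "0 \<le> w" for x y w :: real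
        using that by (simp add: field_simps)
      from this[OF zn norm_ge_zero[of b] norm_ge_zero[of z0]] show ?thesis unfolding M_def .
    qed
    finally have k: "2 * norm (z + 1 / 2) + norm (z + b) / 2 \<le> M" .
    have "norm (triple_integrand z b c p) \<le> (2 * norm (z + 1 / 2) + norm (z + b) / 2) * norm (majorant z b c p)"
      by (rule integrand_le_majorant[OF True])
    also have "\<dots> \<le> M * (norm (majorant (of_real (Re z0 - e)) b c p) + norm (majorant (of_real (Re z0 + e)) b c p))"
      by (intro mult_mono k majorant_between[OF True r] M) simp
    finally show ?thesis using True by (simp add: S_def)
  qed (simp add: S_def)
  ultimately show "\<exists>e>0. \<exists>g. integrable lborel g \<and> (\<forall>z\<in>ball z0 e \<inter> {a. Re a > - 1 / 2}. \<forall>p\<in>space lborel.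
      norm (indicator triple_domain p *\<^sub>R triple_integrand z b c p) \<le> g p)"
    using e(1) by blast
qed (auto simp: open_halfspace_Re_gt)

text \<open>Continuation from real a in (0,1), where \<open>product_formula_pos\<close> holds. Both
  sides are multiplied by 2 Gamma (a + 1), so that the left-hand side contains the triple integral,
  whose holomorphy is known; the factor is nonzero on the half-plane and is cancelled at the
  end.\<close>

lemma product_formula:
  assumes a: "Re a > - 1 / 2" and bc: "Re (b + c) > - 1" and c: "Re c > 0"
  defines "q \<equiv> \<lambda>y::real. jacobi_Q c a b (of_real (2 * y\<^sup>2 - 1))"
  shows "of_real (sqrt pi) * Gamma (a + c + 1) *
      (LINT y:{Llim<..}|lborel. q y * rpow y (a + b) * kern a b (AA y)) =
    Gamma (c + 1) * rpow (y1 * y2) (b - a + 1) * rpow ((y1\<^sup>2 - 1) * (y2\<^sup>2 - 1)) a * (q y1 * q y2)"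
proof -
  define H where "H = {a. Re a > - 1 / 2}"
  have H: "open H" "connected H"
    unfolding H_def by (auto simp: open_halfspace_Re_gt convex_halfspace_Re_gt convex_connected)
  \<comment> \<open>The Jacobi function in the \<open>jac_int1\<close> form, which is holomorphic in
    a on the whole half-plane.\<close>
  define Q where "Q a y = 1 / 2 * rpow (y\<^sup>2 - 1) (- a) * rpow y (- 2 * b) * jac_int1 a b c (y\<^sup>2 - 1)" for a :: complex and y :: real
  have Qq: "jacobi_Q c a b (of_real (2 * y\<^sup>2 - 1)) = Q a y" if "a \<in> H" "y > 1" for a y
    unfolding Q_def by (rule jacobi_Q_eq_jac_int1(1)) (use that bc c in \<open>auto simp: H_def\<close>)
  have c': "Re c > - 1 / 2" "Re c > - 1" using c by simp_all
  have u: "y1\<^sup>2 - 1 > 0" "y2\<^sup>2 - 1 > 0" using y1 y2 by (simp_all add: power2_eq_square less_1_mult)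
  have Qhol: "(\<lambda>a. Q a y) holomorphic_on H" if "y\<^sup>2 - 1 > 0" for y
    unfolding Q_def using jac_int1_holomorphic[OF c'(1) bc that] by (auto intro!: holomorphic_intros simp: H_def)
  let ?l = "\<lambda>a. Gamma (a + c + 1) * (LINT p:triple_domain|lborel. triple_integrand a b c p)"
  let ?r = "\<lambda>a. 2 * Gamma (a + 1) * (Gamma (c + 1) * rpow (y1 * y2) (b - a + 1) * rpow ((y1\<^sup>2 - 1) * (y2\<^sup>2 - 1)) a * (Q a y1 * Q a y2))"
  have np: "a + c + 1 \<notin> \<int>\<^sub>\<le>\<^sub>0" "a + 1 \<notin> \<int>\<^sub>\<le>\<^sub>0" if "a \<in> H" for a
    using that c by (auto simp: H_def intro!: Re_pos_not_nonpos_Ints)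
  have lhol: "?l holomorphic_on H"
    using triple_integral_holomorphic[OF bc c] np by (auto intro!: holomorphic_intros simp: H_def)
  have rhol: "?r holomorphic_on H"
    using Qhol u np by (auto intro!: holomorphic_intros)
  have "?l a = ?r a"
  proof (rule analytic_eq_from_real[OF lhol rhol H, of 0 1])
    fix x :: real assume x: "x \<in> {0<..<1}"
    have xH: "of_real x \<in> H" using x by (simp add: H_def)
    have xr: "Re (of_real x) > 0" "Re (complex_of_real x) > - 1 / 2" using x by simp_all
    note P = product_formula_pos[OF y1 y2 xr(1) bc c'(2)]
    have "?l (of_real x) = 2 * Gamma (of_real x + 1) * (of_real (sqrt pi) * Gamma (of_real x + c + 1) *
      (LINT y:{Llim<..}|lborel. jacobi_Q c (of_real x) b (of_real (2 * y\<^sup>2 - 1)) * rpow y (of_real x + b) * kern (of_real x) b (AA y)))"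
      unfolding integrand_integrable(2)[OF xr(2) bc c] by (simp only: mult_ac)
    then show "?l (of_real x) = ?r (of_real x)"
      unfolding P Qq[OF xH y1] Qq[OF xH y2] .
  next
    show "of_real ` {0<..<1} \<subseteq> H" by (auto simp: H_def)
    show "a \<in> H" using a by (simp add: H_def)
  qed simp
  then have 1: "?l a = 2 * Gamma (a + 1) * (Gamma (c + 1) * rpow (y1 * y2) (b - a + 1) *
      rpow ((y1\<^sup>2 - 1) * (y2\<^sup>2 - 1)) a * (Q a y1 * Q a y2))" .
  have 2: "?l a = 2 * Gamma (a + 1) * (of_real (sqrt pi) * Gamma (a + c + 1) *
      (LINT y:{Llim<..}|lborel. q y * rpow y (a + b) * kern a b (AA y)))"
    unfolding integrand_integrable(2)[OF a bc c] q_def by (simp only: mult_ac)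
  have "a \<in> H" using a by (simp add: H_def)
  then have nz: "2 * Gamma (a + 1) \<noteq> 0" using np(2)[of a] by (simp add: Gamma_eq_zero_iff)
  have 3: "Q a y1 = q y1" "Q a y2 = q y2"
    unfolding q_def using Qq[OF \<open>a \<in> H\<close>] y1 y2 by simp_all
  show ?thesis using 1 unfolding 2 3 mult_left_cancel[OF nz] .
qed

end

subsection \<open>Continuation in the arguments\<close>

lemma rpow_sqrt: "x > 0 \<Longrightarrow> rpow (sqrt x) a = rpow x (a / 2)"
  by (simp add: rpow_def ln_sqrt)

lemma cut_plane: "open cut_plane" "connected cut_plane" "y > 1 \<Longrightarrow> of_real y \<in> cut_plane"
proof -
  show "open cut_plane" unfolding cut_plane_def by (intro open_Compl closed_slot_left)
  show "connected cut_plane" unfolding cut_plane_def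
    by (intro starlike_imp_connected starlike_slotted_complex_plane_left)
  show "y > 1 \<Longrightarrow> of_real y \<in> cut_plane" unfolding cut_plane_def by auto
qed

lemma cut_plane_shift:
  assumes "z \<in> cut_plane" "s \<ge> - 1"
  shows "z + of_real s \<notin> \<real>\<^sub>\<le>\<^sub>0"
proof
  assume "z + of_real s \<in> \<real>\<^sub>\<le>\<^sub>0"
  then obtain r where r: "r \<le> 0" "z + of_real s = of_real r" by (auto elim: nonpos_Reals_cases)
  have "z = of_real (r - s)" using r(2) by (simp add: algebra_simps)
  moreover have "r - s \<in> {..1}" using r(1) assms(2) by simp
  ultimately have "z \<in> of_real ` {..1}" by (rule image_eqI)
  then show False using assms(1) by (simp add: cut_plane_def)
qed

lemma cut_plane_nonpos:
  assumes "z \<in> cut_plane"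
  shows "z \<notin> \<real>\<^sub>\<le>\<^sub>0" "z - 1 \<notin> \<real>\<^sub>\<le>\<^sub>0" "z + 1 \<notin> \<real>\<^sub>\<le>\<^sub>0" "z \<noteq> 0" "z - 1 \<noteq> 0" "z + 1 \<noteq> 0"
  using cut_plane_shift[OF assms, of 0] cut_plane_shift[OF assms, of "- 1"] cut_plane_shift[OF assms, of 1]
  by (auto simp: diff_conv_add_uminus[symmetric])

lemma cut_plane_slit:
  assumes "z \<in> cut_plane"
  shows "- 1 / (z\<^sup>2 - 1) \<in> slit" "z\<^sup>2 - 1 \<noteq> 0"
proof -
  have "z\<^sup>2 - 1 = (z - 1) * (z + 1)" by (simp add: power2_eq_square algebra_simps)
  then show nz: "z\<^sup>2 - 1 \<noteq> 0" using cut_plane_nonpos[OF assms] by simp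
  show "- 1 / (z\<^sup>2 - 1) \<in> slit"
  proof (rule ccontr)
    assume "- 1 / (z\<^sup>2 - 1) \<notin> slit"
    then obtain r where r: "r \<ge> 1" "- 1 / (z\<^sup>2 - 1) = of_real r" by (auto simp: slit_def)
    have "complex_of_real r \<noteq> 0" using r(1) by simp
    then have "z\<^sup>2 = 1 - 1 / of_real r" using r(2) nz by (simp add: field_simps)
    also have "\<dots> = of_real ((sqrt (1 - 1 / r))\<^sup>2)" using r(1) by simp
    also have "\<dots> = (of_real (sqrt (1 - 1 / r)))\<^sup>2" by (rule of_real_power)
    finally have "z = of_real (sqrt (1 - 1 / r)) \<or> z = of_real (- sqrt (1 - 1 / r))"
      by (simp add: power2_eq_iff)
    moreover have "s \<le> 1 \<and> - s \<le> 1" if "0 \<le> s" "s \<le> 1" for s :: real using that by simp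
    from this[of "sqrt (1 - 1 / r)"] have "sqrt (1 - 1 / r) \<le> 1" "- sqrt (1 - 1 / r) \<le> 1" using r(1) by simp_all
    ultimately have "z \<in> of_real ` {..1}" by blast
    then show False using assms by (simp add: cut_plane_def)
  qed
qed

lemma holomorphic2_on_prod:
  assumes f: "f holomorphic_on S" "open S" and g: "g holomorphic_on T" "open T"
  shows "holomorphic2_on (\<lambda>(x, y). f x * g y) (S \<times> T)"
  unfolding holomorphic2_on_def
proof
  fix p :: "complex \<times> complex" assume "p \<in> S \<times> T"
  then obtain x y where p: "p = (x, y)" "x \<in> S" "y \<in> T" by auto
  have df: "(f has_derivative (*) (deriv f x)) (at (fst p))"
    using holomorphic_derivI[OF f p(2)] by (simp add: p has_field_derivative_def)
  have dg: "(g has_derivative (*) (deriv g y)) (at (snd p))"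
    using holomorphic_derivI[OF g p(3)] by (simp add: p has_field_derivative_def)
  have 1: "((\<lambda>p. f (fst p)) has_derivative (\<lambda>h. deriv f x * fst h)) (at p)"
    by (rule has_derivative_compose[where f = fst and f' = fst and g = f and g' = "(*) (deriv f x)"])
       (auto intro!: derivative_eq_intros df)
  have 2: "((\<lambda>p. g (snd p)) has_derivative (\<lambda>h. deriv g y * snd h)) (at p)"
    by (rule has_derivative_compose[where f = snd and f' = snd and g = g and g' = "(*) (deriv g y)"])
       (auto intro!: derivative_eq_intros dg)
  have "((\<lambda>p. f (fst p) * g (snd p)) has_derivative (\<lambda>h. f (fst p) * (deriv g y * snd h) + deriv f x * fst h * g (snd p))) (at p)"
    by (rule has_derivative_mult[OF 1 2])
  moreover have "(\<lambda>p. f (fst p) * g (snd p)) = (\<lambda>(x, y). f x * g y)" by (simp add: case_prod_unfold)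
  moreover have "(\<lambda>h. f (fst p) * (deriv g y * snd h) + deriv f x * fst h * g (snd p)) =
     (\<lambda>(h, k). (deriv f x * g y) * h + (f x * deriv g y) * k)"
    by (auto simp: p fun_eq_iff mult_ac)
  ultimately show "\<exists>a b. ((\<lambda>(x, y). f x * g y) has_derivative (\<lambda>(h, k). a * h + b * k)) (at p)"
    by (intro exI[of _ "deriv f x * g y"] exI[of _ "f x * deriv g y"]) simp
qed

lemma holomorphic2_on_slices:
  assumes "holomorphic2_on g (S \<times> T)" "open S" "open T"
  shows "y \<in> T \<Longrightarrow> (\<lambda>x. g (x, y)) holomorphic_on S" and "x \<in> S \<Longrightarrow> (\<lambda>y. g (x, y)) holomorphic_on T"
proof -
  have D: "\<exists>a b. (g has_derivative (\<lambda>(h, k). a * h + b * k)) (at (x, y))" if "x \<in> S" "y \<in> T" for x y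
    using assms(1) that by (auto simp: holomorphic2_on_def)
  show "(\<lambda>x. g (x, y)) holomorphic_on S" if y: "y \<in> T"
    unfolding holomorphic_on_open[OF assms(2)]
  proof
    fix x assume "x \<in> S"
    then obtain a b where g: "(g has_derivative (\<lambda>(h, k). a * h + b * k)) (at (x, y))" using D y by blast
    have "((\<lambda>x. (x, y)) has_derivative (\<lambda>h. (h, 0))) (at x)" by (auto intro!: derivative_eq_intros)
    from has_derivative_compose[OF this g]
    have "((\<lambda>x. g (x, y)) has_field_derivative a) (at x)" by (simp add: has_field_derivative_def)
    then show "\<exists>f'. ((\<lambda>x. g (x, y)) has_field_derivative f') (at x)" by blast
  qed
  show "(\<lambda>y. g (x, y)) holomorphic_on T" if x: "x \<in> S"
    unfolding holomorphic_on_open[OF assms(3)]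
  proof
    fix y assume "y \<in> T"
    then obtain a b where g: "(g has_derivative (\<lambda>(h, k). a * h + b * k)) (at (x, y))" using D x by blast
    have "((\<lambda>y. (x, y)) has_derivative (\<lambda>h. (0, h))) (at y)" by (auto intro!: derivative_eq_intros)
    from has_derivative_compose[OF this g]
    have "((\<lambda>y. g (x, y)) has_field_derivative b) (at y)" by (simp add: has_field_derivative_def)
    then show "\<exists>f'. ((\<lambda>y. g (x, y)) has_field_derivative f') (at y)" by blast
  qed
qed

text \<open>The identity theorem in one variable, used twice: first in x with y real, then in y with
  x already complex.\<close>

lemma cut_plane_identity:
  assumes "holomorphic2_on F (cut_plane \<times> cut_plane)" "holomorphic2_on G (cut_plane \<times> cut_plane)"
    and eq: "\<And>x y. x > 1 \<Longrightarrow> y > 1 \<Longrightarrow> F (of_real x, of_real y) = G (of_real x, of_real y)"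
    and z: "z1 \<in> cut_plane" "z2 \<in> cut_plane"
  shows "F (z1, z2) = G (z1, z2)"
proof -
  note F = holomorphic2_on_slices[OF assms(1) cut_plane(1) cut_plane(1)]
  note G = holomorphic2_on_slices[OF assms(2) cut_plane(1) cut_plane(1)]
  have im: "of_real ` {1<..<2::real} \<subseteq> cut_plane" using cut_plane(3) by auto
  have 1: "F (z1, of_real y) = G (z1, of_real y)" if "y > 1" for y
    by (rule analytic_eq_from_real[OF F(1) G(1) cut_plane(1,2) _ im _ z(1)]) (use eq that cut_plane(3) in auto)
  show ?thesis
    by (rule analytic_eq_from_real[OF F(2)[OF z(1)] G(2)[OF z(1)] cut_plane(1,2) _ im _ z(2)]) (use 1 in auto)
qed

text \<open>The powers of 2 y^2 - 2 and 2 y^2 are split into powers of y - 1, y + 1 and y. Each of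
  these bases avoids the negative axis on \<open>cut_plane\<close>, whereas y^2 and y^2 - 1 are
  negative for imaginary y.\<close>

lemma jacobi_Q_continuation:
  assumes ac: "Re (a + c) > - 1" and bc: "Re (b + c) > - 1"
  obtains q' where "continues1 (\<lambda>y. jacobi_Q c a b (of_real (2 * y\<^sup>2 - 1))) q'"
proof -
  define F where "F = regF (c + 1) (a + c + 1) (a + b + 2 * c + 2)"
  have F: "F holomorphic_on slit" unfolding F_def by (rule regF_holomorphic) (use assms in auto)
  define q' where "q' y = 1 / 2 * Gamma (a + c + 1) * Gamma (b + c + 1) / ((y - 1) powr (a + c + 1) * (y + 1) powr (a + c + 1) * y powr (2 * b))
     * F (- 1 / (y\<^sup>2 - 1))" for y
  have "(\<lambda>y. F (- 1 / (y\<^sup>2 - 1))) holomorphic_on cut_plane"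
    using cut_plane_slit by (intro holomorphic_on_compose_gen[OF _ F, unfolded comp_def] holomorphic_intros) auto
  then have "q' holomorphic_on cut_plane"
    unfolding q'_def using cut_plane_nonpos by (auto intro!: holomorphic_intros)
  moreover have "q' (of_real y) = jacobi_Q c a b (of_real (2 * y\<^sup>2 - 1))" if y: "y > 1" for y
  proof -
    have u: "y - 1 > 0" "y + 1 > 0" "y > 0" "y\<^sup>2 - 1 = (y - 1) * (y + 1)"
      using y by (auto simp: power2_eq_square algebra_simps)
    have "complex_of_real y - 1 = of_real (y - 1)" "complex_of_real y + 1 = of_real (y + 1)"
      "(complex_of_real y)\<^sup>2 - 1 = of_real (y\<^sup>2 - 1)" by simp_all
    then show ?thesis
      unfolding q'_def jacobi_Q_eq_regF[OF y] F_def
      using u(1-3) by (simp only: powr_eq_rpow u(4) rpow_mult)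
  qed
  ultimately show ?thesis using that[of q'] by (simp add: continues1_def)
qed

lemma power_factor_eq:
  assumes "y1 > 1" "y2 > 1"
  shows "power_factor \<alpha> \<beta> y1 y2 = rpow (y1 * y2) (\<alpha> - \<beta> - 1) / rpow ((y1\<^sup>2 - 1) * (y2\<^sup>2 - 1)) \<alpha>"
proof -
  have "y1\<^sup>2 - 1 > 0" "y2\<^sup>2 - 1 > 0" "y1 * y2 > 0" using assms by (simp_all add: power2_eq_square less_1_mult)
  then show ?thesis unfolding power_factor_def by (simp only: powr_eq_rpow rpow_mult)
qed

lemma power_factor_continuation:
  obtains p where "p holomorphic_on cut_plane" "\<And>y. y \<in> cut_plane \<Longrightarrow> p y \<noteq> 0"
    "\<And>y1 y2. y1 > 1 \<Longrightarrow> y2 > 1 \<Longrightarrow> power_factor \<alpha> \<beta> y1 y2 = p (of_real y1) * p (of_real y2)"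
proof -
  define p where "p y = y powr (\<alpha> - \<beta> - 1) / ((y - 1) powr \<alpha> * (y + 1) powr \<alpha>)" for y :: complex
  have "p holomorphic_on cut_plane"
    unfolding p_def using cut_plane_nonpos by (auto intro!: holomorphic_intros)
  moreover have "p y \<noteq> 0" if "y \<in> cut_plane" for y
    using cut_plane_nonpos[OF that] by (auto simp: p_def)
  moreover have "p (of_real y) = rpow y (\<alpha> - \<beta> - 1) / rpow (y\<^sup>2 - 1) \<alpha>" if y: "y > 1" for y
  proof -
    have u: "y - 1 > 0" "y + 1 > 0" "y > 0" "y\<^sup>2 - 1 = (y - 1) * (y + 1)"
      using y by (auto simp: power2_eq_square algebra_simps)
    have "complex_of_real y - 1 = of_real (y - 1)" "complex_of_real y + 1 = of_real (y + 1)" by simp_all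
    then show ?thesis unfolding p_def using u(1-3) by (simp only: powr_eq_rpow u(4) rpow_mult)
  qed
  then have "power_factor \<alpha> \<beta> y1 y2 = p (of_real y1) * p (of_real y2)" if "y1 > 1" "y2 > 1" for y1 y2
  proof -
    have "y1\<^sup>2 - 1 > 0" "y2\<^sup>2 - 1 > 0" "y1 > 0" "y2 > 0" using that by (simp_all add: power2_eq_square less_1_mult)
    then show ?thesis using \<open>\<And>y. y > 1 \<Longrightarrow> p (of_real y) = _\<close> that by (simp add: power_factor_eq rpow_mult)
  qed
  ultimately show ?thesis using that by blast
qed

section \<open>Reduction of the Gegenbauer and Legendre factors to one kernel\<close>

lemma regF_kernel_arg:
  assumes A: "A > 1"
  shows "regF a b c (1 / (of_real (A / sqrt (A\<^sup>2 - 1)))\<^sup>2) = regF_series a b c (of_real (1 - 1 / A\<^sup>2))"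
proof -
  have A2: "A\<^sup>2 > 1" using A by (simp add: power2_eq_square less_1_mult)
  have "1 / (A / sqrt (A\<^sup>2 - 1))\<^sup>2 = 1 - 1 / A\<^sup>2" using A A2 by (simp add: power_divide field_simps)
  then have e: "1 / (complex_of_real (A / sqrt (A\<^sup>2 - 1)))\<^sup>2 = of_real (1 - 1 / A\<^sup>2)"
    by (metis of_real_1 of_real_divide of_real_power)
  have "1 / A\<^sup>2 < 1" "1 / A\<^sup>2 > 0" using A A2 by (simp_all add: divide_less_eq)
  then have "\<bar>1 - 1 / A\<^sup>2\<bar> < 1" by simp
  then have "norm (complex_of_real (1 - 1 / A\<^sup>2)) < 1" by (simp only: norm_of_real)
  then show ?thesis unfolding e regF_def by simp
qed

text \<open>At z = A / sqrt (A^2 - 1) the power of z splits into powers of A and A^2 - 1; the latter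
  joins the explicit factor to make the exponent \<alpha> - 1/2 of \<open>kern\<close>.\<close>

lemma gegenbauer_kernel:
  assumes A: "A > 1"
  shows "of_real (A\<^sup>2 - 1) powr ((\<alpha> - \<beta> - 1) / 2) * gegenbauer_D (\<alpha> - \<beta> - 1) (\<beta> + 1 / 2) (of_real (A / sqrt (A\<^sup>2 - 1)))
    = exp (\<i> * of_real pi * (\<beta> + 1 / 2)) * Gamma (\<alpha> + \<beta>) / (Gamma (\<beta> + 1 / 2) * 2 powr (\<alpha> + \<beta>)) * kern \<alpha> \<beta> A"
proof -
  define E where "E = A\<^sup>2 - 1"
  have E: "E > 0" using A by (simp add: E_def power2_eq_square less_1_mult)
  have par: "\<alpha> - \<beta> - 1 + 2 * (\<beta> + 1 / 2) = \<alpha> + \<beta>" "(\<alpha> - \<beta> - 1) / 2 + (\<beta> + 1 / 2) = (\<alpha> + \<beta>) / 2"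
    "(\<alpha> + \<beta>) / 2 + 1 / 2 = (\<alpha> + \<beta> + 1) / 2" "\<alpha> - \<beta> - 1 + (\<beta> + 1 / 2) + 1 = \<alpha> + 1 / 2"
    by (simp_all add: field_simps)
  have sq: "sqrt E > 0" using E by simp
  have z: "(2 * complex_of_real (A / sqrt E)) powr (\<alpha> + \<beta>) = 2 powr (\<alpha> + \<beta>) * (rpow A (\<alpha> + \<beta>) / rpow E ((\<alpha> + \<beta>) / 2))"
  proof -
    have "2 * complex_of_real (A / sqrt E) = of_real (2 * (A / sqrt E))" by simp
    moreover have "rpow (sqrt E) (\<alpha> + \<beta>) = rpow E ((\<alpha> + \<beta>) / 2)"
      using E by (rule rpow_sqrt)
    moreover have "2 powr (\<alpha> + \<beta>) = rpow 2 (\<alpha> + \<beta>)" using powr_eq_rpow[of 2 "\<alpha> + \<beta>"] by simp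
    moreover have "2 * (A / sqrt E) > 0" "A / sqrt E > 0" using A sq by simp_all
    ultimately show ?thesis using A sq by (simp only: powr_eq_rpow) (simp add: rpow_mult rpow_divide)
  qed
  have k: "rpow E (\<alpha> - 1 / 2) = rpow E ((\<alpha> - \<beta> - 1) / 2) * rpow E ((\<alpha> + \<beta>) / 2)"
    unfolding rpow_add[symmetric] by (rule arg_cong) (simp add: field_simps)
  show ?thesis
    unfolding gegenbauer_D_def par regF_kernel_arg[OF A] kern_def unfolding E_def[symmetric] z k powr_eq_rpow[OF E] rpow_minus
    by (simp add: field_simps)
qed

text \<open>Here z^2 - 1 = 1 / (A^2 - 1), so the factor with exponent \<beta> / 2 is again a power
  of A^2 - 1. That the same \<open>kern\<close> results is the equivalence of the two integral
  forms.\<close>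

lemma legendre_kernel:
  assumes A: "A > 1"
  shows "of_real (A\<^sup>2 - 1) powr ((\<alpha> - 1) / 2) * legendre_Q (\<alpha> - 1) \<beta> (of_real (A / sqrt (A\<^sup>2 - 1)))
    = of_real (sqrt pi) * exp (\<i> * of_real pi * \<beta>) * Gamma (\<alpha> + \<beta>) / 2 powr \<alpha> * kern \<alpha> \<beta> A"
proof -
  define E where "E = A\<^sup>2 - 1"
  have E: "E > 0" "A\<^sup>2 = E + 1" using A by (simp_all add: E_def power2_eq_square less_1_mult)
  have par: "\<alpha> - 1 + \<beta> + 1 = \<alpha> + \<beta>" "\<alpha> - 1 + 1 = \<alpha>" "\<alpha> - 1 + \<beta> + 2 = \<alpha> + \<beta> + 1" "\<alpha> - 1 + 3 / 2 = \<alpha> + 1 / 2"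
    by (simp_all add: field_simps)
  have sq: "sqrt E > 0" using E by simp
  define z where "z = A / sqrt E"
  have z1: "z > 1"
  proof -
    have "sqrt E < sqrt (A\<^sup>2)" using E by (simp only: real_sqrt_less_iff)
    then show ?thesis using A sq by (simp add: z_def)
  qed
  have half: "rpow (sqrt E) e = rpow E (e / 2)" for e
    using E(1) by (rule rpow_sqrt)
  have zp: "complex_of_real z powr (\<alpha> + \<beta>) = rpow A (\<alpha> + \<beta>) / rpow E ((\<alpha> + \<beta>) / 2)"
    using z1 A sq powr_eq_rpow[of z] by (simp add: z_def rpow_divide half)
  have zz: "(z - 1) * (z + 1) = 1 / E"
  proof -
    have "(z - 1) * (z + 1) = z\<^sup>2 - 1" by (simp add: power2_eq_square algebra_simps)
    also have "z\<^sup>2 = (E + 1) / E" using E by (simp add: z_def power_divide)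
    finally show ?thesis using E by (simp add: field_simps)
  qed
  have "(of_real z - 1) powr (\<beta> / 2) * (of_real z + 1) powr (\<beta> / 2) = rpow ((z - 1) * (z + 1)) (\<beta> / 2)"
  proof -
    have "complex_of_real z - 1 = of_real (z - 1)" "complex_of_real z + 1 = of_real (z + 1)" by simp_all
    moreover have "z - 1 > 0" "z + 1 > 0" using z1 by simp_all
    ultimately show ?thesis by (simp only: powr_eq_rpow rpow_mult)
  qed
  also have "\<dots> = 1 / rpow E (\<beta> / 2)" unfolding zz using E by (simp add: rpow_divide)
  finally have zb: "(of_real z - 1) powr (\<beta> / 2) * (of_real z + 1) powr (\<beta> / 2) = 1 / rpow E (\<beta> / 2)" .
  have k: "rpow E (\<alpha> - 1 / 2) = rpow E ((\<alpha> - 1) / 2) / rpow E (\<beta> / 2) * rpow E ((\<alpha> + \<beta>) / 2)"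
    unfolding rpow_add[symmetric] rpow_diff[symmetric] by (rule arg_cong) (simp add: field_simps)
  show ?thesis
    unfolding legendre_Q_def par regF_kernel_arg[OF A] kern_def
    unfolding E_def[symmetric] z_def[symmetric] zp zb k powr_eq_rpow[OF E(1)] rpow_minus
    by (simp add: field_simps)
qed

lemma holomorphic2_on_const_mult:
  assumes F: "holomorphic2_on F S" and G: "holomorphic2_on G S"
  shows "holomorphic2_on (\<lambda>p. c * F p * G p) S"
  unfolding holomorphic2_on_def
proof
  fix p assume p: "p \<in> S"
  obtain a b where 1: "(F has_derivative (\<lambda>(h, k). a * h + b * k)) (at p)"
    using F p by (auto simp: holomorphic2_on_def)
  obtain a' b' where 2: "(G has_derivative (\<lambda>(h, k). a' * h + b' * k)) (at p)"
    using G p by (auto simp: holomorphic2_on_def)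
  have "((\<lambda>p. c * (F p * G p)) has_derivative
      (\<lambda>x. c * (F p * (case x of (h, k) \<Rightarrow> a' * h + b' * k) + (case x of (h, k) \<Rightarrow> a * h + b * k) * G p))) (at p)"
    by (intro has_derivative_mult_right has_derivative_mult 1 2)
  moreover have "(\<lambda>x. c * (F p * (case x of (h, k) \<Rightarrow> a' * h + b' * k) + (case x of (h, k) \<Rightarrow> a * h + b * k) * G p))
    = (\<lambda>(h, k). (c * (F p * a' + a * G p)) * h + (c * (F p * b' + b * G p)) * k)"
    by (auto simp: fun_eq_iff algebra_simps)
  moreover have "(\<lambda>p. c * (F p * G p)) = (\<lambda>p. c * F p * G p)" by (simp add: mult.assoc)
  ultimately have "((\<lambda>p. c * F p * G p) has_derivative
    (\<lambda>(h, k). (c * (F p * a' + a * G p)) * h + (c * (F p * b' + b * G p)) * k)) (at p)" by simp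
  then show "\<exists>a b. ((\<lambda>p. c * F p * G p) has_derivative (\<lambda>(h, k). a * h + b * k)) (at p)" by blast
qed

text \<open>No continuation under the integral sign takes place: the product formula, solved for I,
  supplies the witness. This rests on c \<noteq> 0 and on p having no zeros in
  \<open>cut_plane\<close>.\<close>

lemma continuation_quotient:
  assumes q': "continues1 q q'" and p: "p holomorphic_on cut_plane" "\<And>y. y \<in> cut_plane \<Longrightarrow> p y \<noteq> 0"
    and P: "\<And>y1 y2. y1 > 1 \<Longrightarrow> y2 > 1 \<Longrightarrow> P y1 y2 = p (of_real y1) * p (of_real y2)"
    and c: "c \<noteq> 0" and I: "\<And>y1 y2. y1 > 1 \<Longrightarrow> y2 > 1 \<Longrightarrow> q y1 * q y2 = c * P y1 y2 * I y1 y2"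
  shows "\<exists>J. continues2 I J"
proof
  have h: "q' holomorphic_on cut_plane" and r: "\<And>y. y > 1 \<Longrightarrow> q' (of_real y) = q y"
    using q' by (auto simp: continues1_def)
  have "holomorphic2_on (\<lambda>(x, y). (q' x / p x / c) * (q' y / p y)) (cut_plane \<times> cut_plane)"
    by (intro holomorphic2_on_prod holomorphic_intros h p c cut_plane(1))
  moreover have "q' (of_real y1) / p (of_real y1) / c * (q' (of_real y2) / p (of_real y2)) = I y1 y2"
    if y: "y1 > 1" "y2 > 1" for y1 y2
  proof -
    have nz: "p (of_real y1) \<noteq> 0" "p (of_real y2) \<noteq> 0" using p(2) cut_plane(3) y by simp_all
    have "q' (of_real y1) / p (of_real y1) / c * (q' (of_real y2) / p (of_real y2)) = (q y1 * q y2) / (c * P y1 y2)"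
      using y by (simp add: r P)
    also have "\<dots> = I y1 y2" unfolding I[OF y] using nz c y by (simp add: P)
    finally show ?thesis .
  qed
  ultimately show "continues2 I (\<lambda>(x, y). (q' x / p x / c) * (q' y / p y))" by (simp add: continues2_def)
qed

lemma continuation_identity:
  assumes q': "continues1 q q'" and P': "continues2 P P'" and I': "continues2 I I'"
    and I: "\<And>y1 y2. y1 > 1 \<Longrightarrow> y2 > 1 \<Longrightarrow> q y1 * q y2 = c * P y1 y2 * I y1 y2"
    and z: "z1 \<in> cut_plane" "z2 \<in> cut_plane"
  shows "q' z1 * q' z2 = c * P' (z1, z2) * I' (z1, z2)"
proof -
  have "(\<lambda>(x, y). q' x * q' y) (z1, z2) = (\<lambda>p. c * P' p * I' p) (z1, z2)"
  proof (rule cut_plane_identity[OF _ _ _ z])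
    show "holomorphic2_on (\<lambda>(x, y). q' x * q' y) (cut_plane \<times> cut_plane)"
      using q' by (intro holomorphic2_on_prod cut_plane(1)) (auto simp: continues1_def)
    show "holomorphic2_on (\<lambda>p. c * P' p * I' p) (cut_plane \<times> cut_plane)"
      using P' I' by (intro holomorphic2_on_const_mult) (auto simp: continues2_def)
  qed (use q' P' I' I in \<open>auto simp: continues1_def continues2_def\<close>)
  then show ?thesis by simp
qed

text \<open>Serves both forms at once: h is k times the \<open>kern\<close> integrand, and of the
  constants only the product c0 * k enters.\<close>

lemma product_formula_integrands:
  fixes \<alpha> \<beta> \<gamma> :: complex
  assumes y: "y1 > 1" "y2 > 1" and a: "Re \<alpha> > - 1 / 2" and bc: "Re (\<beta> + \<gamma>) > - 1" and c: "Re \<gamma> > 0"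
    and h: "\<And>y. y > lower_limit y1 y2 \<Longrightarrow> h y = k *
      (jacobi_Q \<gamma> \<alpha> \<beta> (of_real (2 * y\<^sup>2 - 1)) * of_real y powr (\<alpha> + \<beta>) * kern \<alpha> \<beta> (A_arg y1 y2 y))"
    and k: "c0 * k = of_real (sqrt pi) * Gamma (\<alpha> + \<gamma> + 1) / Gamma (\<gamma> + 1)"
  shows "set_integrable lborel {lower_limit y1 y2<..} h"
    and "jacobi_Q \<gamma> \<alpha> \<beta> (of_real (2 * y1\<^sup>2 - 1)) * jacobi_Q \<gamma> \<alpha> \<beta> (of_real (2 * y2\<^sup>2 - 1)) =
      c0 * power_factor \<alpha> \<beta> y1 y2 * (LINT y:{lower_limit y1 y2<..}|lborel. h y)"
proof -
  interpret two_points y1 y2 by unfold_locales (use y in auto)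
  let ?q = "\<lambda>y::real. jacobi_Q \<gamma> \<alpha> \<beta> (of_real (2 * y\<^sup>2 - 1))"
  let ?f = "\<lambda>y. ?q y * rpow y (\<alpha> + \<beta>) * kern \<alpha> \<beta> (A_arg y1 y2 y)"
  have eq: "h y = k * ?f y" if "y \<in> {lower_limit y1 y2<..}" for y
    using h[of y] gt_facts(1)[of y] that by (simp add: powr_eq_rpow)
  show "set_integrable lborel {lower_limit y1 y2<..} h"
    by (rule iffD2[OF set_integrable_cong[OF refl refl eq] set_integrable_mult_right[OF integrand_integrable(1)[OF a bc c]]])
  define I where "I = (LINT y:{lower_limit y1 y2<..}|lborel. ?f y)"
  have "(LINT y:{lower_limit y1 y2<..}|lborel. h y) = (LINT y:{lower_limit y1 y2<..}|lborel. k * ?f y)"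
    using eq by (intro set_lebesgue_integral_cong) auto
  then have hI: "(LINT y:{lower_limit y1 y2<..}|lborel. h y) = k * I" by (simp add: I_def)
  note PF = product_formula[OF a bc c, folded I_def]
  have nz: "Gamma (\<gamma> + 1) \<noteq> 0" using Re_pos_not_nonpos_Ints[of "\<gamma> + 1"] c by (simp add: Gamma_eq_zero_iff)
  have Y: "rpow (y1 * y2) (\<beta> - \<alpha> + 1) = 1 / rpow (y1 * y2) (\<alpha> - \<beta> - 1)"
    using rpow_minus[of "y1 * y2" "\<alpha> - \<beta> - 1"] by (simp add: algebra_simps)
  have "c0 * power_factor \<alpha> \<beta> y1 y2 * (k * I) = (c0 * k) * I * power_factor \<alpha> \<beta> y1 y2" by (simp only: mult_ac)
  also have "\<dots> = (of_real (sqrt pi) * Gamma (\<alpha> + \<gamma> + 1) * I) / Gamma (\<gamma> + 1) * power_factor \<alpha> \<beta> y1 y2"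
    unfolding k by simp
  also have "\<dots> = ?q y1 * ?q y2"
    unfolding PF power_factor_eq[OF y] Y using nz by simp
  finally show "?q y1 * ?q y2 = c0 * power_factor \<alpha> \<beta> y1 y2 * (LINT y:{lower_limit y1 y2<..}|lborel. h y)"
    unfolding hI by simp
qed

text \<open>The integrability clauses rule out that an integral has merely the default value 0, and
  the existence of all four continuations keeps the final universal statement from being vacuous.
  Since continuations are unique on \<open>cut_plane\<close>, quantifying over all of them expresses
  the convention for complex arguments. The two conditions on nonpositive integers say that Gamma
  (\<alpha> + \<beta>) and Gamma (\<beta> + 1/2) are defined.\<close>

theorem theorem29:
  fixes \<alpha> \<beta> \<gamma> :: complex
  assumes "\<alpha> \<noteq> 0" "\<beta> \<noteq> 0" "\<gamma> \<noteq> 0"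
    and "Re \<alpha> > - 1 / 2" "Re (\<beta> + \<gamma>) > - 1" "Re \<gamma> > 1"
    and "\<alpha> + \<beta> \<notin> \<int>\<^sub>\<le>\<^sub>0" "\<beta> + 1 / 2 \<notin> \<int>\<^sub>\<le>\<^sub>0"
  shows "let c_D = exp (- \<i> * of_real pi * (\<beta> + 1 / 2)) * 2 powr (\<alpha> + \<beta>) * of_real (sqrt pi)
                     * Gamma (\<beta> + 1 / 2) * Gamma (\<alpha> + \<gamma> + 1) / (Gamma (\<gamma> + 1) * Gamma (\<alpha> + \<beta>));
             c_Q = exp (- \<i> * of_real pi * \<beta>) * 2 powr \<alpha>
                     * Gamma (\<alpha> + \<gamma> + 1) / (Gamma (\<gamma> + 1) * Gamma (\<alpha> + \<beta>));
             q = (\<lambda>y::real. jacobi_Q \<gamma> \<alpha> \<beta> (of_real (2 * y\<^sup>2 - 1)))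
         in
           (\<forall>y1>1. \<forall>y2>1.
              set_integrable lborel {lower_limit y1 y2<..} (integrand_D \<alpha> \<beta> \<gamma> y1 y2) \<and>
              set_integrable lborel {lower_limit y1 y2<..} (integrand_Q \<alpha> \<beta> \<gamma> y1 y2) \<and>
              q y1 * q y2 = c_D * power_factor \<alpha> \<beta> y1 y2 * integral_D \<alpha> \<beta> \<gamma> y1 y2 \<and>
              q y1 * q y2 = c_Q * power_factor \<alpha> \<beta> y1 y2 * integral_Q \<alpha> \<beta> \<gamma> y1 y2) \<and>
           (\<exists>q'. continues1 q q') \<and>
           (\<exists>P. continues2 (power_factor \<alpha> \<beta>) P) \<and>
           (\<exists>I. continues2 (integral_D \<alpha> \<beta> \<gamma>) I) \<and>
           (\<exists>J. continues2 (integral_Q \<alpha> \<beta> \<gamma>) J) \<and>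
           (\<forall>q' P I J.
              continues1 q q' \<and> continues2 (power_factor \<alpha> \<beta>) P \<and>
              continues2 (integral_D \<alpha> \<beta> \<gamma>) I \<and> continues2 (integral_Q \<alpha> \<beta> \<gamma>) J \<longrightarrow>
              (\<forall>y1\<in>cut_plane. \<forall>y2\<in>cut_plane.
                 q' y1 * q' y2 = c_D * P (y1, y2) * I (y1, y2) \<and>
                 q' y1 * q' y2 = c_Q * P (y1, y2) * J (y1, y2)))"
proof -
  define c_D where "c_D = exp (- \<i> * of_real pi * (\<beta> + 1 / 2)) * 2 powr (\<alpha> + \<beta>) * of_real (sqrt pi)
                     * Gamma (\<beta> + 1 / 2) * Gamma (\<alpha> + \<gamma> + 1) / (Gamma (\<gamma> + 1) * Gamma (\<alpha> + \<beta>))"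
  define c_Q where "c_Q = exp (- \<i> * of_real pi * \<beta>) * 2 powr \<alpha>
                     * Gamma (\<alpha> + \<gamma> + 1) / (Gamma (\<gamma> + 1) * Gamma (\<alpha> + \<beta>))"
  define q where "q = (\<lambda>y::real. jacobi_Q \<gamma> \<alpha> \<beta> (of_real (2 * y\<^sup>2 - 1)))"
  \<comment> \<open>\<open>k_D\<close> and \<open>k_Q\<close> are the constants of
    \<open>gegenbauer_kernel\<close> and \<open>legendre_kernel\<close>. Against \<open>c_D\<close>
    and \<open>c_Q\<close> the exponentials, the powers of 2 and all Gamma values involving \<beta>
    cancel, so both products are the same constant.\<close>
  define k_D where "k_D = exp (\<i> * of_real pi * (\<beta> + 1 / 2)) * Gamma (\<alpha> + \<beta>) / (Gamma (\<beta> + 1 / 2) * 2 powr (\<alpha> + \<beta>))"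
  define k_Q where "k_Q = of_real (sqrt pi) * exp (\<i> * of_real pi * \<beta>) * Gamma (\<alpha> + \<beta>) / 2 powr \<alpha>"
  have c: "Re \<gamma> > 0" and ac: "Re (\<alpha> + \<gamma>) > - 1" using assms(4,6) by simp_all
  have nz: "Gamma (\<alpha> + \<beta>) \<noteq> 0" "Gamma (\<beta> + 1 / 2) \<noteq> 0" "Gamma (\<gamma> + 1) \<noteq> 0" "Gamma (\<alpha> + \<gamma> + 1) \<noteq> 0"
    using assms(7,8) Re_pos_not_nonpos_Ints[of "\<gamma> + 1"] Re_pos_not_nonpos_Ints[of "\<alpha> + \<gamma> + 1"] c ac
    by (auto simp: Gamma_eq_zero_iff)
  have cnz: "c_D \<noteq> 0" "c_Q \<noteq> 0" using nz by (simp_all add: c_D_def c_Q_def)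
  have e: "exp (- \<i> * of_real pi * z) * exp (\<i> * of_real pi * z) = 1" for z
    by (simp flip: exp_add)
  have ck: "c_D * k_D = of_real (sqrt pi) * Gamma (\<alpha> + \<gamma> + 1) / Gamma (\<gamma> + 1)"
  proof -
    have "c_D * k_D = (exp (- \<i> * of_real pi * (\<beta> + 1 / 2)) * exp (\<i> * of_real pi * (\<beta> + 1 / 2))) *
      (of_real (sqrt pi) * Gamma (\<alpha> + \<gamma> + 1) / Gamma (\<gamma> + 1))"
      unfolding c_D_def k_D_def using nz by (simp add: field_simps)
    then show ?thesis unfolding e by simp
  qed
  have ck': "c_Q * k_Q = of_real (sqrt pi) * Gamma (\<alpha> + \<gamma> + 1) / Gamma (\<gamma> + 1)"
  proof -
    have "c_Q * k_Q = (exp (- \<i> * of_real pi * \<beta>) * exp (\<i> * of_real pi * \<beta>)) *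
      (of_real (sqrt pi) * Gamma (\<alpha> + \<gamma> + 1) / Gamma (\<gamma> + 1))"
      unfolding c_Q_def k_Q_def using nz by (simp add: field_simps)
    then show ?thesis unfolding e by simp
  qed
  have iD: "integrand_D \<alpha> \<beta> \<gamma> y1 y2 y = k_D *
      (jacobi_Q \<gamma> \<alpha> \<beta> (of_real (2 * y\<^sup>2 - 1)) * of_real y powr (\<alpha> + \<beta>) * kern \<alpha> \<beta> (A_arg y1 y2 y))"
    and iQ: "integrand_Q \<alpha> \<beta> \<gamma> y1 y2 y = k_Q *
      (jacobi_Q \<gamma> \<alpha> \<beta> (of_real (2 * y\<^sup>2 - 1)) * of_real y powr (\<alpha> + \<beta>) * kern \<alpha> \<beta> (A_arg y1 y2 y))"
    if "y1 > 1" "y2 > 1" "y > lower_limit y1 y2" for y1 y2 y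
    using gegenbauer_kernel[OF A_arg_gt_1(1)[OF that], of \<alpha> \<beta>] legendre_kernel[OF A_arg_gt_1(1)[OF that], of \<alpha> \<beta>]
    unfolding integrand_D_def integrand_Q_def Let_def k_D_def k_Q_def mult.assoc by (simp_all only: mult_ac)
  note RD = product_formula_integrands[OF _ _ assms(4,5) c iD ck, folded integral_D_def]
  note RQ = product_formula_integrands[OF _ _ assms(4,5) c iQ ck', folded integral_Q_def]
  have D: "q y1 * q y2 = c_D * power_factor \<alpha> \<beta> y1 y2 * integral_D \<alpha> \<beta> \<gamma> y1 y2" if "y1 > 1" "y2 > 1" for y1 y2
    using RD(2)[OF that that] by (simp add: q_def)
  have Q: "q y1 * q y2 = c_Q * power_factor \<alpha> \<beta> y1 y2 * integral_Q \<alpha> \<beta> \<gamma> y1 y2" if "y1 > 1" "y2 > 1" for y1 y2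
    using RQ(2)[OF that that] by (simp add: q_def)
  obtain q' where q': "continues1 q q'" unfolding q_def using jacobi_Q_continuation[OF ac assms(5)] by blast
  obtain p where p: "p holomorphic_on cut_plane" "\<And>y. y \<in> cut_plane \<Longrightarrow> p y \<noteq> 0"
    "\<And>y1 y2. y1 > 1 \<Longrightarrow> y2 > 1 \<Longrightarrow> power_factor \<alpha> \<beta> y1 y2 = p (of_real y1) * p (of_real y2)"
    by (rule power_factor_continuation) (rule that)
  have "continues2 (power_factor \<alpha> \<beta>) (\<lambda>(x, y). p x * p y)"
    unfolding continues2_def using p(3) holomorphic2_on_prod[OF p(1) cut_plane(1) p(1) cut_plane(1)] by simp
  moreover note continuation_quotient[OF q' p cnz(1) D] continuation_quotient[OF q' p cnz(2) Q]
  moreover have "q' y1 * q' y2 = c_D * P (y1, y2) * I (y1, y2) \<and> q' y1 * q' y2 = c_Q * P (y1, y2) * J (y1, y2)"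
    if "continues1 q q'" "continues2 (power_factor \<alpha> \<beta>) P" "continues2 (integral_D \<alpha> \<beta> \<gamma>) I"
      "continues2 (integral_Q \<alpha> \<beta> \<gamma>) J" "y1 \<in> cut_plane" "y2 \<in> cut_plane" for q' P I J y1 y2
    using continuation_identity[OF that(1,2,3) D that(5,6)] continuation_identity[OF that(1,2,4) Q that(5,6)] by blast
  ultimately show ?thesis
    unfolding Let_def c_D_def[symmetric] c_Q_def[symmetric] q_def[symmetric]
    using RD(1) RQ(1) D Q q' by blast
qed

end
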